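(* Let $G=\mathbb Z_p^d$ with $p$ prime, where $p=p_N$, $d=d_N$ and $k=k_N\ge d_N$ are sequences (indexed by $N\to\infty$) with $|G|=p^d\to\infty$. Assume that $1\ll k\lesssim\log|G|=d\log p$. Let $Z_1,\dots,Z_k$ be i.i.d. uniform on $G$ and let $G_k$ be the (directed or undirected) Cayley graph they generate. Let $t_0=t_0(k,p,d)$ be the time at which the entropy of the rate-1 random walk on $\mathbb Z_p^k$ is $\log(p^d)$. Then, with high probability, the random walk on $G_k$ exhibits cutoff at time $t_0$ conditional on generating the group, i.e. on $\langle Z_1,\dots,Z_k\rangle=G$. Further, if $(k-d)p\gg1$, then the group is generated by $Z_1,\dots,Z_k$ with high probability.
   Context: Asymptotic notation is along the sequence: $a\ll b$ means $a/b\to0$; $a\lesssim b$ means $a/b$ is bounded. "With high probability" means with probability tending to 1. Random walk on a Cayley graph: the continuous-time, rate-1 random walk on the directed Cayley graph of the Abelian group $G$ generated by $Z=[Z_1,\dots,Z_k]$, started from the identity, jumps at rate 1; at each jump $i\in\{1,\dots,k\}$ is chosen uniformly and $Z_i$ is added to the current position. In the undirected case, $Z_i$ or $-Z_i$ is added, with probability $\frac12$ each. Cutoff at $t_0$ with high probability (for a random graph) means: for all fixed $\varepsilon\in(0,1)$, the total variation distance between the law of the walk given $Z$ and the uniform distribution on $G$ (a random variable, a function of $Z$) converges in distribution to $0$ at time $(1+\varepsilon)t_0$ and to $1$ at time $(1-\varepsilon)t_0$. "Conditional on generating the group" means that this is under the law of $Z$ conditioned on $\langle Z_1,\dots,Z_k\rangle=G$.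 The rate-1 random walk on $\mathbb Z_p^k$ starts from $0$ and at rate 1 a uniformly chosen coordinate is changed (mod $p$), by $+1$ in the directed case, and by $\pm1$ with probability $\frac12$ each in the undirected case. Its entropy at time $t$ is the Shannon entropy (natural logarithm) of its law at time $t$; this is a strictly increasing bijection from $[0,\infty)$ to $[0,\log(p^k))$.
   Formalization: The cutoff claim is stated under the extra condition that d < k for all large N, since for k = d the entropy of the walk on Z_p^k never reaches log(p^d) and t_0 does not exist. *)

theory Defs
  imports
    "HOL-Probability.Probability"
    "HOL-Algebra.Product_Groups"
    "HOL-Computational_Algebra.Primes"
    "HOL-Library.Landau_Symbols"
begin

section \<open>Rate-1 random walks\<close>

datatype orientation = Directed | Undirected

text \<open>The number of jumps made up to time \<open>t\<close> by a rate-1 jump process.  The library's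
  \<^const>\<open>poisson_pmf\<close> is only specified for a positive parameter, whence the case \<open>t = 0\<close>.\<close>

definition jump_count :: "real \<Rightarrow> nat pmf" where
  "jump_count t = (if t > 0 then poisson_pmf t else return_pmf 0)"

primrec jump_chain :: "('a \<Rightarrow> 'a pmf) \<Rightarrow> 'a \<Rightarrow> nat \<Rightarrow> 'a pmf" where
  "jump_chain K x 0 = return_pmf x"
| "jump_chain K x (Suc n) = bind_pmf (jump_chain K x n) K"

text \<open>Law at time \<open>t\<close> of the continuous-time chain started from \<open>x\<close> that makes jumps with
  transition kernel \<open>K\<close> at rate 1.\<close>

definition walk_law :: "('a \<Rightarrow> 'a pmf) \<Rightarrow> 'a \<Rightarrow> real \<Rightarrow> 'a pmf" where
  "walk_law K x t = bind_pmf (jump_count t) (jump_chain K x)"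

section \<open>The walk on a random Cayley graph\<close>

text \<open>Generators are \<open>Z 0, \<dots>, Z (k - 1)\<close>.\<close>

definition cayley_step ::
    "orientation \<Rightarrow> ('a, 'b) monoid_scheme \<Rightarrow> nat \<Rightarrow> (nat \<Rightarrow> 'a) \<Rightarrow> 'a \<Rightarrow> 'a pmf" where
  "cayley_step \<sigma> G k Z x = do {
     i \<leftarrow> pmf_of_set {..<k};
     case \<sigma> of
       Directed \<Rightarrow> return_pmf (x \<otimes>\<^bsub>G\<^esub> Z i)
     | Undirected \<Rightarrow> do {
         b \<leftarrow> bernoulli_pmf (1 / 2);
         return_pmf (x \<otimes>\<^bsub>G\<^esub> (if b then Z i else inv\<^bsub>G\<^esub> (Z i)))
       }
   }"

definition cayley_walk ::
    "orientation \<Rightarrow> ('a, 'b) monoid_scheme \<Rightarrow> nat \<Rightarrow> (nat \<Rightarrow> 'a) \<Rightarrow> real \<Rightarrow> 'a pmf" where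
  "cayley_walk \<sigma> G k Z t = walk_law (cayley_step \<sigma> G k Z) \<one>\<^bsub>G\<^esub> t"

definition tv_dist :: "'a pmf \<Rightarrow> 'a pmf \<Rightarrow> real" where
  "tv_dist \<mu> \<nu> = (SUP A. \<bar>measure_pmf.prob \<mu> A - measure_pmf.prob \<nu> A\<bar>)"

definition tv_to_uniform ::
    "orientation \<Rightarrow> ('a, 'b) monoid_scheme \<Rightarrow> nat \<Rightarrow> real \<Rightarrow> (nat \<Rightarrow> 'a) \<Rightarrow> real" where
  "tv_to_uniform \<sigma> G k t Z = tv_dist (cayley_walk \<sigma> G k Z t) (pmf_of_set (carrier G))"

definition iid_uniform :: "('a, 'b) monoid_scheme \<Rightarrow> nat \<Rightarrow> (nat \<Rightarrow> 'a) pmf" where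
  "iid_uniform G k = Pi_pmf {..<k} undefined (\<lambda>_. pmf_of_set (carrier G))"

definition generating :: "('a, 'b) monoid_scheme \<Rightarrow> nat \<Rightarrow> (nat \<Rightarrow> 'a) set" where
  "generating G k = {Z. generate G (Z ` {..<k}) = carrier G}"

definition iid_uniform_generating :: "('a, 'b) monoid_scheme \<Rightarrow> nat \<Rightarrow> (nat \<Rightarrow> 'a) pmf" where
  "iid_uniform_generating G k = cond_pmf (iid_uniform G k) (generating G k)"

section \<open>Cutoff\<close>

definition tends_in_distribution_to_const ::
    "(nat \<Rightarrow> 'z pmf) \<Rightarrow> (nat \<Rightarrow> 'z \<Rightarrow> real) \<Rightarrow> real \<Rightarrow> bool" where
  "tends_in_distribution_to_const M X c \<longleftrightarrow>
     weak_conv_m (\<lambda>N. distr (measure_pmf (M N)) borel (X N)) (return borel c)"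

text \<open>\<open>L N\<close> is the law of the random graph with index \<open>N\<close>, and \<open>D N t\<close> is the distance to
  equilibrium at time \<open>t\<close> as a random variable on it.\<close>

definition cutoff_whp ::
    "(nat \<Rightarrow> 'z pmf) \<Rightarrow> (nat \<Rightarrow> real \<Rightarrow> 'z \<Rightarrow> real) \<Rightarrow> (nat \<Rightarrow> real) \<Rightarrow> bool" where
  "cutoff_whp L D t0 \<longleftrightarrow> (\<forall>\<epsilon>. 0 < \<epsilon> \<and> \<epsilon> < 1 \<longrightarrow>
     tends_in_distribution_to_const L (\<lambda>N. D N ((1 + \<epsilon>) * t0 N)) 0 \<and>
     tends_in_distribution_to_const L (\<lambda>N. D N ((1 - \<epsilon>) * t0 N)) 1)"

section \<open>The group and the entropic time\<close>

definition Zpow :: "nat \<Rightarrow> nat \<Rightarrow> (nat \<Rightarrow> int) monoid" where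
  "Zpow p d = product_group {..<d} (\<lambda>_. integer_mod_group p)"

definition coordinate_step ::
    "orientation \<Rightarrow> nat \<Rightarrow> nat \<Rightarrow> (nat \<Rightarrow> int) \<Rightarrow> (nat \<Rightarrow> int) pmf" where
  "coordinate_step \<sigma> p k x = do {
     i \<leftarrow> pmf_of_set {..<k};
     case \<sigma> of
       Directed \<Rightarrow> return_pmf (x(i := (x i + 1) mod int p))
     | Undirected \<Rightarrow> do {
         b \<leftarrow> bernoulli_pmf (1 / 2);
         return_pmf (x(i := (x i + (if b then 1 else - 1)) mod int p))
       }
   }"

definition coordinate_walk :: "orientation \<Rightarrow> nat \<Rightarrow> nat \<Rightarrow> real \<Rightarrow> (nat \<Rightarrow> int) pmf" where
  "coordinate_walk \<sigma> p k t = walk_law (coordinate_step \<sigma> p k) \<one>\<^bsub>Zpow p k\<^esub> t"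

text \<open>Shannon entropy with natural logarithm, as the library's entropy of the identity random
  variable; the lemma below gives the usual formula.\<close>

definition shannon_entropy :: "'a pmf \<Rightarrow> real" where
  "shannon_entropy \<mu> =
     prob_space.entropy (measure_pmf \<mu>) (exp 1) (count_space UNIV) (\<lambda>x. x)"

lemma shannon_entropy_eq:
  "shannon_entropy \<mu> = - measure_pmf.expectation \<mu> (\<lambda>x. ln (pmf \<mu> x))"
proof -
  let ?C = "count_space (UNIV :: 'a set)"
  have dist: "distr (measure_pmf \<mu>) ?C (\<lambda>x. x) = measure_pmf \<mu>"
    by (rule measure_eqI) (auto simp: emeasure_distr)
  let ?f = "RN_deriv ?C (measure_pmf \<mu>)"
  have *: "density ?C ?f = measure_pmf \<mu>"
    by (rule density_RN_deriv_density[of "\<lambda>x. ennreal (pmf \<mu> x)" ?C, folded measure_pmf_eq_density])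
       simp
  have f: "?f x = ennreal (pmf \<mu> x)" for x
  proof -
    have "emeasure (density ?C ?f) {x} = (\<integral>\<^sup>+y. ?f x * indicator {x} y \<partial>?C)"
      by (subst emeasure_density) (auto intro!: nn_integral_cong simp: indicator_def)
    also have "\<dots> = ?f x"
      by (subst nn_integral_cmult_indicator) auto
    finally show ?thesis by (simp add: * emeasure_pmf_single)
  qed
  show ?thesis
    unfolding shannon_entropy_def prob_space.entropy_def[OF prob_space_measure_pmf] KL_divergence_def dist
    by (simp add: entropy_density_def comp_def f log_def)
qed

text \<open>By strict monotonicity of the entropy in time, such a time is unique; for \<open>d > 0\<close> it
  exists iff \<open>d < k\<close>.\<close>

definition entropic_time :: "orientation \<Rightarrow> nat \<Rightarrow> nat \<Rightarrow> nat \<Rightarrow> real" where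
  "entropic_time \<sigma> k p d =
     (THE t. 0 \<le> t \<and> shannon_entropy (coordinate_walk \<sigma> p k t) = ln (real (p ^ d)))"

end

theory Submission
  imports Defs "HOL-Real_Asymp.Real_Asymp"
begin

text \<open>The position of the walk on the Cayley graph is \<open>Z W\<close>, the image of the walk \<open>W\<close> on
  \<open>\<int>\<^sub>p\<^sup>k\<close> under the linear map with columns \<open>Z\<^sub>i\<close>.  The coordinates of \<open>W\<close> are independent, so
  \<open>- ln\<close> of the probability of \<open>W\<close> concentrates around the entropy \<open>k H\<close>.  Shortly before \<open>t\<^sub>0\<close> this puts
  \<open>W\<close>, hence \<open>Z W\<close>, on a set of size \<open>o(p\<^sup>d)\<close>.  Shortly after \<open>t\<^sub>0\<close> the law of \<open>W\<close>, restricted to typical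
  points, has squared \<open>l\<^sup>2\<close> norm \<open>o(p\<^sup>-\<^sup>d)\<close>; since distinct points have the same image with probability
  at most \<open>p\<^sup>-\<^sup>d\<close>, the law of \<open>Z W\<close> is close to uniform.  When \<open>k - d\<close> is so small that this fails,
  \<open>W\<close> itself is already close to uniform, and so is its image if \<open>Z\<close> generates.

  The estimates must be uniform in \<open>p\<close>.  Let \<open>g = 1 - cos (2 \<pi> / p)\<close> be the spectral gap and \<open>s\<close> the time per
  coordinate.  Up to constants, the varentropy of a coordinate is at most \<open>exp (- 2 g s)\<close>, and its
  entropy grows by at least \<open>exp (- 2 g s)\<close> between \<open>s\<close> and \<open>(1 + \<delta>) s\<close>.  The latter
  holds because the entropy production is at least the squared Hellinger distance of the law to its
  shift, which is bounded below by any single Fourier coefficient.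

  The same second moment computation for \<open>W\<close> uniform bounds the probability that \<open>Z\<close> does not
  generate by \<open>p\<^sup>d / p\<^sup>k\<close>.  This is at most \<open>1 / 2\<close> if \<open>d < k\<close>, so conditioning on
  generation costs a factor of at most 2.\<close>

section \<open>Harmonic analysis on the cycle\<close>

text \<open>The quantity that decides between the arguments is \<open>y0\<close>, that is k exp (-2
  g s0). From s0 to (1 + \<epsilon>) s0 the entropy of the whole walk grows by at least a constant
  times \<open>y0\<close>, while its varentropy is at most a constant times \<open>y0\<close>, so
  the Chebyshev error is of order 1 / \<open>y0\<close>. This is small only for large
  \<open>y0\<close>, which can fail when k - d is bounded: k - d \<ge> 1 merely keeps
  \<open>y0\<close> away from 0. At (1 - \<epsilon>) s0 the corresponding scale is k^\<epsilon>
  times \<open>y0\<close>^(1 - \<epsilon>) and tends to infinity in any case. At (1 + \<epsilon>) s0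
  with \<open>y0\<close> bounded, k times the chi-square distance of one coordinate is of order
  \<open>y0\<close>^(1 + \<epsilon>) / k^\<epsilon> and tends to 0. The constants depend on a lower
  bound for s0. The bound k \<le> C log |G| supplies it: the entropy per coordinate at s0 is at
  least 1 / C. The time p^2 separates the diffusive regime, where the law has width sqrt s, from the
  regime where the first Fourier mode dominates.\<close>

lemma sin_ge_two_div_pi_mult:
  assumes "0 \<le> x" "x \<le> pi / 2"
  shows "2 / pi * x \<le> sin x"
proof -
  \<comment> \<open>Concavity of sin puts its graph above the chord over [0, pi / 2].\<close>
  have "convex_on {0..pi/2} (\<lambda>x. - sin x)"
    by (rule f''_ge0_imp_convex[where f' = "\<lambda>x. - cos x" and f'' = "\<lambda>x. sin x"])
       (auto intro!: derivative_eq_intros sin_ge_zero)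
  from convex_onD[OF this, of "2 / pi * x" 0 "pi / 2"] assms
  show ?thesis by (simp add: field_simps)
qed

text \<open>With w = sqrt u this is |2 ln w| \<le> |w - 1 / w|, multiplied by w and squared. For a
  density u = \<nu> / q it bounds the second moment of ln u under \<nu> by the chi-square distance
  of \<nu> from q.\<close>

lemma mult_ln_power2_le:
  assumes "0 < (u::real)"
  shows "u * (ln u)\<^sup>2 \<le> (u - 1)\<^sup>2"
proof -
  \<comment> \<open>The function has derivative (1 - 1 / x)^2 and vanishes at 1, which settles both
    sides of 1.\<close>
  have mono: "x - 1 / x - 2 * ln x \<le> y - 1 / y - 2 * ln y" if "0 < x" "x \<le> y" for x y :: real
  proof (rule DERIV_nonneg_imp_nondecreasing[OF that(2)])
    fix w assume "x \<le> w" "w \<le> y"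
    then have w: "0 < w" using that by simp
    have "((\<lambda>x. x - 1 / x - 2 * ln x) has_real_derivative (1 - 1 / w)\<^sup>2) (at w)"
      using w by (auto intro!: derivative_eq_intros simp: field_simps power2_eq_square)
    then show "\<exists>D. ((\<lambda>x. x - 1 / x - 2 * ln x) has_real_derivative D) (at w) \<and> 0 \<le> D"
      by (intro exI[of _ "(1 - 1 / w)\<^sup>2"]) simp
  qed
  define w where "w = sqrt u"
  have w: "0 < w" "u = w\<^sup>2" using assms by (simp_all add: w_def)
  have ln_u: "ln u = 2 * ln w" using w by (simp add: ln_realpow)
  have "\<bar>2 * ln w\<bar> \<le> \<bar>w - 1 / w\<bar>"
  proof (cases "1 \<le> w")
    case True
    have "0 \<le> ln w" "1 / w \<le> 1" using True by auto
    then show ?thesis using mono[of 1 w] True by simp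
  next
    case False
    have "ln w \<le> 0" "1 \<le> 1 / w" using False w by auto
    then show ?thesis using mono[of w 1] False w by simp
  qed
  then have "w * \<bar>ln u\<bar> \<le> w * \<bar>w - 1 / w\<bar>"
    unfolding ln_u using w(1) by (intro mult_left_mono) auto
  also have "\<dots> = \<bar>u - 1\<bar>"
  proof -
    have "w * \<bar>w - 1 / w\<bar> = \<bar>w * (w - 1 / w)\<bar>" using w by (simp add: abs_mult)
    also have "w * (w - 1 / w) = u - 1" using w by (simp add: field_simps power2_eq_square)
    finally show ?thesis .
  qed
  finally have "(w * \<bar>ln u\<bar>)\<^sup>2 \<le> \<bar>u - 1\<bar>\<^sup>2"
    using w by (intro power_mono) auto
  then show ?thesis by (simp add: power_mult_distrib w(2))
qed

section \<open>Characters of the cycle and the spectral gap\<close>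

locale cycle =
  fixes p :: nat
  assumes p_ge_2: "2 \<le> p"
begin

abbreviation P :: "int set" where "P \<equiv> {0..<int p}"

definition chi :: "int \<Rightarrow> complex" where
  "chi y = cis (2 * pi * of_int y / of_nat p)"

text \<open>In frequency, this is the decay rate of the Fourier coefficient at y, the same for both
  orientations. In space, it serves as a squared distance from 0 on the cycle, comparable to (y /
  p)^2.\<close>

definition phi :: "int \<Rightarrow> real" where
  "phi y = 1 - cos (2 * pi * of_int y / of_nat p)"

definition gap :: real where "gap = phi 1"

lemma p_pos [simp]: "0 < p" using p_ge_2 by simp

lemma chi_add: "chi (x + y) = chi x * chi y"
  by (simp add: chi_def cis_mult add_divide_distrib ring_distribs)

lemma chi_0 [simp]: "chi 0 = 1"
  by (simp add: chi_def)

lemma chi_minus: "chi (- x) = cnj (chi x)"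
  by (simp add: chi_def cis_cnj)

lemma chi_diff: "chi (x - y) = chi x * cnj (chi y)"
  using chi_add[of x "- y"] by (simp add: chi_minus)

lemma norm_chi [simp]: "cmod (chi x) = 1"
  by (simp add: chi_def)

lemma Re_chi: "Re (chi x) = 1 - phi x"
  by (simp add: chi_def phi_def)

lemma chi_mult_p [simp]: "chi (int p * x) = 1"
proof -
  have "2 * pi * of_int (int p * x) / of_nat p = 2 * pi * of_int x"
    using p_ge_2 by simp
  then show ?thesis unfolding chi_def
    by (metis cis_multiple_2pi Ints_of_int)
qed

lemma chi_mod [simp]: "chi (x mod int p) = chi x"
  by (metis chi_add chi_mult_p mult.right_neutral mod_mult_div_eq)

lemma chi_mult_mod: "chi (a * (x mod int p)) = chi (a * x)"
  by (metis chi_mod mod_mult_right_eq)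

lemma phi_mod [simp]: "phi (x mod int p) = phi x"
  using Re_chi[of x] Re_chi[of "x mod int p"] by simp

lemma phi_minus: "phi (- x) = phi x"
  by (simp add: phi_def)

lemma phi_nonneg: "0 \<le> phi x"
  by (simp add: phi_def)

lemma phi_le_2: "phi x \<le> 2"
  using cos_ge_minus_one[of "2 * pi * of_int x / of_nat p"] by (simp add: phi_def)

lemma phi_0 [simp]: "phi 0 = 0"
  by (simp add: phi_def)

lemma phi_sin: "phi x = 2 * (sin (pi * of_int x / of_nat p))\<^sup>2"
  using cos_double_sin[of "pi * of_int x / of_nat p"] by (simp add: phi_def mult.assoc)

lemma phi_upper: "phi x \<le> 2 * pi\<^sup>2 * (of_int x)\<^sup>2 / (real p)\<^sup>2"
proof -
  have "\<bar>sin (pi * of_int x / of_nat p)\<bar>\<^sup>2 \<le> \<bar>pi * of_int x / of_nat p\<bar>\<^sup>2"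
    by (intro power_mono abs_sin_x_le_abs_x) auto
  then show ?thesis by (simp add: phi_sin power_divide power_mult_distrib)
qed

lemma phi_lower:
  assumes "\<bar>2 * x\<bar> \<le> int p"
  shows "8 * (of_int x)\<^sup>2 / (real p)\<^sup>2 \<le> phi x"
proof -
  have *: "8 * (of_int x)\<^sup>2 / (real p)\<^sup>2 \<le> phi x" if "0 \<le> x" "2 * x \<le> int p" for x
  proof -
    have r: "2 * real_of_int x \<le> real p" using that(2) by linarith
    have "2 / pi * (pi * of_int x / of_nat p) \<le> sin (pi * of_int x / of_nat p)"
      using that(1) r by (intro sin_ge_two_div_pi_mult) (auto simp: field_simps)
    then have "2 * of_int x / real p \<le> sin (pi * of_int x / of_nat p)" by simp
    then have "(2 * of_int x / real p)\<^sup>2 \<le> (sin (pi * of_int x / of_nat p))\<^sup>2"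
      using that(1) by (intro power_mono) auto
    then show ?thesis by (simp add: phi_sin power_divide power_mult_distrib)
  qed
  show ?thesis
    using *[of x] *[of "-x"] assms by (cases "0 \<le> x") (auto simp: phi_minus)
qed

lemma gap_lower: "8 / (real p)\<^sup>2 \<le> gap"
  using phi_lower[of 1] p_ge_2 by (simp add: gap_def)

lemma gap_upper: "gap \<le> 2 * pi\<^sup>2 / (real p)\<^sup>2"
  using phi_upper[of 1] by (simp add: gap_def)

lemma gap_pos: "0 < gap"
  using gap_lower by (rule less_le_trans[rotated]) auto

lemma gap_le_phi:
  assumes "x \<in> P" "x \<noteq> 0"
  shows "gap \<le> phi x"
proof -
  have *: "gap \<le> phi x" if "1 \<le> x" "2 * x \<le> int p" for x
  proof -
    have "2 * pi * of_int x \<le> pi * real p"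
      using that by (metis mult.assoc mult.commute mult_left_mono of_int_le_iff of_int_mult of_int_numeral of_int_of_nat_eq pi_ge_zero)
    then have "cos (2 * pi * of_int x / real p) \<le> cos (2 * pi * of_int 1 / real p)"
      using that by (intro cos_monotone_0_pi_le) (auto simp: field_simps)
    then show ?thesis by (simp add: gap_def phi_def)
  qed
  \<comment> \<open>The reflection of x to p - x reduces to angles in [0, pi], where cos
    decreases.\<close>
  have "phi (int p - x) = phi x"
    using phi_mod[of "int p - x"] phi_mod[of "-x"] phi_minus[of x] by (metis minus_mod_self1)
  with *[of x] *[of "int p - x"] assms show ?thesis by fastforce
qed

lemma periodic_sum_shift:
  fixes f :: "int \<Rightarrow> 'a :: comm_monoid_add"
  assumes "\<And>x. f (x mod int p) = f x"
  shows "(\<Sum>x\<in>P. f (x + m)) = (\<Sum>x\<in>P. f x)"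
proof -
  have "(\<Sum>x\<in>P. f (x + m)) = (\<Sum>x\<in>P. f ((x + m) mod int p))" by (simp add: assms)
  also have "\<dots> = (\<Sum>x\<in>P. f x)"
  proof (rule sum.reindex_bij_witness[where i = "\<lambda>x. (x - m) mod int p" and j = "\<lambda>x. (x + m) mod int p"])
  qed (auto simp: mod_simps)
  finally show ?thesis .
qed

lemma sum_chi: "(\<Sum>j\<in>P. chi (j * y)) = (if int p dvd y then of_nat p else 0)"
proof (cases "int p dvd y")
  case True
  then have "chi (j * y) = 1" for j
    by (metis chi_mult_p dvd_def mult.left_commute)
  then show ?thesis using True by simp
next
  case False
  \<comment> \<open>Otherwise \<open>phi y = 0\<close>, against the positive gap.\<close>
  have "chi y \<noteq> 1"
  proof
    assume "chi y = 1"
    then have "phi y = 0" using Re_chi[of y] by simp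
    then have "phi (y mod int p) = 0" by simp
    moreover have "y mod int p \<in> P" "y mod int p \<noteq> 0" using False by (auto simp: dvd_eq_mod_eq_0)
    ultimately show False using gap_le_phi gap_pos by fastforce
  qed
  \<comment> \<open>Multiplication by \<open>chi y\<close> only shifts the summation index, so the
    sum is fixed by a factor other than 1.\<close>
  have "chi y * (\<Sum>j\<in>P. chi (j * y)) = (\<Sum>j\<in>P. chi ((j + 1) * y))"
    by (simp add: sum_distrib_left ring_distribs chi_add mult.commute)
  also have "\<dots> = (\<Sum>j\<in>P. chi (j * y))"
    by (rule periodic_sum_shift) (metis chi_mult_mod mult.commute)
  finally have "(chi y - 1) * (\<Sum>j\<in>P. chi (j * y)) = 0" by (simp add: algebra_simps)
  then show ?thesis using \<open>chi y \<noteq> 1\<close> False by simp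
qed

section \<open>Sums of Lorentzian profiles over the cycle\<close>

lemma sum_resolvent_half:
  fixes a :: real
  assumes "0 < a"
  shows "(\<Sum>j\<in>{1..n}. 1 / (1 + a * (real j)\<^sup>2)) \<le> pi / 2 / sqrt a"
proof -
  \<comment> \<open>Comparison with the integral: each summand is at most the increment of the
    primitive over [n, n + 1], evaluated by the mean value theorem.\<close>
  have "(\<Sum>j\<in>{1..n}. 1 / (1 + a * (real j)\<^sup>2)) \<le> arctan (sqrt a * real n) / sqrt a"
  proof (induction n)
    case (Suc n)
    have "\<exists>z. real n < z \<and> z < real n + 1 \<and>
        arctan (sqrt a * (real n + 1)) / sqrt a - arctan (sqrt a * real n) / sqrt a
          = (real n + 1 - real n) * (1 / (1 + a * z\<^sup>2))"
    proof (rule MVT2)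
      fix x :: real
      show "((\<lambda>x. arctan (sqrt a * x) / sqrt a) has_real_derivative 1 / (1 + a * x\<^sup>2)) (at x)"
        using assms by (auto intro!: derivative_eq_intros simp: power_mult_distrib divide_inverse mult_ac)
    qed simp
    then obtain z where z: "real n < z" "z < real n + 1"
      "arctan (sqrt a * (real n + 1)) / sqrt a - arctan (sqrt a * real n) / sqrt a = 1 / (1 + a * z\<^sup>2)"
      by auto
    have "1 / (1 + a * (real n + 1)\<^sup>2) \<le> 1 / (1 + a * z\<^sup>2)"
      using z(1,2) assms by (intro divide_left_mono add_left_mono mult_left_mono power_mono mult_pos_pos add_pos_nonneg) auto
    then show ?case using Suc z(3) by (simp add: add.commute)
  qed simp
  also have "\<dots> \<le> pi / 2 / sqrt a"
    using arctan_bounded[of "sqrt a * real n"] assms by (intro divide_right_mono) auto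
  finally show ?thesis .
qed

text \<open>The profile 1 / (1 + A phi) has width of order p / sqrt A around m. It is used twice: as
  a majorant of exp (-A phi), and as the normalising constant of a reference distribution in the
  entropy estimates.\<close>

lemma sum_resolvent:
  assumes "0 < A"
  shows "(\<Sum>j\<in>P. 1 / (1 + A * phi (j - m))) \<le> 1 + 2 * real p / sqrt A"
proof -
  define a where "a = 8 * A / (real p)\<^sup>2"
  have a: "0 < a" using assms by (simp add: a_def)
  define g where "g x = 1 / (1 + A * phi x)" for x
  have g_mod: "g (x mod int p) = g x" and g_minus: "g (- x) = g x" for x
    by (simp_all add: g_def phi_minus)
  have g_nonneg: "0 \<le> g x" for x using assms phi_nonneg[of x] by (simp add: g_def)
  have g_le: "g (int j) \<le> 1 / (1 + a * (real j)\<^sup>2)" if "2 * j \<le> p" for j :: nat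
  proof -
    have "a * (real j)\<^sup>2 \<le> A * phi (int j)"
      using mult_left_mono[OF phi_lower[of "int j"], of A] that assms by (simp add: a_def algebra_simps)
    moreover have "0 \<le> A * phi (int j)" using assms phi_nonneg by simp
    ultimately show ?thesis
      using a unfolding g_def by (intro divide_left_mono) (auto intro!: mult_pos_pos add_pos_nonneg)
  qed
  have un: "sum g (S \<union> T) \<le> sum g S + sum g T" if "finite S" "finite T" for S T
    using sum.union_inter[OF that, of g] sum_nonneg[of "S \<inter> T" g] g_nonneg by simp
  define n where "n = p div 2"
  have "(\<Sum>j\<in>P. g (j - m)) = (\<Sum>j\<in>P. g j)"
    using periodic_sum_shift[of g "-m"] g_mod by simp
  also have "\<dots> \<le> (\<Sum>j\<in>{0} \<union> (int ` {1..n} \<union> (\<lambda>j. int p - int j) ` {1..n}). g j)"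
  proof (rule sum_mono2)
    \<comment> \<open>The residues 0, j and p - j with j at most p div 2 cover the cycle. For even p
      the point p / 2 lies in both images, which is harmless because \<open>g\<close> is
      nonnegative.\<close>
    show "P \<subseteq> {0} \<union> (int ` {1..n} \<union> (\<lambda>j. int p - int j) ` {1..n})"
    proof
      fix x assume x: "x \<in> P"
      show "x \<in> {0} \<union> (int ` {1..n} \<union> (\<lambda>j. int p - int j) ` {1..n})"
      proof (cases "x \<le> int n")
        case True
        then have "x = 0 \<or> x = int (nat x) \<and> nat x \<in> {1..n}" using x by auto
        then show ?thesis by blast
      next
        case False
        then have "x = int p - int (nat (int p - x))" "nat (int p - x) \<in> {1..n}"
          using x by (auto simp: n_def)
        then show ?thesis by blast
      qed
    qed
  qed (auto simp: g_nonneg)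
  also have "\<dots> \<le> g 0 + (sum g (int ` {1..n}) + sum g ((\<lambda>j. int p - int j) ` {1..n}))"
    by (intro order.trans[OF un] add_mono un) auto
  also have "sum g (int ` {1..n}) = (\<Sum>j\<in>{1..n}. g (int j))"
    by (subst sum.reindex) auto
  also have "sum g ((\<lambda>j. int p - int j) ` {1..n}) = (\<Sum>j\<in>{1..n}. g (int p - int j))"
    by (subst sum.reindex) (auto simp: inj_on_def)
  also have "\<dots> = (\<Sum>j\<in>{1..n}. g (int j))"
    by (intro sum.cong refl) (metis g_mod g_minus minus_mod_self1)
  also have "(\<Sum>j\<in>{1..n}. g (int j)) \<le> (\<Sum>j\<in>{1..n}. 1 / (1 + a * (real j)\<^sup>2))"
    by (intro sum_mono g_le) (auto simp: n_def)
  also have "\<dots> \<le> pi / 2 / sqrt a" by (rule sum_resolvent_half[OF a])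
  also have "g 0 + (pi / 2 / sqrt a + pi / 2 / sqrt a) = 1 + pi * real p / (sqrt 8 * sqrt A)"
    using assms by (simp add: g_def a_def real_sqrt_mult real_sqrt_divide field_simps)
  also have "\<dots> \<le> 1 + 2 * real p / sqrt A"
  proof -
    \<comment> \<open>This turns pi / sqrt 8 into the rounder constant 2.\<close>
    have "pi \<le> 2 * sqrt 8"
      using pi_less_4 real_le_rsqrt[of 2 8] by simp
    then have "pi * (real p / sqrt A) / sqrt 8 \<le> 2 * (real p / sqrt A)"
      using assms by (subst divide_le_eq) (auto intro!: divide_right_mono mult_right_mono)
    then show ?thesis by (simp add: mult.commute)
  qed
  finally show ?thesis by (simp add: g_def)
qed

end

section \<open>The coordinate walk\<close>

lemma jump_chain_closed:
  assumes "x \<in> S" "\<And>y. y \<in> S \<Longrightarrow> set_pmf (K y) \<subseteq> S"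
  shows "set_pmf (jump_chain K x n) \<subseteq> S"
  by (induction n) (use assms in auto)

lemma walk_law_closed:
  assumes "x \<in> S" "\<And>y. y \<in> S \<Longrightarrow> set_pmf (K y) \<subseteq> S"
  shows "set_pmf (walk_law K x t) \<subseteq> S"
  using jump_chain_closed[OF assms] by (fastforce simp: walk_law_def)

lemma expectation_jump_chain_eigenfunction:
  fixes f :: "'a \<Rightarrow> complex"
  assumes S: "finite S" "x \<in> S" "\<And>y. y \<in> S \<Longrightarrow> set_pmf (K y) \<subseteq> S"
    and eig: "\<And>y. y \<in> S \<Longrightarrow> measure_pmf.expectation (K y) f = c * f y"
  shows "measure_pmf.expectation (jump_chain K x n) f = c ^ n * f x"
proof (induction n)
  case (Suc n)
  have sub: "set_pmf (jump_chain K x n) \<subseteq> S" by (rule jump_chain_closed[OF S(2)]) (rule S(3))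
  have "measure_pmf.expectation (jump_chain K x (Suc n)) f
      = (\<Sum>y\<in>S. pmf (jump_chain K x n) y *\<^sub>R measure_pmf.expectation (K y) f)"
    unfolding jump_chain.simps using S sub
    by (intro pmf_expectation_bind) (auto intro: finite_subset)
  also have "\<dots> = c * (\<Sum>y\<in>S. pmf (jump_chain K x n) y *\<^sub>R f y)"
    by (simp add: eig sum_distrib_left mult_ac)
  also have "(\<Sum>y\<in>S. pmf (jump_chain K x n) y *\<^sub>R f y) = measure_pmf.expectation (jump_chain K x n) f"
    using S(1) sub by (intro integral_measure_pmf[symmetric]) auto
  finally show ?case by (simp add: Suc)
qed simp

text \<open>Conditioning on the number of jumps. The time t = 0 fits the same series because
  \<open>0 ^ 0 = 1\<close> leaves exactly the term n = 0.\<close>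

lemma pmf_walk_law_sums:
  assumes "0 \<le> t"
  shows "(\<lambda>n. t ^ n / fact n * exp (- t) * pmf (jump_chain K x n) y) sums pmf (walk_law K x t) y"
proof (cases "t = 0")
  case True
  have "(\<lambda>n. (pmf (jump_chain K x n) y / fact n) * 0 ^ n) sums (pmf (jump_chain K x 0) y / fact 0)"
    by (rule powser_sums_zero)
  then show ?thesis using True by (simp add: walk_law_def jump_count_def bind_return_pmf mult_ac)
next
  case False
  then have t: "0 < t" using assms by simp
  let ?g = "\<lambda>n. pmf (jump_chain K x n) y"
  have "integrable (measure_pmf (poisson_pmf t)) ?g"
    by (rule measure_pmf.integrable_const_bound[of _ 1]) (auto simp: pmf_le_1)
  then have "integrable (count_space UNIV) (\<lambda>n. pmf (poisson_pmf t) n * ?g n)"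
    unfolding measure_pmf_eq_density by (subst (asm) integrable_density) auto
  from sums_integral_count_space_nat[OF this]
  have "(\<lambda>n. pmf (poisson_pmf t) n * ?g n) sums (LINT n|count_space UNIV. pmf (poisson_pmf t) n * ?g n)" .
  also have "(LINT n|count_space UNIV. pmf (poisson_pmf t) n * ?g n) = measure_pmf.expectation (poisson_pmf t) ?g"
    unfolding measure_pmf_eq_density by (subst integral_density) auto
  also have "\<dots> = pmf (walk_law K x t) y"
    using t by (simp add: walk_law_def jump_count_def pmf_bind)
  finally show ?thesis using t by simp
qed

text \<open>For N Poisson of mean t, the expectation of c^N is exp (t (c - 1)). Confining the chain
  to a finite set turns expectations into finite sums, which may be exchanged with the Poisson
  series.\<close>

lemma expectation_walk_law_eigenfunction:
  fixes f :: "'a \<Rightarrow> complex"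
  assumes S: "finite S" "x \<in> S" "\<And>y. y \<in> S \<Longrightarrow> set_pmf (K y) \<subseteq> S"
    and eig: "\<And>y. y \<in> S \<Longrightarrow> measure_pmf.expectation (K y) f = c * f y"
    and t: "0 \<le> t"
  shows "measure_pmf.expectation (walk_law K x t) f = exp (of_real t * (c - 1)) * f x"
proof -
  let ?a = "\<lambda>n. t ^ n / fact n * exp (- t)"
  have sub: "set_pmf (walk_law K x t) \<subseteq> S" by (rule walk_law_closed[OF S(2)]) (rule S(3))
  have E: "measure_pmf.expectation (walk_law K x t) f = (\<Sum>y\<in>S. pmf (walk_law K x t) y *\<^sub>R f y)"
    using S(1) sub by (intro integral_measure_pmf) auto
  have "(\<lambda>n. \<Sum>y\<in>S. (?a n * pmf (jump_chain K x n) y) *\<^sub>R f y) sums (\<Sum>y\<in>S. pmf (walk_law K x t) y *\<^sub>R f y)"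
    by (intro sums_sum sums_scaleR_left pmf_walk_law_sums t)
  moreover have "(\<Sum>y\<in>S. (?a n * pmf (jump_chain K x n) y) *\<^sub>R f y)
      = exp (- of_real t) * f x * ((of_real t * c) ^ n /\<^sub>R fact n)" for n
  proof -
    have "(\<Sum>y\<in>S. (?a n * pmf (jump_chain K x n) y) *\<^sub>R f y) = ?a n *\<^sub>R (\<Sum>y\<in>S. pmf (jump_chain K x n) y *\<^sub>R f y)"
      by (simp add: scaleR_sum_right)
    also have "(\<Sum>y\<in>S. pmf (jump_chain K x n) y *\<^sub>R f y) = measure_pmf.expectation (jump_chain K x n) f"
      using S(1) jump_chain_closed[OF S(2), of K n, OF S(3)] by (intro integral_measure_pmf[symmetric]) auto
    also have "\<dots> = c ^ n * f x"
      by (rule expectation_jump_chain_eigenfunction[OF S eig])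
    finally show ?thesis
      by (simp add: scaleR_conv_of_real power_mult_distrib exp_of_real[symmetric] divide_inverse mult_ac)
  qed
  ultimately have "(\<lambda>n. exp (- of_real t) * f x * ((of_real t * c) ^ n /\<^sub>R fact n)) sums
      (\<Sum>y\<in>S. pmf (walk_law K x t) y *\<^sub>R f y)"
    by simp
  moreover have "(\<lambda>n. exp (- of_real t) * f x * ((of_real t * c) ^ n /\<^sub>R fact n)) sums
      (exp (- of_real t) * f x * exp (of_real t * c))"
    by (intro sums_mult exp_converges)
  ultimately have "(\<Sum>y\<in>S. pmf (walk_law K x t) y *\<^sub>R f y) = exp (- of_real t) * f x * exp (of_real t * c)"
    by (rule sums_unique2)
  then show ?thesis by (simp add: E algebra_simps exp_add[symmetric])
qed

section \<open>Fourier inversion on the product and independence of the coordinates\<close>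

context cycle
begin

definition cube :: "nat \<Rightarrow> (nat \<Rightarrow> int) set" where
  "cube k = (\<Pi>\<^sub>E i\<in>{..<k}. P)"

lemma finite_cube [simp]: "finite (cube k)"
  by (simp add: cube_def finite_PiE)

lemma carrier_Zpow: "carrier (Zpow p d) = cube d"
  by (simp add: Zpow_def cube_def carrier_integer_mod_group PiE_def Pi_def) (use p_ge_2 in auto)

lemma one_Zpow: "\<one>\<^bsub>Zpow p d\<^esub> = (\<lambda>i\<in>{..<d}. 0)"
  by (simp add: Zpow_def)

lemma card_cube: "card (cube k) = p ^ k"
  by (simp add: cube_def card_PiE)

lemma one_in_cube: "\<one>\<^bsub>Zpow p k\<^esub> \<in> cube k"
  using p_ge_2 by (auto simp: one_Zpow cube_def)

text \<open>The eigenvalue of the generator of the rate-1 walk on the cycle at the character of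
  frequency j. Only the imaginary part, that is the drift, depends on the orientation.\<close>

definition psi :: "orientation \<Rightarrow> int \<Rightarrow> complex" where
  "psi \<sigma> j = (case \<sigma> of Directed \<Rightarrow> chi j - 1 | Undirected \<Rightarrow> - of_real (phi j))"

lemma Re_psi: "Re (psi \<sigma> j) = - phi j"
  by (cases \<sigma>) (simp_all add: psi_def Re_chi)

lemma psi_0 [simp]: "psi \<sigma> 0 = 0"
  by (cases \<sigma>) (simp_all add: psi_def)

lemma norm_exp_psi: "cmod (exp (of_real s * psi \<sigma> j)) = exp (- (s * phi j))"
  by (simp add: norm_exp_eq_Re Re_psi)

definition chiv :: "nat \<Rightarrow> (nat \<Rightarrow> int) \<Rightarrow> (nat \<Rightarrow> int) \<Rightarrow> complex" where
  "chiv k a x = (\<Prod>i<k. chi (a i * x i))"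

lemma coordinate_step_closed:
  assumes "0 < k" "x \<in> cube k"
  shows "set_pmf (coordinate_step \<sigma> p k x) \<subseteq> cube k"
  using assms p_ge_2
  by (cases \<sigma>) (auto simp: coordinate_step_def cube_def set_pmf_of_set PiE_def extensional_def lessThan_empty_iff)

lemma chiv_update:
  assumes "i < k"
  shows "chiv k a (x(i := (x i + u) mod int p)) = chiv k a x * chi (a i * u)"
proof -
  have "chiv k a (x(i := (x i + u) mod int p))
      = chi (a i * ((x i + u) mod int p)) * (\<Prod>j\<in>{..<k} - {i}. chi (a j * x j))"
    unfolding chiv_def using assms by (subst prod.remove[of _ i]) (auto intro!: prod.cong)
  also have "chi (a i * ((x i + u) mod int p)) = chi (a i * x i) * chi (a i * u)"
    by (simp add: chi_mult_mod ring_distribs chi_add)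
  also have "chi (a i * x i) * chi (a i * u) * (\<Prod>j\<in>{..<k} - {i}. chi (a j * x j))
      = chiv k a x * chi (a i * u)"
    unfolding chiv_def using assms by (subst (2) prod.remove[of _ i]) auto
  finally show ?thesis .
qed

text \<open>A jump in coordinate i multiplies the character by \<open>chi (a i)\<close>, or on
  average by the mean of this number and its conjugate; averaging over i adds up the
  eigenvalues.\<close>

lemma expectation_coordinate_step:
  assumes "0 < k"
  shows "measure_pmf.expectation (coordinate_step \<sigma> p k x) (chiv k a)
    = (1 + (\<Sum>i<k. psi \<sigma> (a i)) / of_nat k) * chiv k a x"
proof -
  have [simp]: "{..<k} \<noteq> {}" using assms by auto
  have half: "chiv k a x * cnj (chi (a i)) / 2 + chiv k a x * chi (a i) / 2
      = chiv k a x * (1 + psi Undirected (a i))" for i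
  proof -
    have "cnj (chi (a i)) + chi (a i) = 2 * (1 + psi Undirected (a i))"
      by (simp add: complex_add_cnj add.commute[of "cnj _"] Re_chi psi_def)
    then show ?thesis by (metis add_divide_distrib distrib_left nonzero_mult_div_cancel_left times_divide_eq_right zero_neq_numeral)
  qed
  have "measure_pmf.expectation (coordinate_step \<sigma> p k x) (chiv k a)
      = (\<Sum>i<k. (chiv k a x * (1 + psi \<sigma> (a i))) /\<^sub>R real k)"
    unfolding coordinate_step_def
  proof (subst pmf_expectation_bind_pmf_of_set)
    show "(\<Sum>i<k. measure_pmf.expectation (case \<sigma> of
            Directed \<Rightarrow> return_pmf (x(i := (x i + 1) mod int p))
          | Undirected \<Rightarrow> bernoulli_pmf (1 / 2) \<bind>
              (\<lambda>b. return_pmf (x(i := (x i + (if b then 1 else - 1)) mod int p)))) (chiv k a) /\<^sub>R real (card {..<k}))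
        = (\<Sum>i<k. (chiv k a x * (1 + psi \<sigma> (a i))) /\<^sub>R real k)"
    proof (cases \<sigma>)
      case Directed
      then show ?thesis by (intro sum.cong) (simp_all add: chiv_update psi_def)
    next
      case Undirected
      have "measure_pmf.expectation (bernoulli_pmf (1 / 2) \<bind>
              (\<lambda>b. return_pmf (x(i := (x i + (if b then 1 else - 1)) mod int p)))) (chiv k a)
          = chiv k a x * (1 + psi Undirected (a i))" if "i < k" for i
        using that half[of i]
        by (subst pmf_expectation_bind[where A = UNIV])
           (auto simp: UNIV_bool chiv_update[where u = 1] chiv_update[where u = "-1", simplified] chi_minus scaleR_conv_of_real)
      then show ?thesis using Undirected by (intro sum.cong) simp_all
    qed
  qed (auto split: orientation.split)
  also have "\<dots> = (\<Sum>i<k. 1 + psi \<sigma> (a i)) / of_nat k * chiv k a x"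
    by (simp add: scaleR_conv_of_real sum_distrib_left sum_divide_distrib divide_inverse mult_ac)
  also have "\<dots> = (1 + (\<Sum>i<k. psi \<sigma> (a i)) / of_nat k) * chiv k a x"
    using assms by (simp add: sum.distrib add_divide_distrib)
  finally show ?thesis .
qed

lemma set_coordinate_walk:
  assumes "0 < k"
  shows "set_pmf (coordinate_walk \<sigma> p k t) \<subseteq> cube k"
  unfolding coordinate_walk_def
  by (rule walk_law_closed) (use one_in_cube coordinate_step_closed[OF assms] in auto)

text \<open>The eigenvalue is a mean over the coordinates, so its exponential is a product: this is
  where the independence of the coordinates, each run at rate 1 / k, comes from.\<close>

lemma expectation_coordinate_walk:
  assumes "0 < k" "0 \<le> t"
  shows "measure_pmf.expectation (coordinate_walk \<sigma> p k t) (chiv k a)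
    = (\<Prod>i<k. exp (of_real (t / k) * psi \<sigma> (a i)))"
proof -
  have "measure_pmf.expectation (coordinate_walk \<sigma> p k t) (chiv k a)
      = exp (of_real t * (1 + (\<Sum>i<k. psi \<sigma> (a i)) / of_nat k - 1)) * chiv k a \<one>\<^bsub>Zpow p k\<^esub>"
    unfolding coordinate_walk_def
    by (rule expectation_walk_law_eigenfunction[where S = "cube k"])
       (use assms one_in_cube coordinate_step_closed expectation_coordinate_step in auto)
  also have "chiv k a \<one>\<^bsub>Zpow p k\<^esub> = 1"
    by (simp add: chiv_def one_Zpow)
  finally show ?thesis
    by (simp add: exp_sum[symmetric] sum_distrib_left[symmetric] del: of_real_divide) (simp add: field_simps)
qed

definition inv_fourier :: "orientation \<Rightarrow> real \<Rightarrow> int \<Rightarrow> complex" where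
  "inv_fourier \<sigma> s x = (\<Sum>j\<in>P. exp (of_real s * psi \<sigma> j) * chi (- (j * x))) / of_nat p"

text \<open>Expand the indicator of x in the characters of the product group and take expectations
  term by term; the factorised transform gives a factorised law. The factors are complex numbers
  here; \<open>nu_eq_inv_fourier\<close> identifies them as probabilities.\<close>

lemma pmf_coordinate_walk_inv_fourier:
  assumes k: "0 < k" "0 \<le> t" and x: "x \<in> cube k"
  shows "complex_of_real (pmf (coordinate_walk \<sigma> p k t) x) = (\<Prod>i<k. inv_fourier \<sigma> (t / k) (x i))"
proof -
  let ?W = "coordinate_walk \<sigma> p k t"
  let ?E = "\<lambda>a. \<Prod>i<k. exp (of_real (t / k) * psi \<sigma> (a i))"
  have ind: "(if y = x then 1 else 0) = (\<Sum>a\<in>cube k. (\<Prod>i<k. chi (- (a i * x i)) / of_nat p) * chiv k a y)"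
    if y: "y \<in> cube k" for y
  proof -
    have "(\<Sum>a\<in>cube k. (\<Prod>i<k. chi (- (a i * x i)) / of_nat p) * chiv k a y)
        = (\<Sum>a\<in>cube k. \<Prod>i<k. chi (a i * (y i - x i)) / of_nat p)"
      by (simp add: chiv_def prod.distrib[symmetric] chi_diff chi_minus right_diff_distrib)
         (simp add: mult_ac)
    also have "\<dots> = (\<Prod>i<k. \<Sum>j\<in>P. chi (j * (y i - x i)) / of_nat p)"
      unfolding cube_def by (subst prod_sum_PiE) auto
    also have "\<dots> = (\<Prod>i<k. if y i = x i then 1 else 0)"
    proof (intro prod.cong refl)
      fix i assume i: "i \<in> {..<k}"
      then have "y i \<in> P" "x i \<in> P" using x y by (auto simp: cube_def PiE_def Pi_def)
      then have "int p dvd (y i - x i) \<longleftrightarrow> y i = x i"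
        by (simp add: mod_eq_dvd_iff[symmetric])
      then show "(\<Sum>j\<in>P. chi (j * (y i - x i)) / of_nat p) = (if y i = x i then 1 else 0)"
        using p_ge_2 by (simp add: sum_divide_distrib[symmetric] sum_chi)
    qed
    also have "\<dots> = (if y = x then 1 else 0)"
    proof (cases "y = x")
      case False
      then obtain i where "i < k" "y i \<noteq> x i"
        using x y unfolding cube_def by (metis PiE_ext lessThan_iff)
      then show ?thesis using False by auto
    qed simp
    finally show ?thesis by simp
  qed
  have "complex_of_real (pmf ?W x) = (\<Sum>y\<in>cube k. pmf ?W y *\<^sub>R (if y = x then 1 else 0))"
    using x by (simp add: scaleR_conv_of_real if_distrib[where f = "\<lambda>u. _ * u"] cong: if_cong)
  also have "\<dots> = (\<Sum>y\<in>cube k. \<Sum>a\<in>cube k. (\<Prod>i<k. chi (- (a i * x i)) / of_nat p) * (pmf ?W y *\<^sub>R chiv k a y))"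
    by (intro sum.cong refl) (simp add: ind sum_distrib_left scaleR_conv_of_real mult_ac)
  also have "\<dots> = (\<Sum>a\<in>cube k. (\<Prod>i<k. chi (- (a i * x i)) / of_nat p) * (\<Sum>y\<in>cube k. pmf ?W y *\<^sub>R chiv k a y))"
    by (subst sum.swap) (simp add: sum_distrib_left)
  also have "\<dots> = (\<Sum>a\<in>cube k. (\<Prod>i<k. chi (- (a i * x i)) / of_nat p) * ?E a)"
  proof (intro sum.cong refl)
    fix a
    have "(\<Sum>y\<in>cube k. pmf ?W y *\<^sub>R chiv k a y) = measure_pmf.expectation ?W (chiv k a)"
      using set_coordinate_walk[OF k(1)] by (intro integral_measure_pmf[symmetric]) auto
    then show "(\<Prod>i<k. chi (- (a i * x i)) / of_nat p) * (\<Sum>y\<in>cube k. pmf ?W y *\<^sub>R chiv k a y)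
        = (\<Prod>i<k. chi (- (a i * x i)) / of_nat p) * ?E a"
      by (simp add: expectation_coordinate_walk[OF k])
  qed
  also have "\<dots> = (\<Sum>a\<in>cube k. \<Prod>i<k. exp (of_real (t / k) * psi \<sigma> (a i)) * chi (- (a i * x i)) / of_nat p)"
    by (simp add: prod.distrib[symmetric] mult_ac)
  also have "\<dots> = (\<Prod>i<k. inv_fourier \<sigma> (t / k) (x i))"
    unfolding cube_def inv_fourier_def sum_divide_distrib by (subst prod_sum_PiE) auto
  finally show ?thesis .
qed

text \<open>The law of one coordinate, taken from the walk with a single coordinate so that it is a
  probability by construction. It is extended periodically to all integers, so that shifts such as
  \<open>nu \<sigma> s (x + 1)\<close> need no reduction.\<close>

definition nu :: "orientation \<Rightarrow> real \<Rightarrow> int \<Rightarrow> real" where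
  "nu \<sigma> s x = pmf (coordinate_walk \<sigma> p 1 s) (\<lambda>i\<in>{..<1}. x mod int p)"

lemma nu_nonneg: "0 \<le> nu \<sigma> s x"
  by (simp add: nu_def)

lemma nu_mod [simp]: "nu \<sigma> s (x mod int p) = nu \<sigma> s x"
  by (simp add: nu_def)

lemma inv_fourier_mod [simp]: "inv_fourier \<sigma> s (x mod int p) = inv_fourier \<sigma> s x"
  by (simp add: inv_fourier_def chi_minus chi_mult_mod)

lemma nu_eq_inv_fourier:
  assumes "0 \<le> s"
  shows "complex_of_real (nu \<sigma> s x) = inv_fourier \<sigma> s x"
proof -
  have "(\<lambda>i\<in>{..<1}. x mod int p) \<in> cube 1"
    using p_ge_2 by (auto simp: cube_def)
  from pmf_coordinate_walk_inv_fourier[OF _ assms this] show ?thesis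
    by (simp add: nu_def)
qed

lemma pmf_coordinate_walk:
  assumes "0 < k" "0 \<le> t" "x \<in> cube k"
  shows "pmf (coordinate_walk \<sigma> p k t) x = (\<Prod>i<k. nu \<sigma> (t / k) (x i))"
proof -
  have "complex_of_real (pmf (coordinate_walk \<sigma> p k t) x) = complex_of_real (\<Prod>i<k. nu \<sigma> (t / k) (x i))"
    using assms by (simp add: pmf_coordinate_walk_inv_fourier nu_eq_inv_fourier)
  then show ?thesis by (rule of_real_eq_iff[THEN iffD1])
qed

lemma fourier_nu:
  assumes "0 \<le> s" "j \<in> P"
  shows "(\<Sum>x\<in>P. of_real (nu \<sigma> s x) * chi (j * x)) = exp (of_real s * psi \<sigma> j)"
proof -
  have "(\<Sum>x\<in>P. of_real (nu \<sigma> s x) * chi (j * x))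
      = (\<Sum>x\<in>P. \<Sum>l\<in>P. exp (of_real s * psi \<sigma> l) / of_nat p * chi (x * (j - l)))"
    unfolding nu_eq_inv_fourier[OF assms(1)] inv_fourier_def sum_distrib_right sum_divide_distrib
    by (intro sum.cong refl) (simp add: right_diff_distrib chi_diff chi_minus mult_ac)
  also have "\<dots> = (\<Sum>l\<in>P. exp (of_real s * psi \<sigma> l) / of_nat p * (\<Sum>x\<in>P. chi (x * (j - l))))"
    by (subst sum.swap) (simp add: sum_distrib_left)
  also have "\<dots> = (\<Sum>l\<in>P. if l = j then exp (of_real s * psi \<sigma> l) else 0)"
  proof (intro sum.cong refl)
    fix l assume "l \<in> P"
    then have "int p dvd (j - l) \<longleftrightarrow> l = j"
      using assms(2) by (auto simp: mod_eq_dvd_iff[symmetric])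
    then show "exp (of_real s * psi \<sigma> l) / of_nat p * (\<Sum>x\<in>P. chi (x * (j - l)))
        = (if l = j then exp (of_real s * psi \<sigma> l) else 0)"
      using p_ge_2 by (simp add: sum_chi)
  qed
  also have "\<dots> = exp (of_real s * psi \<sigma> j)" using assms(2) by simp
  finally show ?thesis .
qed

lemma sum_nu:
  assumes "0 \<le> s"
  shows "(\<Sum>x\<in>P. nu \<sigma> s x) = 1"
proof -
  have "(\<Sum>x\<in>P. complex_of_real (nu \<sigma> s x)) = 1"
    using fourier_nu[OF assms, of 0 \<sigma>] p_ge_2 by simp
  then show ?thesis by (metis of_real_eq_1_iff of_real_sum)
qed

end

section \<open>Entropy and varentropy of one coordinate\<close>

text \<open>The bound ln y \<le> y - 1 at y = sqrt (b / a). Summed over two probability vectors it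
  says that relative entropy dominates the squared Hellinger distance.\<close>

lemma mult_ln_ratio_ge:
  assumes "0 < a" "0 < (b::real)"
  shows "2 * a - 2 * sqrt (a * b) \<le> a * (ln a - ln b)"
proof -
  have "ln (sqrt (b / a)) \<le> sqrt (b / a) - 1"
    using assms by (intro ln_le_minus_one) simp
  then have "(ln b - ln a) / 2 \<le> sqrt (b / a) - 1"
    using assms by (simp add: ln_sqrt ln_div)
  then have "a * ((ln b - ln a) / 2) \<le> a * (sqrt (b / a) - 1)"
    using assms by (intro mult_left_mono) auto
  moreover have "a * sqrt (b / a) = sqrt (a * b)"
  proof -
    have "a * b = a\<^sup>2 * (b / a)" using assms by (simp add: power2_eq_square)
    then have "sqrt (a * b) = sqrt (a\<^sup>2) * sqrt (b / a)" by (simp only: real_sqrt_mult)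
    then show ?thesis using assms by simp
  qed
  moreover have "a * ((ln b - ln a) / 2) = (a * ln b - a * ln a) / 2"
    by (simp add: algebra_simps)
  ultimately show ?thesis by (simp add: right_diff_distrib)
qed

text \<open>Expanding (1 - exp (- a)) (1 - cos y) \<ge> 0 separates the damping from the rotation of
  a Fourier coefficient.\<close>

lemma one_minus_exp_mult_cos_le:
  assumes "0 \<le> (a::real)"
  shows "1 - exp (- a) * cos y \<le> a + y\<^sup>2 / 2"
proof -
  have "0 \<le> (1 - exp (- a)) * (1 - cos y)" using assms by (intro mult_nonneg_nonneg) auto
  moreover have "1 - a \<le> exp (- a)" using exp_ge_add_one_self[of "-a"] by simp
  moreover have "1 - y\<^sup>2 / 2 \<le> cos y"
  proof -
    have "\<bar>sin (y / 2)\<bar>\<^sup>2 \<le> \<bar>y / 2\<bar>\<^sup>2" by (intro power_mono abs_sin_x_le_abs_x) auto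
    then show ?thesis using cos_double_sin[of "y / 2"] by (simp add: power_divide)
  qed
  ultimately show ?thesis by (simp add: algebra_simps)
qed

lemma exp_minus_le_inverse:
  assumes "0 \<le> (x::real)"
  shows "exp (- x) \<le> 1 / (1 + x)"
proof -
  have "1 / exp x \<le> 1 / (1 + x)"
    using exp_ge_add_one_self[of x] assms by (intro divide_left_mono) auto
  then show ?thesis by (simp add: exp_minus inverse_eq_divide)
qed

context cycle
begin

text \<open>The residue of x is reached by that many upward jumps, and every number of jumps has
  positive Poisson probability. Positivity is what allows logarithms of \<open>nu\<close> everywhere
  below.\<close>

lemma nu_pos:
  assumes "0 < s"
  shows "0 < nu \<sigma> s x"
proof -
  let ?K = "coordinate_step \<sigma> p 1"
  have mem: "(\<lambda>i\<in>{..<1}. int n mod int p) \<in> set_pmf (jump_chain ?K \<one>\<^bsub>Zpow p 1\<^esub> n)" for n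
  proof (induction n)
    case 0
    then show ?case by (simp add: one_Zpow)
  next
    case (Suc n)
    have "(\<lambda>i\<in>{..<1}. int (Suc n) mod int p) \<in> set_pmf (?K (\<lambda>i\<in>{..<1}. int n mod int p))"
      by (cases \<sigma>) (auto simp: coordinate_step_def set_pmf_of_set fun_eq_iff restrict_def mod_simps add.commute
          lessThan_empty_iff intro!: bexI[of _ True])
    with Suc show ?case unfolding jump_chain.simps set_bind_pmf by blast
  qed
  have "(\<lambda>i\<in>{..<1}. x mod int p) \<in> set_pmf (coordinate_walk \<sigma> p 1 s)"
    using mem[of "nat (x mod int p)"] assms p_ge_2
    by (auto simp: coordinate_walk_def walk_law_def jump_count_def intro!: exI[of _ "nat (x mod int p)"])
  then show ?thesis by (simp add: nu_def pmf_positive)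
qed

section \<open>Parseval and the chi-square distance\<close>

lemma sum_nu_shift:
  assumes "0 \<le> s"
  shows "(\<Sum>x\<in>P. nu \<sigma> s (x + m)) = 1"
  using periodic_sum_shift[of "nu \<sigma> s" m] sum_nu[OF assms] by simp

text \<open>\<open>nu\<close> is real, so one of the two factors may be conjugated and expanded by
  Fourier inversion. Only moduli of the coefficients remain, so the l2 norm is the same for both
  orientations.\<close>

lemma parseval:
  assumes "0 \<le> s"
  shows "real p * (\<Sum>x\<in>P. (nu \<sigma> s x)\<^sup>2) = (\<Sum>j\<in>P. exp (- (2 * s * phi j)))"
proof -
  have "complex_of_real (real p * (\<Sum>x\<in>P. (nu \<sigma> s x)\<^sup>2))
      = (\<Sum>x\<in>P. of_real (nu \<sigma> s x) * (of_nat p * of_real (nu \<sigma> s x)))"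
    by (simp add: sum_distrib_left power2_eq_square mult_ac)
  also have "\<dots> = (\<Sum>x\<in>P. of_real (nu \<sigma> s x) * (of_nat p * cnj (of_real (nu \<sigma> s x))))"
    by simp
  also have "\<dots> = (\<Sum>x\<in>P. of_real (nu \<sigma> s x) * (\<Sum>j\<in>P. cnj (exp (of_real s * psi \<sigma> j)) * chi (j * x)))"
  proof (intro sum.cong refl arg_cong2[where f = "(*)"])
    fix x
    show "of_nat p * cnj (of_real (nu \<sigma> s x)) = (\<Sum>j\<in>P. cnj (exp (of_real s * psi \<sigma> j)) * chi (j * x))"
      unfolding nu_eq_inv_fourier[OF assms] using p_ge_2 by (simp add: inv_fourier_def chi_minus)
  qed
  also have "\<dots> = (\<Sum>j\<in>P. cnj (exp (of_real s * psi \<sigma> j)) * (\<Sum>x\<in>P. of_real (nu \<sigma> s x) * chi (j * x)))"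
    unfolding sum_distrib_left by (subst sum.swap) (simp add: mult_ac)
  also have "\<dots> = (\<Sum>j\<in>P. of_real (exp (- (2 * s * phi j))))"
  proof (intro sum.cong refl)
    fix j assume j: "j \<in> P"
    have "cnj (exp (of_real s * psi \<sigma> j)) * exp (of_real s * psi \<sigma> j) = of_real ((cmod (exp (of_real s * psi \<sigma> j)))\<^sup>2)"
      by (metis complex_norm_square mult.commute of_real_power)
    also have "\<dots> = of_real (exp (- (2 * s * phi j)))"
      by (simp only: norm_exp_psi) (simp add: power2_eq_square exp_add[symmetric] flip: of_real_mult)
    finally show "cnj (exp (of_real s * psi \<sigma> j)) * (\<Sum>x\<in>P. of_real (nu \<sigma> s x) * chi (j * x))
        = of_real (exp (- (2 * s * phi j)))"
      by (simp add: fourier_nu[OF assms j])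
  qed
  finally show ?thesis unfolding of_real_sum[symmetric] of_real_eq_iff .
qed

lemma nu_le_sum:
  assumes "0 \<le> s"
  shows "nu \<sigma> s x \<le> (\<Sum>j\<in>P. exp (- (s * phi j))) / real p"
proof -
  have "nu \<sigma> s x = cmod (inv_fourier \<sigma> s x)"
    by (metis abs_of_nonneg norm_of_real nu_eq_inv_fourier[OF assms] nu_nonneg)
  also have "\<dots> \<le> (\<Sum>j\<in>P. cmod (exp (of_real s * psi \<sigma> j) * chi (- (j * x)))) / real p"
    unfolding inv_fourier_def by (simp add: norm_divide divide_right_mono norm_sum)
  finally show ?thesis by (simp only: norm_mult norm_exp_psi norm_chi mult_1_right)
qed

lemma sum_exp_phi_le:
  assumes "0 < s"
  shows "(\<Sum>j\<in>P. exp (- (s * phi j))) \<le> 1 + 2 * real p / sqrt s"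
proof -
  have "(\<Sum>j\<in>P. exp (- (s * phi j))) \<le> (\<Sum>j\<in>P. 1 / (1 + s * phi (j - 0)))"
    using assms phi_nonneg by (intro sum_mono) (simp add: exp_minus_le_inverse)
  then show ?thesis using sum_resolvent[OF assms, of 0] by linarith
qed

lemma nu_le:
  assumes "0 < s"
  shows "nu \<sigma> s x \<le> 1 / real p + 2 / sqrt s"
proof -
  have "nu \<sigma> s x \<le> (1 + 2 * real p / sqrt s) / real p"
    using nu_le_sum[of s \<sigma> x] sum_exp_phi_le[OF assms] assms
    by (meson divide_right_mono less_imp_le of_nat_0_le_iff order_trans)
  then show ?thesis using p_ge_2 by (simp add: add_divide_distrib)
qed

text \<open>The chi-square distance of one coordinate from uniform, written on the Fourier side;
  \<open>chisq_eq\<close> gives the spatial form.\<close>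

definition chisq :: "real \<Rightarrow> real" where
  "chisq s = (\<Sum>j\<in>P - {0}. exp (- (2 * s * phi j)))"

lemma chisq_nonneg: "0 \<le> chisq s"
  by (simp add: chisq_def sum_nonneg)

lemma sum_exp_phi_eq: "(\<Sum>j\<in>P. exp (- (2 * s * phi j))) = 1 + chisq s"
  unfolding chisq_def using p_ge_2 by (subst sum.remove[of _ 0]) auto

lemma chisq_eq:
  assumes "0 \<le> s"
  shows "real p * (\<Sum>x\<in>P. (nu \<sigma> s x)\<^sup>2) = 1 + chisq s"
  by (simp add: parseval[OF assms] sum_exp_phi_eq)

lemma chisq_le:
  assumes "0 < s"
  shows "chisq s \<le> 2 * real p / sqrt s"
proof -
  have "(\<Sum>j\<in>P. exp (- (2 * s * phi j))) \<le> (\<Sum>j\<in>P. exp (- (s * phi j)))"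
    using assms phi_nonneg by (intro sum_mono) auto
  with sum_exp_phi_le[OF assms] show ?thesis using sum_exp_phi_eq[of s] by linarith
qed

lemma gap_mult_p2: "(real p)\<^sup>2 * gap \<le> 2 * pi\<^sup>2"
  using mult_left_mono[OF gap_upper, of "(real p)\<^sup>2"] p_ge_2 by simp

text \<open>By time p^2 the distance has dropped to 2, and after that every mode decays at rate at
  least 2 \<open>gap\<close>. Restarting the exponential from time 0 costs exp (2 \<open>gap\<close>
  p^2), at most exp (4 pi^2).\<close>

lemma chisq_decay:
  assumes "(real p)\<^sup>2 \<le> s"
  shows "chisq s \<le> 2 * exp (4 * pi\<^sup>2) * exp (- (2 * gap * s))"
proof -
  define r where "r = (real p)\<^sup>2"
  have r: "0 < r" using p_ge_2 by (simp add: r_def)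
  have "chisq s \<le> (\<Sum>j\<in>P - {0}. exp (- (2 * (s - r) * gap)) * exp (- (2 * r * phi j)))"
    unfolding chisq_def
  proof (intro sum_mono)
    fix j assume "j \<in> P - {0}"
    then have "(s - r) * gap \<le> (s - r) * phi j"
      using assms by (intro mult_left_mono gap_le_phi) (auto simp: r_def)
    then show "exp (- (2 * s * phi j)) \<le> exp (- (2 * (s - r) * gap)) * exp (- (2 * r * phi j))"
      by (simp add: exp_add[symmetric] algebra_simps)
  qed
  also have "\<dots> = exp (- (2 * (s - r) * gap)) * chisq r"
    by (simp add: chisq_def sum_distrib_left)
  also have "\<dots> \<le> exp (4 * pi\<^sup>2 - 2 * gap * s) * 2"
    using gap_mult_p2 chisq_le[OF r] p_ge_2
    by (intro mult_mono) (auto simp: r_def algebra_simps chisq_nonneg)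
  finally show ?thesis by (simp add: exp_diff exp_minus field_simps)
qed

section \<open>Entropy and varentropy near uniformity\<close>

definition entropy1 :: "orientation \<Rightarrow> real \<Rightarrow> real" where
  "entropy1 \<sigma> s = - (\<Sum>x\<in>P. nu \<sigma> s x * ln (nu \<sigma> s x))"

definition varentropy1 :: "orientation \<Rightarrow> real \<Rightarrow> real" where
  "varentropy1 \<sigma> s = (\<Sum>x\<in>P. nu \<sigma> s x * (ln (nu \<sigma> s x) + entropy1 \<sigma> s)\<^sup>2)"

text \<open>The variance is the least second moment about a constant. The freedom in c lets an
  explicit normalising constant stand in for the unknown entropy.\<close>

lemma varentropy1_le:
  assumes "0 \<le> s"
  shows "varentropy1 \<sigma> s \<le> (\<Sum>x\<in>P. nu \<sigma> s x * (ln (nu \<sigma> s x) + c)\<^sup>2)"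
proof -
  have "(\<Sum>x\<in>P. nu \<sigma> s x * (ln (nu \<sigma> s x) + c)\<^sup>2)
      = (\<Sum>x\<in>P. nu \<sigma> s x * (ln (nu \<sigma> s x) + entropy1 \<sigma> s)\<^sup>2
          + 2 * (c - entropy1 \<sigma> s) * (nu \<sigma> s x * ln (nu \<sigma> s x)) + (c\<^sup>2 - (entropy1 \<sigma> s)\<^sup>2) * nu \<sigma> s x)"
    by (intro sum.cong refl) (simp add: power2_eq_square algebra_simps)
  also have "\<dots> = varentropy1 \<sigma> s + 2 * (c - entropy1 \<sigma> s) * (- entropy1 \<sigma> s) + (c\<^sup>2 - (entropy1 \<sigma> s)\<^sup>2)"
    unfolding sum.distrib sum_distrib_left[symmetric] sum_nu[OF assms] by (simp add: varentropy1_def entropy1_def)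
  also have "\<dots> = varentropy1 \<sigma> s + (c - entropy1 \<sigma> s)\<^sup>2"
    by (simp add: power2_eq_square algebra_simps)
  finally show ?thesis by simp
qed

text \<open>The deficit is the relative entropy with respect to the uniform law, bounded by ln u
  \<le> u - 1 at u = p \<nu>.\<close>

lemma entropy1_deficit_le_chisq:
  assumes "0 < s"
  shows "ln (real p) - entropy1 \<sigma> s \<le> chisq s"
proof -
  have nz: "nu \<sigma> s x \<noteq> 0" for x using nu_pos[OF assms, of \<sigma> x] by simp
  have "ln (real p) - entropy1 \<sigma> s = (\<Sum>x\<in>P. nu \<sigma> s x * ln (real p * nu \<sigma> s x))"
    using nz p_ge_2 sum_nu[of s \<sigma>] assms
    by (simp add: entropy1_def ln_mult ring_distribs sum.distrib flip: sum_distrib_right)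
  also have "\<dots> \<le> (\<Sum>x\<in>P. nu \<sigma> s x * (real p * nu \<sigma> s x - 1))"
    using nu_pos[OF assms] p_ge_2 by (intro sum_mono mult_left_mono ln_le_minus_one) (auto simp: nu_nonneg)
  also have "\<dots> = real p * (\<Sum>x\<in>P. (nu \<sigma> s x)\<^sup>2) - (\<Sum>x\<in>P. nu \<sigma> s x)"
    by (simp add: right_diff_distrib sum_subtractf sum_distrib_left power2_eq_square mult_ac)
  also have "\<dots> = chisq s" using assms by (simp add: chisq_eq sum_nu)
  finally show ?thesis .
qed

lemma varentropy1_le_chisq:
  assumes "0 < s"
  shows "varentropy1 \<sigma> s \<le> chisq s"
proof -
  have "varentropy1 \<sigma> s \<le> (\<Sum>x\<in>P. nu \<sigma> s x * (ln (nu \<sigma> s x) + ln (real p))\<^sup>2)"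
    using assms by (intro varentropy1_le) simp
  also have "\<dots> \<le> (\<Sum>x\<in>P. (real p * nu \<sigma> s x - 1)\<^sup>2 / real p)"
  proof (intro sum_mono)
    fix x
    have "real p * nu \<sigma> s x * (ln (real p * nu \<sigma> s x))\<^sup>2 \<le> (real p * nu \<sigma> s x - 1)\<^sup>2"
      using nu_pos[OF assms] p_ge_2 by (intro mult_ln_power2_le) auto
    then show "nu \<sigma> s x * (ln (nu \<sigma> s x) + ln (real p))\<^sup>2 \<le> (real p * nu \<sigma> s x - 1)\<^sup>2 / real p"
      using nu_pos[OF assms, of \<sigma> x] p_ge_2 by (simp add: ln_mult field_simps)
  qed
  also have "\<dots> = (\<Sum>x\<in>P. real p * (nu \<sigma> s x)\<^sup>2 - 2 * nu \<sigma> s x + 1 / real p)"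
    using p_ge_2 by (intro sum.cong refl) (simp add: power2_eq_square field_simps)
  also have "\<dots> = chisq s"
    using assms chisq_eq[of s \<sigma>] sum_nu[of s \<sigma>] p_ge_2
    by (simp add: sum.distrib sum_subtractf flip: sum_distrib_left)
  finally show ?thesis .
qed

text \<open>If m is an independent copy of the position, the mean of \<open>phi (x - m)\<close> is 1
  minus the squared modulus of the first Fourier coefficient, that is 1 - exp (-2 s
  \<open>gap\<close>). Some m does at least as well as this mean. A centre has to be chosen because
  the directed walk drifts.\<close>

lemma exists_center:
  assumes "0 < s"
  shows "\<exists>m. (\<Sum>x\<in>P. nu \<sigma> s x * phi (x - m)) \<le> 2 * s * gap"
proof (rule ccontr)
  assume "\<nexists>m. (\<Sum>x\<in>P. nu \<sigma> s x * phi (x - m)) \<le> 2 * s * gap"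
  then have gt: "2 * s * gap < (\<Sum>x\<in>P. nu \<sigma> s x * phi (x - m))" for m
    by (meson not_le)
  have s: "0 \<le> s" using assms by simp
  define f where "f = (\<Sum>x\<in>P. complex_of_real (nu \<sigma> s x) * chi x)"
  have one: "(1::int) \<in> P" using p_ge_2 by simp
  have f: "f = exp (of_real s * psi \<sigma> 1)"
    using fourier_nu[OF s one, of \<sigma>] by (simp add: f_def)
  have "2 * s * gap = (\<Sum>m\<in>P. nu \<sigma> s m * (2 * s * gap))"
    using sum_nu[OF s, of \<sigma>] by (simp flip: sum_distrib_right)
  also have "\<dots> < (\<Sum>m\<in>P. nu \<sigma> s m * (\<Sum>x\<in>P. nu \<sigma> s x * phi (x - m)))"
    using one by (intro sum_strict_mono mult_strict_left_mono gt nu_pos assms) auto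
  also have "\<dots> = (\<Sum>m\<in>P. \<Sum>x\<in>P. nu \<sigma> s m * nu \<sigma> s x) -
      Re (\<Sum>m\<in>P. \<Sum>x\<in>P. (of_real (nu \<sigma> s x) * chi x) * cnj (of_real (nu \<sigma> s m) * chi m))"
  proof -
    have "nu \<sigma> s m * (nu \<sigma> s x * phi (x - m)) = nu \<sigma> s m * nu \<sigma> s x -
        Re ((of_real (nu \<sigma> s x) * chi x) * cnj (of_real (nu \<sigma> s m) * chi m))" for m x
    proof -
      have "(of_real (nu \<sigma> s x) * chi x) * cnj (of_real (nu \<sigma> s m) * chi m)
          = (nu \<sigma> s m * nu \<sigma> s x) *\<^sub>R chi (x - m)"
        by (simp add: chi_diff scaleR_conv_of_real mult_ac)
      then have "Re ((of_real (nu \<sigma> s x) * chi x) * cnj (of_real (nu \<sigma> s m) * chi m))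
          = nu \<sigma> s m * nu \<sigma> s x * (1 - phi (x - m))"
        by (simp only: scaleR_complex.sel Re_chi)
      then show ?thesis by (simp add: algebra_simps)
    qed
    then show ?thesis by (simp only: sum_distrib_left sum_subtractf Re_sum)
  qed
  also have "(\<Sum>m\<in>P. \<Sum>x\<in>P. nu \<sigma> s m * nu \<sigma> s x) = 1"
    using sum_nu[OF s, of \<sigma>] by (simp add: sum_product[symmetric])
  also have "(\<Sum>m\<in>P. \<Sum>x\<in>P. (of_real (nu \<sigma> s x) * chi x) * cnj (of_real (nu \<sigma> s m) * chi m)) = f * cnj f"
    unfolding f_def cnj_sum sum_product by (rule sum.swap)
  also have "f * cnj f = of_real ((exp (- (s * gap)))\<^sup>2)"
    unfolding complex_norm_square[symmetric] f norm_exp_psi gap_def ..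
  also have "1 - Re (of_real ((exp (- (s * gap)))\<^sup>2)) = 1 - exp (- (2 * s * gap))"
    by (simp add: power2_eq_square exp_add[symmetric])
  also have "\<dots> \<le> 2 * s * gap"
    using exp_ge_add_one_self[of "- (2 * s * gap)"] by simp
  finally show False by simp
qed

text \<open>With A = 1 / (s \<open>gap\<close>) the width p / sqrt A is sqrt (p^2
  \<open>gap\<close>) sqrt s, so p disappears. The 9 is twice a bound for sqrt 2 * pi.\<close>

lemma sum_resolvent_gap:
  assumes "0 < s"
  shows "(\<Sum>x\<in>P. 1 / (1 + phi (x - m) / (s * gap))) \<le> 1 + 9 * sqrt s"
proof -
  have "(\<Sum>x\<in>P. 1 / (1 + (1 / (s * gap)) * phi (x - m))) \<le> 1 + 2 * real p / sqrt (1 / (s * gap))"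
    using assms gap_pos by (intro sum_resolvent) simp
  moreover have "real p / sqrt (1 / (s * gap)) \<le> 9 / 2 * sqrt s"
  proof -
    have "real p / sqrt (1 / (s * gap)) = sqrt ((real p)\<^sup>2 * gap) * sqrt s"
      using assms gap_pos by (simp add: real_sqrt_divide real_sqrt_mult)
    also have "sqrt ((real p)\<^sup>2 * gap) \<le> sqrt (2 * pi\<^sup>2)"
      using gap_mult_p2 by simp
    also have "sqrt (2 * pi\<^sup>2) = sqrt 2 * pi" by (simp add: real_sqrt_mult)
    also have "sqrt 2 * pi \<le> 1.42 * 3.15"
    proof (intro mult_mono)
      show "sqrt 2 \<le> 1.42" by (rule real_le_lsqrt) (auto simp: power2_eq_square)
      show "pi \<le> 3.15" using pi_approx by simp
    qed auto
    also have "1.42 * 3.15 \<le> (9 / 2 :: real)" by simp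
    finally show ?thesis using assms by simp
  qed
  ultimately show ?thesis by (simp add: mult.commute)
qed

text \<open>Compare the law with the Lorentzian \<open>q\<close> of width sqrt s around a good
  centre. Its heavy tail suits the only information at hand, a second moment: 1 / \<open>q\<close>
  grows linearly in \<open>b\<close>, so the chi-square distance from \<open>q\<close> is controlled
  by the mean of \<open>b\<close>, and so is the second moment of ln \<open>a\<close>.\<close>

lemma varentropy1_bounded:
  assumes "0 < s" "s \<le> (real p)\<^sup>2"
  shows "varentropy1 \<sigma> s \<le> 166 + 18 / sqrt s"
proof -
  obtain m where m: "(\<Sum>x\<in>P. nu \<sigma> s x * phi (x - m)) \<le> 2 * s * gap"
    using exists_center[OF assms(1)] by blast
  have s: "0 \<le> s" using assms by simp
  define b where "b x = phi (x - m) / (s * gap)" for x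
  define a where "a x = 1 + b x" for x
  define Z where "Z = (\<Sum>x\<in>P. 1 / a x)"
  define q where "q x = 1 / (Z * a x)" for x
  have sg: "0 < s * gap" using assms gap_pos by simp
  have b: "0 \<le> b x" for x using sg phi_nonneg by (simp add: b_def)
  then have a: "1 \<le> a x" "0 < a x" for x by (auto simp: a_def intro: add_pos_nonneg)
  have Z: "0 < Z" unfolding Z_def using a p_ge_2 by (intro sum_pos) auto
  have Z_le: "Z \<le> 1 + 9 * sqrt s"
    unfolding Z_def a_def b_def using sum_resolvent_gap[OF assms(1)] by simp
  have sum_q: "(\<Sum>x\<in>P. q x) = 1"
  proof -
    have "(\<Sum>x\<in>P. q x) = (\<Sum>x\<in>P. 1 / a x) / Z"
      by (simp add: q_def sum_divide_distrib mult.commute)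
    then show ?thesis using Z by (simp add: Z_def)
  qed
  have q: "0 < q x" for x using Z a by (simp add: q_def)
  have sum_b: "(\<Sum>x\<in>P. nu \<sigma> s x * b x) \<le> 2"
    using m sg by (simp add: b_def divide_le_eq mult_ac flip: sum_divide_distrib)
  have sum_a: "(\<Sum>x\<in>P. nu \<sigma> s x * a x) \<le> 3"
    using sum_b by (simp add: a_def ring_distribs sum.distrib sum_nu[OF s])
  \<comment> \<open>The only use of s \<le> p^2: the uniform part 1 / p of the pointwise bound is
    absorbed.\<close>
  have nu_b: "nu \<sigma> s x \<le> 3 / sqrt s" for x
  proof -
    have "sqrt s \<le> real p" using assms(2) by (intro real_le_lsqrt) auto
    then have "1 / real p \<le> 1 / sqrt s" using assms(1) by (intro divide_left_mono) auto
    then show ?thesis using nu_le[OF assms(1), of \<sigma> x] by simp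
  qed
  \<comment> \<open>Centring at ln Z splits the logarithm into ln (\<nu> / q) - ln a.\<close>
  have "varentropy1 \<sigma> s \<le> (\<Sum>x\<in>P. nu \<sigma> s x * (ln (nu \<sigma> s x) + ln Z)\<^sup>2)"
    by (rule varentropy1_le[OF s])
  also have "\<dots> \<le> (\<Sum>x\<in>P. 2 * ((nu \<sigma> s x)\<^sup>2 / q x - 2 * nu \<sigma> s x + q x) + 2 * (nu \<sigma> s x * b x))"
  proof (intro sum_mono)
    fix x
    let ?n = "nu \<sigma> s x"
    have n: "0 < ?n" by (rule nu_pos[OF assms(1)])
    have "q x * (?n / q x * (ln (?n / q x))\<^sup>2) \<le> q x * (?n / q x - 1)\<^sup>2"
      using n q[of x] by (intro mult_left_mono mult_ln_power2_le) auto
    also have "q x * (?n / q x - 1)\<^sup>2 = ?n\<^sup>2 / q x - 2 * ?n + q x"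
      using q[of x] by (simp add: power2_eq_square field_simps)
    also have "q x * (?n / q x * (ln (?n / q x))\<^sup>2) = ?n * (ln (?n / q x))\<^sup>2"
      using q[of x] by simp
    finally have 1: "?n * (ln (?n / q x))\<^sup>2 \<le> ?n\<^sup>2 / q x - 2 * ?n + q x" .
    have "a x * (ln (a x))\<^sup>2 \<le> (b x)\<^sup>2"
      using mult_ln_power2_le[OF a(2)[of x]] by (simp add: a_def)
    also have "(b x)\<^sup>2 \<le> a x * b x"
      using b[of x] by (simp add: a_def power2_eq_square algebra_simps)
    finally have "(ln (a x))\<^sup>2 \<le> b x" using a(2)[of x] by simp
    then have 2: "?n * (ln (a x))\<^sup>2 \<le> ?n * b x" using n by (intro mult_left_mono) auto
    have "ln ?n + ln Z = ln (?n / q x) - ln (a x)"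
      using n Z a(2)[of x] by (simp add: q_def ln_mult ln_div)
    moreover have "(u - v)\<^sup>2 \<le> 2 * u\<^sup>2 + 2 * v\<^sup>2" for u v :: real
      using zero_le_power2[of "u + v"] by (simp add: power2_eq_square algebra_simps)
    ultimately have "(ln ?n + ln Z)\<^sup>2 \<le> 2 * (ln (?n / q x))\<^sup>2 + 2 * (ln (a x))\<^sup>2" by simp
    then have "?n * (ln ?n + ln Z)\<^sup>2 \<le> ?n * (2 * (ln (?n / q x))\<^sup>2 + 2 * (ln (a x))\<^sup>2)"
      using n by (intro mult_left_mono) auto
    also have "\<dots> = 2 * (?n * (ln (?n / q x))\<^sup>2) + 2 * (?n * (ln (a x))\<^sup>2)" by (simp add: algebra_simps)
    also have "\<dots> \<le> 2 * (?n\<^sup>2 / q x - 2 * ?n + q x) + 2 * (?n * b x)"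
      by (rule add_mono[OF mult_left_mono[OF 1] mult_left_mono[OF 2]]) auto
    finally show "?n * (ln ?n + ln Z)\<^sup>2 \<le> 2 * (?n\<^sup>2 / q x - 2 * ?n + q x) + 2 * (?n * b x)" .
  qed
  also have "\<dots> = 2 * ((\<Sum>x\<in>P. (nu \<sigma> s x)\<^sup>2 / q x) - 1) + 2 * (\<Sum>x\<in>P. nu \<sigma> s x * b x)"
    unfolding sum.distrib sum_subtractf sum_distrib_left[symmetric] sum_q sum_nu[OF s] by simp
  \<comment> \<open>The factors sqrt s cancel: one factor \<nu> is at most 3 / sqrt s, and Z is of
    order 1 + sqrt s.\<close>
  also have "(\<Sum>x\<in>P. (nu \<sigma> s x)\<^sup>2 / q x) \<le> (\<Sum>x\<in>P. Z * (3 / sqrt s) * (nu \<sigma> s x * a x))"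
  proof (intro sum_mono)
    fix x
    have "nu \<sigma> s x * (Z * (nu \<sigma> s x * a x)) \<le> 3 / sqrt s * (Z * (nu \<sigma> s x * a x))"
      using Z a(2)[of x] nu_nonneg by (intro mult_right_mono nu_b) auto
    then show "(nu \<sigma> s x)\<^sup>2 / q x \<le> Z * (3 / sqrt s) * (nu \<sigma> s x * a x)"
      by (simp add: q_def power2_eq_square mult_ac)
  qed
  also have "\<dots> = Z * (3 / sqrt s) * (\<Sum>x\<in>P. nu \<sigma> s x * a x)"
    by (simp add: sum_distrib_left)
  also have "\<dots> \<le> (1 + 9 * sqrt s) * (3 / sqrt s) * 3"
    using sum_a Z_le Z assms(1) by (intro mult_mono) (auto intro!: sum_nonneg mult_nonneg_nonneg nu_nonneg less_imp_le[OF a(2)])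
  also have "\<dots> = 9 / sqrt s + 81"
    using assms(1) by (simp add: field_simps)
  finally show ?thesis using sum_b by simp
qed

text \<open>The moment about the starting point, for small times where the drift is harmless: it is
  1 minus the real part of the first Fourier coefficient, and the rotation contributes the
  s^2.\<close>

lemma phi_moment_le:
  assumes "0 < s"
  shows "(\<Sum>x\<in>P. nu \<sigma> s x * phi x) \<le> (s + s\<^sup>2) * gap"
proof -
  have s: "0 \<le> s" using assms by simp
  have one: "(1::int) \<in> P" using p_ge_2 by simp
  define \<theta> where "\<theta> = 2 * pi / real p"
  have gap_cos: "gap = 1 - cos \<theta>" by (simp add: gap_def phi_def \<theta>_def)
  have "(\<Sum>x\<in>P. nu \<sigma> s x * phi x) = 1 - Re (\<Sum>x\<in>P. of_real (nu \<sigma> s x) * chi (1 * x))"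
    using sum_nu[OF s, of \<sigma>] by (simp add: Re_chi right_diff_distrib sum_subtractf)
  also have "\<dots> = 1 - Re (exp (of_real s * psi \<sigma> 1))"
    by (simp only: fourier_nu[OF s one])
  also have "\<dots> \<le> (s + s\<^sup>2) * gap"
  proof (cases \<sigma>)
    case Undirected
    have "1 - Re (exp (of_real s * psi \<sigma> 1)) = 1 - exp (- (s * gap))"
      by (simp add: Undirected psi_def Re_exp gap_def)
    also have "\<dots> \<le> s * gap" using exp_ge_add_one_self[of "- (s * gap)"] by simp
    also have "\<dots> \<le> (s + s\<^sup>2) * gap" using gap_pos by (intro mult_right_mono) auto
    finally show ?thesis .
  next
    case Directed
    have "1 - Re (exp (of_real s * psi \<sigma> 1)) = 1 - exp (- (s * gap)) * cos (s * sin \<theta>)"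
      by (simp add: Directed psi_def Re_exp gap_def chi_def phi_def \<theta>_def right_diff_distrib)
    also have "\<dots> \<le> s * gap + (s * sin \<theta>)\<^sup>2 / 2"
      using assms gap_pos by (intro one_minus_exp_mult_cos_le) simp
    \<comment> \<open>The squared drift is of the order of the gap, since sin^2 = (1 - cos) (1 +
      cos).\<close>
    also have "(s * sin \<theta>)\<^sup>2 / 2 \<le> s\<^sup>2 * gap"
    proof -
      have "(sin \<theta>)\<^sup>2 = gap * (1 + cos \<theta>)"
        using sin_cos_squared_add[of \<theta>] by (simp add: gap_cos power2_eq_square algebra_simps)
      also have "\<dots> \<le> gap * 2" using gap_pos by (intro mult_left_mono) auto
      finally have "s\<^sup>2 * (sin \<theta>)\<^sup>2 \<le> s\<^sup>2 * (gap * 2)" by (intro mult_left_mono) auto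
      then show ?thesis by (simp add: power_mult_distrib)
    qed
    finally show ?thesis by (simp add: algebra_simps)
  qed
  finally show ?thesis .
qed

text \<open>Gibbs' inequality against a Lorentzian at 0: the entropy is at most ln Z plus the mean
  of ln \<open>a\<close>. The parameter 1 / A takes the place of the time in the profile and remains
  free; a large A makes the first term small, a small s then the second.\<close>

lemma entropy1_le:
  assumes "0 < s" "0 < A"
  shows "entropy1 \<sigma> s \<le> 9 * sqrt (1 / A) + A * (s + s\<^sup>2)"
proof -
  have s: "0 \<le> s" using assms by simp
  define b where "b x = phi (x - 0) / (1 / A * gap)" for x
  define a where "a x = 1 + b x" for x
  define Z where "Z = (\<Sum>x\<in>P. 1 / a x)"
  have b: "0 \<le> b x" for x using gap_pos assms phi_nonneg by (simp add: b_def)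
  then have a: "0 < a x" for x by (auto simp: a_def intro: add_pos_nonneg)
  have Z: "0 < Z" unfolding Z_def using a p_ge_2 by (intro sum_pos) auto
  have Z_le: "Z \<le> 1 + 9 * sqrt (1 / A)"
    unfolding Z_def a_def b_def using assms by (intro sum_resolvent_gap) simp
  have "entropy1 \<sigma> s \<le> (\<Sum>x\<in>P. 1 / (Z * a x) - nu \<sigma> s x + nu \<sigma> s x * ln Z + nu \<sigma> s x * b x)"
    unfolding entropy1_def sum_negf[symmetric]
  proof (intro sum_mono)
    fix x
    let ?n = "nu \<sigma> s x"
    have n: "0 < ?n" by (rule nu_pos[OF assms(1)])
    have "ln (1 / (Z * a x * ?n)) \<le> 1 / (Z * a x * ?n) - 1"
      using n Z a by (intro ln_le_minus_one) auto
    then have "?n * (- ln Z - ln (a x) - ln ?n) \<le> ?n * (1 / (Z * a x * ?n) - 1)"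
      using n Z a[of x] by (intro mult_left_mono) (auto simp: ln_div ln_mult)
    also have "\<dots> = 1 / (Z * a x) - ?n" using n by (simp add: field_simps)
    finally have 1: "- (?n * ln ?n) \<le> 1 / (Z * a x) - ?n + ?n * ln Z + ?n * ln (a x)"
      by (simp add: algebra_simps)
    have "?n * ln (a x) \<le> ?n * b x"
      using n ln_add_one_self_le_self[OF b[of x]] by (intro mult_left_mono) (auto simp: a_def)
    with 1 show "- (?n * ln ?n) \<le> 1 / (Z * a x) - ?n + ?n * ln Z + ?n * b x" by linarith
  qed
  also have "\<dots> = (\<Sum>x\<in>P. 1 / a x) / Z - 1 + ln Z + (\<Sum>x\<in>P. nu \<sigma> s x * phi x) / (1 / A * gap)"
  proof -
    have "(\<Sum>x\<in>P. 1 / (Z * a x)) = (\<Sum>x\<in>P. 1 / a x) / Z"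
      by (simp add: sum_divide_distrib mult.commute)
    moreover have "(\<Sum>x\<in>P. nu \<sigma> s x * b x) = (\<Sum>x\<in>P. nu \<sigma> s x * phi x) / (1 / A * gap)"
      unfolding b_def sum_divide_distrib by (simp add: mult.assoc)
    moreover have "(\<Sum>x\<in>P. nu \<sigma> s x * ln Z) = ln Z"
      using sum_nu[OF s, of \<sigma>] by (simp flip: sum_distrib_right)
    ultimately show ?thesis
      using sum_nu[OF s, of \<sigma>] by (simp add: sum.distrib sum_subtractf)
  qed
  also have "\<dots> \<le> 1 - 1 + 9 * sqrt (1 / A) + (s + s\<^sup>2) * gap / (1 / A * gap)"
    using Z Z_le ln_le_minus_one[OF Z] phi_moment_le[OF assms(1), of \<sigma>] gap_pos assms
    by (intro add_mono diff_mono divide_right_mono) (auto simp: Z_def)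
  also have "\<dots> = 9 * sqrt (1 / A) + A * (s + s\<^sup>2)"
    using gap_pos assms by (simp add: field_simps)
  finally show ?thesis .
qed

end

section \<open>Growth of the entropy\<close>

context cycle
begin

lemma nu_mod_diff: "nu \<sigma> s (x mod int p - m) = nu \<sigma> s (x - m)"
  by (metis mod_diff_left_eq nu_mod)

text \<open>The right-hand side of the forward equation: the generator applied to the law.\<close>

definition dnu :: "orientation \<Rightarrow> real \<Rightarrow> int \<Rightarrow> real" where
  "dnu \<sigma> s x = (case \<sigma> of
     Directed \<Rightarrow> nu \<sigma> s (x - 1) - nu \<sigma> s x
   | Undirected \<Rightarrow> (nu \<sigma> s (x - 1) + nu \<sigma> s (x + 1)) / 2 - nu \<sigma> s x)"

lemma DERIV_nu:
  assumes "0 < s"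
  shows "((\<lambda>s. nu \<sigma> s x) has_real_derivative dnu \<sigma> s x) (at s)"
proof -
  have s: "0 \<le> s" using assms by simp
  define f where "f z = (\<Sum>j\<in>P. exp (z * psi \<sigma> j) * chi (- (j * x))) / of_nat p" for z
  define f' where "f' = (\<Sum>j\<in>P. psi \<sigma> j * exp (of_real s * psi \<sigma> j) * chi (- (j * x))) / of_nat p"
  have "(f has_field_derivative f') (at (of_real s))"
    unfolding f_def f'_def using p_ge_2 by (auto intro!: derivative_eq_intros simp: mult_ac)
  then have "((\<lambda>s. f (of_real s)) has_vector_derivative f') (at s)"
    by (rule has_vector_derivative_real_field)
  then have "((\<lambda>s. Re (f (of_real s))) has_vector_derivative Re f') (at s)"
    by (rule bounded_linear.has_vector_derivative[OF bounded_linear_Re])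
  then have "((\<lambda>s. Re (f (of_real s))) has_real_derivative Re f') (at s)"
    by (simp add: has_real_derivative_iff_has_vector_derivative)
  \<comment> \<open>The Fourier formula represents \<open>nu\<close> at nonnegative times only, so
    the derivative is transferred on the open half-line.\<close>
  then have "((\<lambda>s. nu \<sigma> s x) has_real_derivative Re f') (at s)"
  proof (rule has_field_derivative_transform_within_open[where S = "{0<..}"])
    fix u :: real assume "u \<in> {0<..}"
    then show "Re (f (of_real u)) = nu \<sigma> u x"
      using nu_eq_inv_fourier[of u \<sigma> x] by (simp add: f_def inv_fourier_def[symmetric] flip: nu_eq_inv_fourier)
  qed (use assms in auto)
  moreover have "f' = of_real (dnu \<sigma> s x)"
  proof (cases \<sigma>)
    case Directed
    have "psi \<sigma> j * exp (of_real s * psi \<sigma> j) * chi (- (j * x))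
        = exp (of_real s * psi \<sigma> j) * chi (- (j * (x - 1))) - exp (of_real s * psi \<sigma> j) * chi (- (j * x))" for j
    proof -
      have "chi (- (j * (x - 1))) = chi (- (j * x)) * chi j"
        by (simp add: right_diff_distrib flip: chi_add)
      then show ?thesis by (simp add: Directed psi_def algebra_simps)
    qed
    then have "f' = inv_fourier \<sigma> s (x - 1) - inv_fourier \<sigma> s x"
      by (simp add: f'_def inv_fourier_def sum_subtractf diff_divide_distrib)
    then show ?thesis by (simp add: Directed dnu_def nu_eq_inv_fourier[OF s])
  next
    case Undirected
    have "psi \<sigma> j * exp (of_real s * psi \<sigma> j) * chi (- (j * x))
        = exp (of_real s * psi \<sigma> j) * chi (- (j * (x - 1))) / 2 + exp (of_real s * psi \<sigma> j) * chi (- (j * (x + 1))) / 2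
          - exp (of_real s * psi \<sigma> j) * chi (- (j * x))" for j
    proof -
      have 1: "chi (- (j * (x - 1))) = chi (- (j * x)) * chi j"
        by (simp add: right_diff_distrib flip: chi_add)
      have 2: "chi (- (j * (x + 1))) = chi (- (j * x)) * cnj (chi j)"
        by (simp add: distrib_left flip: chi_add chi_minus)
      have eq: "psi \<sigma> j = (chi j + cnj (chi j)) / 2 - 1"
        by (simp add: complex_add_cnj Re_chi psi_def Undirected diff_divide_distrib)
      have "psi \<sigma> j * E * C = E * (C * chi j) / 2 + E * (C * cnj (chi j)) / 2 - E * C" for E C
        by (simp only: eq) (simp add: field_simps)
      then show ?thesis unfolding 1 2 .
    qed
    then have "f' = inv_fourier \<sigma> s (x - 1) / 2 + inv_fourier \<sigma> s (x + 1) / 2 - inv_fourier \<sigma> s x"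
      by (simp add: f'_def inv_fourier_def sum.distrib sum_subtractf sum_divide_distrib add_divide_distrib diff_divide_distrib)
         (simp add: mult.commute)
    then show ?thesis by (simp add: Undirected dnu_def nu_eq_inv_fourier[OF s] add_divide_distrib)
  qed
  ultimately show ?thesis by simp
qed

definition entropy1_rate :: "orientation \<Rightarrow> real \<Rightarrow> real" where
  "entropy1_rate \<sigma> s = - (\<Sum>x\<in>P. dnu \<sigma> s x * ln (nu \<sigma> s x))"

lemma sum_dnu:
  assumes "0 \<le> s"
  shows "(\<Sum>x\<in>P. dnu \<sigma> s x) = 0"
  using sum_nu_shift[OF assms, of \<sigma> "-1"] sum_nu_shift[OF assms, of \<sigma> 1] sum_nu[OF assms, of \<sigma>]
  by (cases \<sigma>) (simp_all add: dnu_def sum_subtractf sum.distrib flip: sum_divide_distrib)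

lemma DERIV_entropy1:
  assumes "0 < s"
  shows "(entropy1 \<sigma> has_real_derivative entropy1_rate \<sigma> s) (at s)"
proof -
  have "((\<lambda>s. - (\<Sum>x\<in>P. nu \<sigma> s x * ln (nu \<sigma> s x))) has_real_derivative
      - (\<Sum>x\<in>P. dnu \<sigma> s x * ln (nu \<sigma> s x) + dnu \<sigma> s x)) (at s)"
    using nu_pos[OF assms, of \<sigma>, THEN less_imp_neq]
    by (auto intro!: derivative_eq_intros DERIV_nu assms nu_pos sum.cong simp: field_simps)
  then show ?thesis
    using sum_dnu[of s \<sigma>] assms by (simp add: entropy1_def[abs_def] entropy1_rate_def sum.distrib)
qed

text \<open>Shifting the summation index turns the entropy production into the relative entropy of
  the law with respect to its shift, or the mean over both shifts. Each is at least the squared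
  Hellinger distance, which does not see the direction.\<close>

lemma hellinger_shift_le_entropy1_rate:
  assumes "0 < s"
  shows "(\<Sum>x\<in>P. (sqrt (nu \<sigma> s (x + 1)) - sqrt (nu \<sigma> s x))\<^sup>2) \<le> entropy1_rate \<sigma> s"
proof -
  have s: "0 \<le> s" using assms by simp
  let ?n = "nu \<sigma> s"
  define B where "B = (\<Sum>x\<in>P. 2 * ?n x - 2 * sqrt (?n x * ?n (x + 1)))"
  have ge: "(\<Sum>x\<in>P. 2 * ?n x - 2 * sqrt (?n x * ?n (x + m))) \<le> (\<Sum>x\<in>P. ?n x * (ln (?n x) - ln (?n (x + m))))" for m
    using nu_pos[OF assms] by (intro sum_mono mult_ln_ratio_ge) auto
  have shift: "(\<Sum>x\<in>P. ?n (x + m) * ln (?n x)) = (\<Sum>x\<in>P. ?n x * ln (?n (x - m)))" for m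
    using periodic_sum_shift[of "\<lambda>x. ?n x * ln (?n (x - m))" m] by (simp add: nu_mod_diff)
  have "B = (\<Sum>x\<in>P. 2 * ?n x - 2 * sqrt (?n x * ?n (x - 1)))"
  proof -
    have "(\<Sum>x\<in>P. sqrt (?n (x + 1) * ?n x)) = (\<Sum>x\<in>P. sqrt (?n x * ?n (x - 1)))"
      using periodic_sum_shift[of "\<lambda>x. sqrt (?n x * ?n (x - 1))" 1] by (simp add: nu_mod_diff)
    then show ?thesis by (simp add: B_def sum_subtractf mult.commute flip: sum_distrib_left)
  qed
  have "B \<le> entropy1_rate \<sigma> s"
  proof (cases \<sigma>)
    case Directed
    have "entropy1_rate \<sigma> s = (\<Sum>x\<in>P. ?n x * ln (?n x)) - (\<Sum>x\<in>P. ?n (x + -1) * ln (?n x))"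
      by (simp add: Directed entropy1_rate_def dnu_def left_diff_distrib sum_subtractf)
    also have "\<dots> = (\<Sum>x\<in>P. ?n x * (ln (?n x) - ln (?n (x + 1))))"
      unfolding shift by (simp add: right_diff_distrib sum_subtractf)
    finally show ?thesis using ge[of 1] by (simp add: B_def)
  next
    case Undirected
    have "entropy1_rate \<sigma> s = (\<Sum>x\<in>P. ?n x * ln (?n x)) - ((\<Sum>x\<in>P. ?n (x + -1) * ln (?n x)) + (\<Sum>x\<in>P. ?n (x + 1) * ln (?n x))) / 2"
      by (simp add: Undirected entropy1_rate_def dnu_def left_diff_distrib sum_subtractf sum.distrib distrib_right sum_divide_distrib add_divide_distrib)
    also have "\<dots> = ((\<Sum>x\<in>P. ?n x * (ln (?n x) - ln (?n (x + 1)))) + (\<Sum>x\<in>P. ?n x * (ln (?n x) - ln (?n (x + -1))))) / 2"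
      unfolding shift by (simp add: right_diff_distrib sum_subtractf field_simps)
    finally show ?thesis
      using ge[of 1] ge[of "-1"] \<open>B = (\<Sum>x\<in>P. 2 * ?n x - 2 * sqrt (?n x * ?n (x - 1)))\<close> by (simp add: B_def)
  qed
  moreover have "(\<Sum>x\<in>P. (sqrt (?n (x + 1)) - sqrt (?n x))\<^sup>2) = B"
  proof -
    have "(\<Sum>x\<in>P. (sqrt (?n (x + 1)) - sqrt (?n x))\<^sup>2) = (\<Sum>x\<in>P. ?n (x + 1) + ?n x - 2 * sqrt (?n x * ?n (x + 1)))"
      by (intro sum.cong refl) (simp add: power2_diff nu_nonneg real_sqrt_mult)
    also have "\<dots> = B"
      by (simp add: B_def sum.distrib sum_subtractf sum_nu_shift[OF s] sum_nu[OF s] flip: sum_distrib_left)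
    finally show ?thesis .
  qed
  ultimately show ?thesis by simp
qed

lemma norm_chi_minus_one: "(cmod (chi j - 1))\<^sup>2 = 2 * phi j"
proof -
  have "(cmod (chi j - 1))\<^sup>2 = (Re (chi j) - 1)\<^sup>2 + (Im (chi j))\<^sup>2"
    by (simp add: cmod_power2)
  also have "\<dots> = (cmod (chi j))\<^sup>2 - 2 * Re (chi j) + 1"
    by (simp only: cmod_power2) (simp add: power2_eq_square algebra_simps)
  finally show ?thesis by (simp add: Re_chi)
qed

text \<open>The Fourier coefficient at j of the difference between the law and its shift has modulus
  |chi j - 1| exp (- s phi j) and is at most the l1 norm. Writing |a - b| as |sqrt a - sqrt b| (sqrt
  a + sqrt b), Cauchy-Schwarz bounds the l1 norm by the Hellinger distance.\<close>

lemma phi_exp_le_entropy1_rate: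
  assumes "0 < s" "j \<in> P"
  shows "phi j * exp (- (2 * s * phi j)) / 2 \<le> entropy1_rate \<sigma> s"
proof -
  have s: "0 \<le> s" using assms by simp
  let ?n = "nu \<sigma> s"
  let ?u = "\<lambda>x. \<bar>sqrt (?n (x + 1)) - sqrt (?n x)\<bar>" and ?v = "\<lambda>x. sqrt (?n (x + 1)) + sqrt (?n x)"
  have "(\<Sum>x\<in>P. of_real (?n (x + 1)) * chi (j * (x + 1))) = (\<Sum>x\<in>P. of_real (?n x) * chi (j * x))"
    by (rule periodic_sum_shift) (simp add: chi_mult_mod)
  then have "chi j * (\<Sum>x\<in>P. of_real (?n (x + 1)) * chi (j * x)) = exp (of_real s * psi \<sigma> j)"
    unfolding fourier_nu[OF s assms(2)] by (simp add: sum_distrib_left distrib_left chi_add mult_ac)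
  then have eq: "chi j * (\<Sum>x\<in>P. of_real (?n (x + 1) - ?n x) * chi (j * x)) = (1 - chi j) * exp (of_real s * psi \<sigma> j)"
    using fourier_nu[OF s assms(2), of \<sigma>] by (simp add: left_diff_distrib sum_subtractf right_diff_distrib)
  have "cmod (chi j - 1) * exp (- (s * phi j)) = cmod (\<Sum>x\<in>P. of_real (?n (x + 1) - ?n x) * chi (j * x))"
    using arg_cong[OF eq, of cmod] by (simp add: norm_mult Re_psi norm_minus_commute)
  also have "\<dots> \<le> (\<Sum>x\<in>P. \<bar>?n (x + 1) - ?n x\<bar>)"
    by (rule order_trans[OF norm_sum]) (simp only: norm_mult norm_chi norm_of_real mult_1_right order_refl)
  also have "\<dots> = (\<Sum>x\<in>P. ?u x * ?v x)"
  proof (intro sum.cong refl)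
    fix x
    have "?n (x + 1) - ?n x = (sqrt (?n (x + 1)) - sqrt (?n x)) * ?v x"
      by (simp add: algebra_simps nu_nonneg)
    then show "\<bar>?n (x + 1) - ?n x\<bar> = ?u x * ?v x"
      by (simp add: abs_mult nu_nonneg)
  qed
  finally have "(cmod (chi j - 1) * exp (- (s * phi j)))\<^sup>2 \<le> (\<Sum>x\<in>P. ?u x * ?v x)\<^sup>2"
    by (intro power_mono) auto
  also have "\<dots> \<le> (\<Sum>x\<in>P. (?u x)\<^sup>2) * (\<Sum>x\<in>P. (?v x)\<^sup>2)"
    by (rule Cauchy_Schwarz_ineq_sum)
  also have "\<dots> \<le> entropy1_rate \<sigma> s * 4"
  proof (intro mult_mono)
    have "(\<Sum>x\<in>P. (?v x)\<^sup>2) \<le> (\<Sum>x\<in>P. 2 * ?n (x + 1) + 2 * ?n x)"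
    proof (intro sum_mono)
      fix x
      have "0 \<le> (sqrt (?n (x + 1)) - sqrt (?n x))\<^sup>2" by simp
      then show "(?v x)\<^sup>2 \<le> 2 * ?n (x + 1) + 2 * ?n x"
        unfolding power2_sum power2_diff by (simp add: nu_nonneg)
    qed
    also have "\<dots> = 4"
      by (simp add: sum.distrib sum_nu_shift[OF s] sum_nu[OF s] flip: sum_distrib_left)
    finally show "(\<Sum>x\<in>P. (?v x)\<^sup>2) \<le> 4" .
    show "(\<Sum>x\<in>P. (?u x)\<^sup>2) \<le> entropy1_rate \<sigma> s" using hellinger_shift_le_entropy1_rate[OF assms(1), of \<sigma>] by simp
    then show "0 \<le> entropy1_rate \<sigma> s" by (rule order_trans[rotated]) (simp add: sum_nonneg)
  qed (simp add: sum_nonneg)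
  also have "(cmod (chi j - 1) * exp (- (s * phi j)))\<^sup>2 = 2 * phi j * exp (- (2 * s * phi j))"
    by (simp add: power_mult_distrib norm_chi_minus_one exp_double[symmetric] mult.assoc)
  finally show ?thesis by simp
qed

lemma gap_exp_le_entropy1_rate:
  assumes "0 < s"
  shows "gap * exp (- (2 * s * gap)) / 2 \<le> entropy1_rate \<sigma> s"
  using phi_exp_le_entropy1_rate[OF assms, of 1 \<sigma>] p_ge_2 by (simp add: gap_def)

text \<open>In the diffusive regime the best frequency is j near p / sqrt s, for which
  \<open>phi j\<close> is of order 1 / s. It must not exceed p / 2, whence the separate treatment of
  s < 4, where c / s \<le> 1 caps the claim.\<close>

lemma inverse_le_entropy1_rate:
  assumes c: "0 < c" "c \<le> 1" "c \<le> s" and s: "s \<le> (real p)\<^sup>2"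
  shows "c * exp (- (4 * pi\<^sup>2)) / s \<le> entropy1_rate \<sigma> s"
proof (cases "s < 4")
  case True
  define j where "j = int (p div 2)"
  have j: "j \<in> P" "\<bar>2 * j\<bar> \<le> int p" using p_ge_2 by (auto simp: j_def)
  \<comment> \<open>The highest available frequency; p = 3 with j = 1 is the extremal case.\<close>
  have "int p \<le> 3 * j" using p_ge_2 by (simp add: j_def)
  then have "real p \<le> 3 * of_int j" by linarith
  then have "(real p)\<^sup>2 \<le> (3 * of_int j)\<^sup>2" by (intro power_mono) auto
  then have "8 / 9 \<le> 8 * (of_int j)\<^sup>2 / (real p)\<^sup>2"
    using p_ge_2 by (simp add: field_simps power_mult_distrib)
  with phi_lower[OF j(2)] have phi: "8 / 9 \<le> phi j" by linarith
  have "c / s \<le> 1" using c by simp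
  then have "c / s * exp (- (4 * pi\<^sup>2)) \<le> 1 * exp (- (4 * pi\<^sup>2))"
    by (intro mult_right_mono) auto
  then have "c * exp (- (4 * pi\<^sup>2)) / s \<le> exp (- (4 * pi\<^sup>2))" by simp
  also have "\<dots> \<le> exp (- 20) * exp (- 16 :: real)"
  proof -
    have "3 * 3 \<le> pi * pi" using pi_gt3 by (intro mult_mono) auto
    then show ?thesis by (simp add: exp_add[symmetric] power2_eq_square)
  qed
  also have "\<dots> \<le> 4 / 9 * exp (- 16)"
    using exp_minus_le_inverse[of 20] by (intro mult_right_mono) auto
  also have "\<dots> \<le> phi j * exp (- (2 * s * phi j)) / 2"
  proof -
    have "s * phi j \<le> 4 * 2"
      using True phi_le_2[of j] phi_nonneg[of j] c by (intro mult_mono) auto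
    then have "8 / 9 * exp (- 16) \<le> phi j * exp (- (2 * s * phi j))"
      using phi by (intro mult_mono) auto
    then show ?thesis by simp
  qed
  also have "\<dots> \<le> entropy1_rate \<sigma> s" using c by (intro phi_exp_le_entropy1_rate j) auto
  finally show ?thesis .
next
  case False
  define y where "y = real p / sqrt s"
  define j where "j = \<lfloor>y\<rfloor>"
  have rs: "2 \<le> sqrt s" "sqrt s \<le> real p"
    using False s by (auto intro!: real_le_rsqrt real_le_lsqrt)
  have s0: "0 < s" using False by simp
  have y1: "1 \<le> y" using rs s0 by (simp add: y_def le_divide_eq)
  have "y \<le> real p / 2" unfolding y_def using rs s0 by (intro divide_left_mono) auto
  then have j2: "of_int j \<le> y" "2 * j \<le> int p" "1 \<le> j"
    unfolding j_def using y1 by linarith+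
  \<comment> \<open>Rounding down loses at most a factor 2 because y \<ge> 1.\<close>
  have jy: "y / 2 \<le> of_int j"
  proof -
    have "y < of_int j + 1" unfolding j_def by linarith
    moreover have "1 \<le> real_of_int j" using j2(3) by simp
    ultimately show ?thesis by linarith
  qed
  have j: "j \<in> P" "\<bar>2 * j\<bar> \<le> int p" using j2 p_ge_2 by auto
  have y2: "y\<^sup>2 / (real p)\<^sup>2 = 1 / s" using s0 p_ge_2 by (simp add: y_def power_divide)
  have "2 / s = 8 * (y / 2)\<^sup>2 / (real p)\<^sup>2" using y2 by (simp add: power_divide)
  also have "\<dots> \<le> 8 * (of_int j)\<^sup>2 / (real p)\<^sup>2"
    using jy y1 by (intro divide_right_mono mult_left_mono power_mono) auto
  finally have lower: "2 / s \<le> phi j" using phi_lower[OF j(2)] by linarith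
  have "2 * pi\<^sup>2 * (of_int j)\<^sup>2 / (real p)\<^sup>2 \<le> 2 * pi\<^sup>2 * y\<^sup>2 / (real p)\<^sup>2"
    using j2 by (intro divide_right_mono mult_left_mono power_mono) auto
  also have "\<dots> = 2 * pi\<^sup>2 * (1 / s)" unfolding y2[symmetric] by simp
  finally have "phi j \<le> 2 * pi\<^sup>2 * (1 / s)" using phi_upper[of j] by linarith
  then have upper: "s * phi j \<le> 2 * pi\<^sup>2" using s0 by (simp add: field_simps)
  have "c * exp (- (4 * pi\<^sup>2)) / s \<le> 2 / s * exp (- (4 * pi\<^sup>2)) / 2"
    using c s0 by (simp add: divide_right_mono)
  also have "\<dots> \<le> phi j * exp (- (2 * s * phi j)) / 2"
    using lower upper phi_nonneg[of j] by (intro divide_right_mono mult_mono) auto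
  also have "\<dots> \<le> entropy1_rate \<sigma> s" using s0 by (intro phi_exp_le_entropy1_rate j) auto
  finally show ?thesis .
qed

lemma entropy1_rate_pos:
  assumes "0 < s"
  shows "0 < entropy1_rate \<sigma> s"
  using gap_exp_le_entropy1_rate[OF assms, of \<sigma>] gap_pos by (smt (verit) exp_gt_zero half_gt_zero mult_pos_pos)

lemma entropy1_strict_mono:
  assumes "0 < a" "a < b"
  shows "entropy1 \<sigma> a < entropy1 \<sigma> b"
proof (rule DERIV_pos_imp_increasing[OF assms(2)])
  fix s assume "a \<le> s" "s \<le> b"
  then have "0 < s" using assms by simp
  then show "\<exists>y. (entropy1 \<sigma> has_real_derivative y) (at s) \<and> 0 < y"
    using DERIV_entropy1 entropy1_rate_pos by blast
qed

text \<open>Integrate the production over [a, (1 + \<delta>) a]. If this interval ends before p^2,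
  the rate \<kappa> / s gives \<kappa> ln (1 + \<delta>). Otherwise the first mode gives a quarter
  of exp (-2 g a) - exp (-2 g b'), and the second exponential is smaller than the first by a fixed
  factor.\<close>

lemma entropy1_gain:
  assumes c: "0 < c" "c \<le> 1" "c \<le> a" and \<delta>: "0 < \<delta>" "\<delta> \<le> 1" and b: "(1 + \<delta>) * a \<le> b"
  shows "min (c * exp (- (4 * pi\<^sup>2)) * ln (1 + \<delta>)) ((1 - exp (- 8 * \<delta>)) / 4) * exp (- (2 * gap * a))
    \<le> entropy1 \<sigma> b - entropy1 \<sigma> a" (is "min ?u ?v * ?e \<le> _")
proof -
  define b' where "b' = (1 + \<delta>) * a"
  have a: "0 < a" using c by simp
  have ab: "a < b'" using a \<delta> by (simp add: b'_def)
  have Hb: "entropy1 \<sigma> b' \<le> entropy1 \<sigma> b"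
    using entropy1_strict_mono[of b' b \<sigma>] a ab b by (cases "b' = b") (auto simp: b'_def)
  have "min ?u ?v * ?e \<le> entropy1 \<sigma> b' - entropy1 \<sigma> a"
  proof (cases "b' \<le> (real p)\<^sup>2")
    case True
    define \<kappa> where "\<kappa> = c * exp (- (4 * pi\<^sup>2))"
    have "entropy1 \<sigma> a - \<kappa> * ln a \<le> entropy1 \<sigma> b' - \<kappa> * ln b'"
    proof (rule DERIV_nonneg_imp_nondecreasing[where f = "\<lambda>s. entropy1 \<sigma> s - \<kappa> * ln s"])
      fix s assume s: "a \<le> s" "s \<le> b'"
      then have "((\<lambda>s. entropy1 \<sigma> s - \<kappa> * ln s) has_real_derivative entropy1_rate \<sigma> s - \<kappa> / s) (at s)"
        using a by (auto intro!: derivative_eq_intros DERIV_entropy1)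
      moreover have "\<kappa> / s \<le> entropy1_rate \<sigma> s"
        unfolding \<kappa>_def using s True c by (intro inverse_le_entropy1_rate) auto
      ultimately show "\<exists>y. ((\<lambda>s. entropy1 \<sigma> s - \<kappa> * ln s) has_real_derivative y) (at s) \<and> 0 \<le> y"
        by (intro exI[of _ "entropy1_rate \<sigma> s - \<kappa> / s"]) simp
    next
      show "a \<le> b'" using ab by simp
    qed
    moreover have "ln b' = ln (1 + \<delta>) + ln a" using a \<delta> by (simp add: b'_def ln_mult)
    ultimately have "?u \<le> entropy1 \<sigma> b' - entropy1 \<sigma> a" by (simp add: \<kappa>_def algebra_simps)
    moreover have "min ?u ?v * ?e \<le> ?u * 1"
      using \<delta> a gap_pos c by (intro mult_mono) auto
    ultimately show ?thesis by simp
  next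
    case False
    have "entropy1 \<sigma> a + exp (- (2 * gap * a)) / 4 \<le> entropy1 \<sigma> b' + exp (- (2 * gap * b')) / 4"
    proof (rule DERIV_nonneg_imp_nondecreasing[where f = "\<lambda>s. entropy1 \<sigma> s + exp (- (2 * gap * s)) / 4"])
      fix s assume s: "a \<le> s" "s \<le> b'"
      then have "((\<lambda>s. entropy1 \<sigma> s + exp (- (2 * gap * s)) / 4) has_real_derivative
          entropy1_rate \<sigma> s - gap * exp (- (2 * s * gap)) / 2) (at s)"
        using a by (auto intro!: derivative_eq_intros DERIV_entropy1 simp: mult_ac)
      then show "\<exists>y. ((\<lambda>s. entropy1 \<sigma> s + exp (- (2 * gap * s)) / 4) has_real_derivative y) (at s) \<and> 0 \<le> y"
        using gap_exp_le_entropy1_rate[of s \<sigma>] s a by (intro exI[of _ "entropy1_rate \<sigma> s - gap * exp (- (2 * s * gap)) / 2"]) simp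
    next
      show "a \<le> b'" using ab by simp
    qed
    moreover have "exp (- (2 * gap * b')) \<le> exp (- 8 * \<delta>) * ?e"
    proof -
      \<comment> \<open>Since b' > p^2 and b' \<le> 2 a, the exponent 2 g a is at least 8; this is
        the 8 in \<open>exp (- 8 * \<delta>)\<close>.\<close>
      have "8 \<le> gap * (real p)\<^sup>2"
        using gap_lower p_ge_2 by (simp add: divide_le_eq)
      also have "\<dots> \<le> gap * b'" using False gap_pos by (intro mult_left_mono) auto
      also have "\<dots> \<le> gap * (2 * a)" unfolding b'_def using \<delta> a gap_pos by (intro mult_left_mono mult_right_mono) auto
      finally have "8 * \<delta> \<le> gap * (2 * a) * \<delta>" using \<delta> by (intro mult_right_mono) auto
      then show ?thesis by (simp add: b'_def exp_add[symmetric] algebra_simps)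
    qed
    moreover have "min ?u ?v * ?e \<le> ?v * ?e" by (intro mult_right_mono min.cobounded2) simp
    ultimately show ?thesis by (simp add: algebra_simps)
  qed
  with Hb show ?thesis by linarith
qed

text \<open>With A = (27 / T)^2 the first term of \<open>entropy1_le\<close> equals T / 3, and the
  bound on s makes the second at most T / 3.\<close>

lemma entropy1_small:
  assumes "0 < T" "0 < s" "s \<le> 1" "s \<le> T / (6 * (27 / T)\<^sup>2)"
  shows "entropy1 \<sigma> s < T"
proof -
  define A where "A = (27 / T)\<^sup>2"
  have A: "0 < A" using assms by (simp add: A_def)
  have "A * (s + s\<^sup>2) \<le> A * (2 * s)"
    using assms A by (intro mult_left_mono) (auto simp: power2_eq_square mult_left_le)
  also have "\<dots> \<le> T / 3" using assms(4) A unfolding A_def[symmetric] by (simp add: field_simps)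
  finally have "A * (s + s\<^sup>2) \<le> T / 3" .
  moreover have "9 * sqrt (1 / A) = T / 3"
    using assms(1) by (simp add: A_def real_sqrt_divide)
  ultimately show ?thesis using entropy1_le[OF assms(2) A, of \<sigma>] assms(1) by simp
qed

lemma entropy1_ex1:
  assumes T: "0 < T" "T < ln (real p)"
  shows "\<exists>!s. 0 < s \<and> entropy1 \<sigma> s = T"
proof -
  define a where "a = min 1 (T / (6 * (27 / T)\<^sup>2))"
  have a: "0 < a" "entropy1 \<sigma> a < T"
    using T by (auto simp: a_def intro!: entropy1_small)
  define \<epsilon> where "\<epsilon> = ln (real p) - T"
  have \<epsilon>: "0 < \<epsilon>" using T by (simp add: \<epsilon>_def)
  \<comment> \<open>Large enough for \<open>chisq b\<close> to be at most the distance of T from the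
    maximal entropy ln p.\<close>
  define b where "b = max (a + 1) ((2 * real p / \<epsilon>)\<^sup>2)"
  have b: "a < b" "0 < b" using a by (auto simp: b_def)
  have "2 * real p / \<epsilon> \<le> sqrt b"
    by (rule real_le_rsqrt) (simp add: b_def)
  then have "2 * real p / sqrt b \<le> \<epsilon>" using \<epsilon> b by (simp add: field_simps)
  then have "T \<le> entropy1 \<sigma> b"
    using entropy1_deficit_le_chisq[OF b(2), of \<sigma>] chisq_le[OF b(2)] by (simp add: \<epsilon>_def)
  moreover have "continuous_on {a..b} (entropy1 \<sigma>)"
    using a by (intro continuous_at_imp_continuous_on ballI DERIV_isCont[OF DERIV_entropy1]) auto
  ultimately obtain s where "a \<le> s" "entropy1 \<sigma> s = T"
    using IVT'[of "entropy1 \<sigma>" a T b] a b by auto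
  then have "0 < s \<and> entropy1 \<sigma> s = T" using a by simp
  moreover have "s = s'" if "0 < s \<and> entropy1 \<sigma> s = T" "0 < s' \<and> entropy1 \<sigma> s' = T" for s s'
    using that entropy1_strict_mono[of s s' \<sigma>] entropy1_strict_mono[of s' s \<sigma>] by (metis less_irrefl linorder_neqE)
  ultimately show ?thesis by blast
qed

end

section \<open>The product law and the entropic time\<close>

lemma bdd_above_tv: "bdd_above (range (\<lambda>A. \<bar>measure_pmf.prob \<mu> A - measure_pmf.prob \<nu> A\<bar>))"
proof (rule bdd_aboveI2)
  fix A
  show "\<bar>measure_pmf.prob \<mu> A - measure_pmf.prob \<nu> A\<bar> \<le> 1"
    using measure_pmf.prob_le_1[of \<mu> A] measure_pmf.prob_le_1[of \<nu> A]
      measure_nonneg[of "measure_pmf \<mu>" A] measure_nonneg[of "measure_pmf \<nu>" A] by linarith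
qed

lemma tv_dist_ge: "\<bar>measure_pmf.prob \<mu> A - measure_pmf.prob \<nu> A\<bar> \<le> tv_dist \<mu> \<nu>"
  unfolding tv_dist_def by (rule cSUP_upper[OF UNIV_I bdd_above_tv])

lemma tv_dist_le:
  assumes "\<And>A. \<bar>measure_pmf.prob \<mu> A - measure_pmf.prob \<nu> A\<bar> \<le> c"
  shows "tv_dist \<mu> \<nu> \<le> c"
  unfolding tv_dist_def by (rule cSUP_least) (use assms in auto)

lemma tv_dist_nonneg: "0 \<le> tv_dist \<mu> \<nu>"
  using tv_dist_ge[of \<mu> "{}" \<nu>] by simp

lemma tv_dist_le_1: "tv_dist \<mu> \<nu> \<le> 1"
proof (rule tv_dist_le)
  fix A
  show "\<bar>measure_pmf.prob \<mu> A - measure_pmf.prob \<nu> A\<bar> \<le> 1"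
    using measure_pmf.prob_le_1[of \<mu> A] measure_pmf.prob_le_1[of \<nu> A]
      measure_nonneg[of "measure_pmf \<mu>" A] measure_nonneg[of "measure_pmf \<nu>" A] by linarith
qed

lemma tv_dist_map_le: "tv_dist (map_pmf f \<mu>) (map_pmf f \<nu>) \<le> tv_dist \<mu> \<nu>"
  by (rule tv_dist_le) (simp add: tv_dist_ge)

lemma prob_eq_sum:
  assumes "finite S" "set_pmf \<mu> \<subseteq> S"
  shows "measure_pmf.prob \<mu> A = (\<Sum>x\<in>S. if x \<in> A then pmf \<mu> x else 0)"
proof -
  have "measure_pmf.prob \<mu> A = measure_pmf.prob \<mu> (S \<inter> A)"
    by (rule measure_pmf.finite_measure_eq_AE) (use assms(2) in \<open>auto simp: AE_measure_pmf_iff\<close>)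
  also have "\<dots> = sum (pmf \<mu>) (S \<inter> A)" using assms(1) by (simp add: measure_measure_pmf_finite)
  finally show ?thesis using assms(1) by (simp add: sum.inter_restrict)
qed

lemma tv_dist_le_l1:
  assumes S: "finite S" "set_pmf \<mu> \<subseteq> S" "set_pmf \<nu> \<subseteq> S"
  shows "tv_dist \<mu> \<nu> \<le> (\<Sum>x\<in>S. \<bar>pmf \<mu> x - pmf \<nu> x\<bar>)"
proof (rule tv_dist_le)
  fix A
  have "\<bar>measure_pmf.prob \<mu> A - measure_pmf.prob \<nu> A\<bar>
      = \<bar>\<Sum>x\<in>S. (if x \<in> A then pmf \<mu> x - pmf \<nu> x else 0)\<bar>"
    unfolding prob_eq_sum[OF S(1,2)] prob_eq_sum[OF S(1,3)] sum_subtractf[symmetric]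
    by (intro arg_cong[where f = abs] sum.cong) auto
  also have "\<dots> \<le> (\<Sum>x\<in>S. \<bar>if x \<in> A then pmf \<mu> x - pmf \<nu> x else 0\<bar>)" by (rule sum_abs)
  also have "\<dots> \<le> (\<Sum>x\<in>S. \<bar>pmf \<mu> x - pmf \<nu> x\<bar>)" by (intro sum_mono) auto
  finally show "\<bar>measure_pmf.prob \<mu> A - measure_pmf.prob \<nu> A\<bar> \<le> (\<Sum>x\<in>S. \<bar>pmf \<mu> x - pmf \<nu> x\<bar>)" .
qed

section \<open>Moments of the product law\<close>

context cycle
begin

definition mu :: "orientation \<Rightarrow> nat \<Rightarrow> real \<Rightarrow> (nat \<Rightarrow> int) \<Rightarrow> real" where
  "mu \<sigma> k s x = (\<Prod>i<k. nu \<sigma> s (x i))"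

lemma mu_nonneg: "0 \<le> mu \<sigma> k s x"
  by (simp add: mu_def prod_nonneg nu_nonneg)

lemma mu_pos: "0 < s \<Longrightarrow> 0 < mu \<sigma> k s x"
  by (simp add: mu_def prod_pos nu_pos)

lemma sum_mu_prod: "(\<Sum>x\<in>cube k. mu \<sigma> k s x * (\<Prod>i<k. f i (x i))) = (\<Prod>i<k. \<Sum>y\<in>P. nu \<sigma> s y * f i y)"
  unfolding cube_def by (subst prod_sum_PiE) (auto simp: mu_def prod.distrib)

lemma sum_mu:
  assumes "0 \<le> s"
  shows "(\<Sum>x\<in>cube k. mu \<sigma> k s x) = 1"
  using sum_mu_prod[of \<sigma> k s "\<lambda>_ _. 1"] sum_nu[OF assms] by simp

lemma sum_mu_coordinate:
  assumes "0 \<le> s" "j < k"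
  shows "(\<Sum>x\<in>cube k. mu \<sigma> k s x * g (x j)) = (\<Sum>y\<in>P. nu \<sigma> s y * g y)"
proof -
  have "(\<Sum>x\<in>cube k. mu \<sigma> k s x * g (x j))
      = (\<Sum>x\<in>cube k. mu \<sigma> k s x * (\<Prod>i<k. if i = j then g (x i) else 1))"
    using assms(2) by (simp add: prod.delta)
  also have "\<dots> = (\<Prod>i<k. \<Sum>y\<in>P. nu \<sigma> s y * (if i = j then g y else 1))"
    by (rule sum_mu_prod)
  also have "\<dots> = (\<Prod>i<k. if i = j then \<Sum>y\<in>P. nu \<sigma> s y * g y else 1)"
    by (intro prod.cong refl) (simp add: sum_nu[OF assms(1)])
  finally show ?thesis using assms(2) by (simp add: prod.delta)
qed

lemma sum_mu_coordinates:
  assumes "0 \<le> s" "j < k" "l < k" "j \<noteq> l"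
  shows "(\<Sum>x\<in>cube k. mu \<sigma> k s x * (g (x j) * h (x l))) = (\<Sum>y\<in>P. nu \<sigma> s y * g y) * (\<Sum>y\<in>P. nu \<sigma> s y * h y)"
proof -
  have "(\<Prod>i<k. if i = j then u else if i = l then v else 1) = u * v" for u v :: real
    using assms by (subst prod.remove[of _ j]) (auto simp: prod.delta cong: if_cong intro!: prod.cong[THEN trans, where B1 = "{..<k} - {j}"])
  note prod2 = this
  have prod2': "(\<Prod>i<k. if i = j then g (x i) else if i = l then h (x i) else 1) = g (x j) * h (x l)" for x
    using prod2[of "g (x j)" "h (x l)"] by (simp cong: if_cong)
  have "(\<Sum>x\<in>cube k. mu \<sigma> k s x * (g (x j) * h (x l)))
      = (\<Prod>i<k. \<Sum>y\<in>P. nu \<sigma> s y * (if i = j then g y else if i = l then h y else 1))"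
    unfolding prod2'[symmetric] by (rule sum_mu_prod)
  also have "\<dots> = (\<Prod>i<k. if i = j then \<Sum>y\<in>P. nu \<sigma> s y * g y else if i = l then \<Sum>y\<in>P. nu \<sigma> s y * h y else 1)"
    by (intro prod.cong refl) (simp add: sum_nu[OF assms(1)])
  finally show ?thesis by (simp add: prod2)
qed

lemma sum_mu_variance:
  assumes "0 \<le> s" "(\<Sum>y\<in>P. nu \<sigma> s y * g y) = 0"
  shows "(\<Sum>x\<in>cube k. mu \<sigma> k s x * (\<Sum>i<k. g (x i))\<^sup>2) = real k * (\<Sum>y\<in>P. nu \<sigma> s y * (g y)\<^sup>2)"
proof -
  have "(\<Sum>x\<in>cube k. mu \<sigma> k s x * (\<Sum>i<k. g (x i))\<^sup>2)
      = (\<Sum>x\<in>cube k. \<Sum>i<k. \<Sum>j<k. mu \<sigma> k s x * (g (x i) * g (x j)))"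
    unfolding power2_eq_square sum_product by (simp add: sum_distrib_left)
  also have "\<dots> = (\<Sum>i<k. \<Sum>x\<in>cube k. \<Sum>j<k. mu \<sigma> k s x * (g (x i) * g (x j)))"
    by (rule sum.swap)
  also have "\<dots> = (\<Sum>i<k. \<Sum>j<k. \<Sum>x\<in>cube k. mu \<sigma> k s x * (g (x i) * g (x j)))"
    by (intro sum.cong refl sum.swap)
  also have "\<dots> = (\<Sum>i<k. \<Sum>j<k. if j = i then \<Sum>y\<in>P. nu \<sigma> s y * (g y)\<^sup>2 else 0)"
  proof (intro sum.cong refl)
    fix i j assume ij: "i \<in> {..<k}" "j \<in> {..<k}"
    show "(\<Sum>x\<in>cube k. mu \<sigma> k s x * (g (x i) * g (x j))) = (if j = i then \<Sum>y\<in>P. nu \<sigma> s y * (g y)\<^sup>2 else 0)"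
    proof (cases "j = i")
      case True
      then show ?thesis
        using sum_mu_coordinate[OF assms(1), of i k \<sigma> "\<lambda>y. g y * g y"] ij by (simp add: power2_eq_square)
    next
      case False
      then show ?thesis using sum_mu_coordinates[OF assms(1), of i k j \<sigma> g g] ij assms(2) by simp
    qed
  qed
  also have "\<dots> = real k * (\<Sum>y\<in>P. nu \<sigma> s y * (g y)\<^sup>2)" by simp
  finally show ?thesis .
qed

lemma ln_mu:
  assumes "0 < s"
  shows "ln (mu \<sigma> k s x) = (\<Sum>i<k. ln (nu \<sigma> s (x i)))"
  unfolding mu_def by (rule ln_prod) (use nu_pos[OF assms] in \<open>auto simp: less_le\<close>)

text \<open>- ln \<mu> is a sum of k independent terms with mean \<open>entropy1\<close> and
  variance \<open>varentropy1\<close>, so this is Chebyshev's inequality with finite sums.\<close>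

lemma mu_chebyshev:
  assumes "0 < s" "0 < r"
  shows "(\<Sum>x\<in>{x \<in> cube k. r \<le> \<bar>ln (mu \<sigma> k s x) + real k * entropy1 \<sigma> s\<bar>}. mu \<sigma> k s x) \<le> real k * varentropy1 \<sigma> s / r\<^sup>2"
proof -
  have s: "0 \<le> s" using assms by simp
  let ?g = "\<lambda>y. ln (nu \<sigma> s y) + entropy1 \<sigma> s"
  have 0: "(\<Sum>y\<in>P. nu \<sigma> s y * ?g y) = 0"
    by (simp add: distrib_left sum.distrib sum_nu[OF s] flip: sum_distrib_right) (simp add: entropy1_def)
  have g: "ln (mu \<sigma> k s x) + real k * entropy1 \<sigma> s = (\<Sum>i<k. ?g (x i))" for x
    by (simp add: ln_mu[OF assms(1)] sum.distrib)
  have "r\<^sup>2 * (\<Sum>x\<in>{x \<in> cube k. r \<le> \<bar>ln (mu \<sigma> k s x) + real k * entropy1 \<sigma> s\<bar>}. mu \<sigma> k s x)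
      \<le> (\<Sum>x\<in>{x \<in> cube k. r \<le> \<bar>ln (mu \<sigma> k s x) + real k * entropy1 \<sigma> s\<bar>}. mu \<sigma> k s x * (\<Sum>i<k. ?g (x i))\<^sup>2)"
    unfolding sum_distrib_left
  proof (intro sum_mono)
    fix x assume "x \<in> {x \<in> cube k. r \<le> \<bar>ln (mu \<sigma> k s x) + real k * entropy1 \<sigma> s\<bar>}"
    then have "r\<^sup>2 \<le> \<bar>\<Sum>i<k. ?g (x i)\<bar>\<^sup>2"
      using assms(2) unfolding g by (intro power_mono) auto
    then show "r\<^sup>2 * mu \<sigma> k s x \<le> mu \<sigma> k s x * (\<Sum>i<k. ?g (x i))\<^sup>2"
      by (subst mult.commute) (intro mult_left_mono mu_nonneg, simp)
  qed
  also have "\<dots> \<le> (\<Sum>x\<in>cube k. mu \<sigma> k s x * (\<Sum>i<k. ?g (x i))\<^sup>2)"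
    by (intro sum_mono2) (auto simp: mu_nonneg)
  also have "\<dots> = real k * varentropy1 \<sigma> s"
    unfolding sum_mu_variance[OF s 0] varentropy1_def ..
  finally show ?thesis using assms(2) by (simp add: field_simps)
qed

lemma sum_mu_sq:
  assumes "0 \<le> s"
  shows "(\<Sum>x\<in>cube k. (mu \<sigma> k s x)\<^sup>2) = (1 + chisq s) ^ k / real p ^ k"
proof -
  have "(\<Sum>x\<in>cube k. (mu \<sigma> k s x)\<^sup>2) = (\<Prod>i<k. \<Sum>y\<in>P. nu \<sigma> s y * nu \<sigma> s y)"
    using sum_mu_prod[of \<sigma> k s "\<lambda>_. nu \<sigma> s"] by (simp add: power2_eq_square mu_def)
  also have "(\<Sum>y\<in>P. nu \<sigma> s y * nu \<sigma> s y) = (1 + chisq s) / real p"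
    using chisq_eq[OF assms, of \<sigma>] p_ge_2 by (simp add: power2_eq_square field_simps)
  finally show ?thesis by (simp add: power_divide)
qed

lemma shannon_entropy_coordinate_walk:
  assumes "0 < k" "0 < t"
  shows "shannon_entropy (coordinate_walk \<sigma> p k t) = real k * entropy1 \<sigma> (t / k)"
proof -
  define s where "s = t / k"
  have s: "0 < s" using assms by (simp add: s_def)
  have pmf: "pmf (coordinate_walk \<sigma> p k t) x = mu \<sigma> k s x" if "x \<in> cube k" for x
    using pmf_coordinate_walk[of k t x \<sigma>] that assms by (simp add: mu_def s_def)
  have "measure_pmf.expectation (coordinate_walk \<sigma> p k t) (\<lambda>x. ln (pmf (coordinate_walk \<sigma> p k t) x))
      = (\<Sum>x\<in>cube k. ln (pmf (coordinate_walk \<sigma> p k t) x) * pmf (coordinate_walk \<sigma> p k t) x)"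
    using set_coordinate_walk[OF assms(1)] by (intro integral_measure_pmf_real) auto
  also have "\<dots> = (\<Sum>x\<in>cube k. \<Sum>i<k. mu \<sigma> k s x * ln (nu \<sigma> s (x i)))"
    by (intro sum.cong refl) (simp add: pmf ln_mu[OF s] sum_distrib_left mult.commute)
  also have "\<dots> = (\<Sum>i<k. \<Sum>x\<in>cube k. mu \<sigma> k s x * ln (nu \<sigma> s (x i)))"
    by (rule sum.swap)
  also have "\<dots> = - real k * entropy1 \<sigma> s"
    using s by (simp add: sum_mu_coordinate[where g = "\<lambda>y. ln (nu \<sigma> s y)"] entropy1_def)
  finally show ?thesis by (simp add: shannon_entropy_eq s_def)
qed

lemma shannon_entropy_coordinate_walk_0: "shannon_entropy (coordinate_walk \<sigma> p k 0) = 0"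
  by (simp add: shannon_entropy_eq coordinate_walk_def walk_law_def jump_count_def bind_return_pmf)

text \<open>Resolves the definite description: d < k places the entropy per coordinate strictly
  between 0 and ln p, where \<open>entropy1\<close> takes every value exactly once.\<close>

lemma entropic_time_props:
  fixes \<sigma> :: orientation
  assumes "0 < d" "d < k"
  defines "s0 \<equiv> entropic_time \<sigma> k p d / k"
  shows "0 < s0" "real k * entropy1 \<sigma> s0 = ln (real (p ^ d))"
proof -
  define T where "T = real d * ln (real p) / real k"
  have lnp: "0 < ln (real p)" using p_ge_2 by simp
  have "0 < T" "T < ln (real p)" using assms lnp by (auto simp: T_def field_simps)
  from entropy1_ex1[OF this, of \<sigma>] obtain s where s: "0 < s" "entropy1 \<sigma> s = T" "\<And>s'. 0 < s' \<Longrightarrow> entropy1 \<sigma> s' = T \<Longrightarrow> s' = s"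
    by metis
  have T: "real k * T = ln (real (p ^ d))" using assms by (simp add: T_def ln_realpow)
  have "0 < ln (real (p ^ d))" using mult_pos_pos[of "real k" T] \<open>0 < T\<close> assms(1,2) unfolding T by simp
  have "entropic_time \<sigma> k p d = real k * s"
    unfolding entropic_time_def
  proof (rule the_equality)
    show "0 \<le> real k * s \<and> shannon_entropy (coordinate_walk \<sigma> p k (real k * s)) = ln (real (p ^ d))"
    proof
      have "real k * s / real k = s" using assms(2) by simp
      moreover have "shannon_entropy (coordinate_walk \<sigma> p k (real k * s)) = real k * entropy1 \<sigma> (real k * s / real k)"
        using s(1) assms(2) by (intro shannon_entropy_coordinate_walk) auto
      ultimately show "shannon_entropy (coordinate_walk \<sigma> p k (real k * s)) = ln (real (p ^ d))"
        by (simp only: s(2) T)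
    qed (use s(1) in simp)
    fix t assume t: "0 \<le> t \<and> shannon_entropy (coordinate_walk \<sigma> p k t) = ln (real (p ^ d))"
    \<comment> \<open>Time 0 needs separate exclusion: the formula by \<open>entropy1\<close> is
      available for positive times only, but the entropy at 0 is 0.\<close>
    then have "t \<noteq> 0" using \<open>0 < ln (real (p ^ d))\<close> shannon_entropy_coordinate_walk_0[of \<sigma> k] by auto
    then have "0 < t" using t by simp
    then have "real k * entropy1 \<sigma> (t / k) = real k * T"
      using t assms(2) unfolding T by (simp add: shannon_entropy_coordinate_walk)
    then have "entropy1 \<sigma> (t / k) = T" using assms(2) by simp
    then have "t / k = s" using assms(2) \<open>0 < t\<close> by (intro s(3)) auto
    then show "t = real k * s" using assms(2) by (auto simp: field_simps)
  qed
  then have "s0 = s" unfolding s0_def using assms(1,2) by simp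
  then show "0 < s0" "real k * entropy1 \<sigma> s0 = ln (real (p ^ d))" by (simp_all only: s(1,2) T)
qed

text \<open>Cauchy-Schwarz against the chi-square distance; for a product law the latter is (1 +
  \<open>chisq\<close>)^k - 1.\<close>

lemma tv_coordinate_walk_le:
  assumes "0 < k" "0 < t"
  shows "tv_dist (coordinate_walk \<sigma> p k t) (pmf_of_set (cube k)) \<le> sqrt (exp (real k * chisq (t / k)) - 1)"
proof -
  define s where "s = t / k"
  have s: "0 \<le> s" using assms by (simp add: s_def)
  have ne: "cube k \<noteq> {}" using one_in_cube by auto
  define u where "u = 1 / real p ^ k"
  have pk: "0 < real p ^ k" using p_ge_2 by simp
  have pmf: "pmf (coordinate_walk \<sigma> p k t) x = mu \<sigma> k s x" if "x \<in> cube k" for x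
    using pmf_coordinate_walk[of k t x \<sigma>] that assms by (simp add: mu_def s_def)
  have "tv_dist (coordinate_walk \<sigma> p k t) (pmf_of_set (cube k))
      \<le> (\<Sum>x\<in>cube k. \<bar>pmf (coordinate_walk \<sigma> p k t) x - pmf (pmf_of_set (cube k)) x\<bar>)"
    using set_coordinate_walk[OF assms(1)] ne by (intro tv_dist_le_l1) auto
  also have "\<dots> = (\<Sum>x\<in>cube k. \<bar>mu \<sigma> k s x - u\<bar> * 1)"
    using ne by (intro sum.cong refl) (simp add: pmf u_def card_cube)
  also have "\<dots> \<le> sqrt (\<Sum>x\<in>cube k. \<bar>mu \<sigma> k s x - u\<bar>\<^sup>2) * sqrt (\<Sum>x\<in>cube k. 1\<^sup>2)"
    unfolding real_sqrt_mult[symmetric] by (intro real_le_rsqrt Cauchy_Schwarz_ineq_sum)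
  also have "(\<Sum>x\<in>cube k. \<bar>mu \<sigma> k s x - u\<bar>\<^sup>2)
      = (\<Sum>x\<in>cube k. (mu \<sigma> k s x)\<^sup>2 - 2 * u * mu \<sigma> k s x + u\<^sup>2)"
    by (intro sum.cong refl) (simp add: power2_diff mult_ac)
  also have "\<dots> = (1 + chisq s) ^ k / real p ^ k - u"
    using pk by (simp add: sum.distrib sum_subtractf sum_mu_sq[OF s] sum_mu[OF s] card_cube flip: sum_distrib_left)
       (simp add: u_def power2_eq_square)
  also have "sqrt \<dots> * sqrt (\<Sum>x\<in>cube k. 1\<^sup>2) = sqrt ((1 + chisq s) ^ k - 1)"
    using pk by (simp add: real_sqrt_mult[symmetric] card_cube u_def left_diff_distrib)
  also have "\<dots> \<le> sqrt (exp (real k * chisq s) - 1)"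
  proof -
    have "(1 + chisq s) ^ k \<le> exp (chisq s) ^ k"
      using chisq_nonneg[of s] exp_ge_add_one_self[of "chisq s"] by (intro power_mono) auto
    then show ?thesis by (simp add: exp_of_nat_mult)
  qed
  finally show ?thesis by (simp add: s_def)
qed

end

section \<open>The linear map attached to the generators\<close>

text \<open>A kernel intertwined with another by f on an invariant set is run by projecting the
  other chain.\<close>

lemma jump_chain_map:
  assumes "x \<in> S" "\<And>y. y \<in> S \<Longrightarrow> set_pmf (K y) \<subseteq> S" "\<And>y. y \<in> S \<Longrightarrow> K' (f y) = map_pmf f (K y)"
  shows "jump_chain K' (f x) n = map_pmf f (jump_chain K x n)"
proof (induction n)
  case (Suc n)
  have sub: "set_pmf (jump_chain K x n) \<subseteq> S" by (rule jump_chain_closed[OF assms(1)]) (rule assms(2))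
  have "bind_pmf (jump_chain K x n) (\<lambda>y. K' (f y)) = bind_pmf (jump_chain K x n) (\<lambda>y. map_pmf f (K y))"
    by (rule bind_pmf_cong) (use sub assms(3) in auto)
  then show ?case by (simp add: Suc bind_map_pmf map_bind_pmf)
qed simp

lemma walk_law_map:
  assumes "x \<in> S" "\<And>y. y \<in> S \<Longrightarrow> set_pmf (K y) \<subseteq> S" "\<And>y. y \<in> S \<Longrightarrow> K' (f y) = map_pmf f (K y)"
  shows "walk_law K' (f x) t = map_pmf f (walk_law K x t)"
proof -
  have "jump_chain K' (f x) = (\<lambda>n. map_pmf f (jump_chain K x n))"
    by (rule ext) (rule jump_chain_map[where S = S and K = K and f = f], use assms in auto)
  then show ?thesis by (simp add: walk_law_def map_bind_pmf)
qed

context cycle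
begin

text \<open>The matrix with columns \<open>Z i\<close> applied to x. The argument may be any integer
  vector, so additivity holds literally; reduction mod p is handled by
  \<open>lin_cong\<close>.\<close>

definition lin :: "nat \<Rightarrow> nat \<Rightarrow> (nat \<Rightarrow> nat \<Rightarrow> int) \<Rightarrow> (nat \<Rightarrow> int) \<Rightarrow> nat \<Rightarrow> int" where
  "lin d k Z x = (\<lambda>j\<in>{..<d}. (\<Sum>i<k. x i * Z i j) mod int p)"

lemma mem_cubeI: "(\<lambda>j\<in>{..<d}. f j mod int p) \<in> cube d"
  using p_ge_2 by (auto simp: cube_def)

lemma lin_in_cube: "lin d k Z x \<in> cube d"
  unfolding lin_def by (rule mem_cubeI)

lemma cubeD: "x \<in> cube k \<Longrightarrow> i < k \<Longrightarrow> x i \<in> P"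
  by (auto simp: cube_def PiE_def Pi_def)

lemma group_Zpow: "group (Zpow p d)"
  by (simp add: Zpow_def)

lemma mult_Zpow: "x \<otimes>\<^bsub>Zpow p d\<^esub> y = (\<lambda>j\<in>{..<d}. (x j + y j) mod int p)"
  by (simp add: Zpow_def)

lemma inv_Zpow: "x \<in> cube d \<Longrightarrow> inv\<^bsub>Zpow p d\<^esub> x = (\<lambda>j\<in>{..<d}. (- x j) mod int p)"
proof -
  assume x: "x \<in> cube d"
  then have "x \<in> (\<Pi>\<^sub>E i\<in>{..<d}. carrier (integer_mod_group p))"
    by (simp add: carrier_Zpow[symmetric] Zpow_def)
  then have "inv\<^bsub>Zpow p d\<^esub> x = (\<lambda>i\<in>{..<d}. inv\<^bsub>integer_mod_group p\<^esub> x i)"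
    unfolding Zpow_def by (intro inv_product_group) auto
  also have "\<dots> = (\<lambda>j\<in>{..<d}. (- x j) mod int p)"
  proof (rule restrict_ext)
    fix j assume "j \<in> {..<d}"
    then have "x j \<in> carrier (integer_mod_group p)"
      using cubeD[OF x, of j] by (auto simp: carrier_integer_mod_group)
    then show "inv\<^bsub>integer_mod_group p\<^esub> x j = (- x j) mod int p" by (rule inv_integer_mod_group)
  qed
  finally show ?thesis .
qed

lemma lin_add: "lin d k Z (\<lambda>i. x i + y i) = lin d k Z x \<otimes>\<^bsub>Zpow p d\<^esub> lin d k Z y"
  unfolding mult_Zpow lin_def
  by (rule restrict_ext) (simp add: distrib_right sum.distrib mod_add_eq)

lemma lin_uminus: "lin d k Z (\<lambda>i. - x i) = inv\<^bsub>Zpow p d\<^esub> (lin d k Z x)"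
  unfolding inv_Zpow[OF lin_in_cube] unfolding lin_def
  by (rule restrict_ext) (simp add: sum_negf mod_minus_eq)

lemma lin_zero: "lin d k Z (\<lambda>i. 0) = \<one>\<^bsub>Zpow p d\<^esub>"
  by (simp add: lin_def one_Zpow)

lemma lin_cong:
  assumes "\<And>i. i < k \<Longrightarrow> x i mod int p = y i mod int p"
  shows "lin d k Z x = lin d k Z y"
proof -
  have "(\<Sum>i<k. x i * Z i j) mod int p = (\<Sum>i<k. y i * Z i j) mod int p" for j
  proof -
    have "(\<Sum>i<k. x i * Z i j) mod int p = (\<Sum>i<k. (x i * Z i j) mod int p) mod int p"
      by (rule mod_sum_eq[symmetric])
    also have "(\<Sum>i<k. (x i * Z i j) mod int p) = (\<Sum>i<k. (y i * Z i j) mod int p)"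
      by (rule sum.cong[OF refl]) (rule mod_mult_cong[OF assms refl], simp)
    also have "(\<Sum>i<k. (y i * Z i j) mod int p) mod int p = (\<Sum>i<k. y i * Z i j) mod int p"
      by (rule mod_sum_eq)
    finally show ?thesis .
  qed
  then show ?thesis by (simp add: lin_def)
qed

lemma lin_reduce: "lin d k Z x = lin d k Z (\<lambda>i\<in>{..<k}. x i mod int p)"
  by (rule lin_cong) simp

lemma lin_single:
  assumes "i < k" "Z i \<in> cube d"
  shows "lin d k Z (\<lambda>l. if l = i then 1 else 0) = Z i"
proof (rule ext)
  fix j
  have "(\<Sum>l<k. (if l = i then 1 else 0) * Z l j) = (\<Sum>l<k. if l = i then Z l j else 0)"
    by (intro sum.cong) auto
  then have "(\<Sum>l<k. (if l = i then 1 else 0) * Z l j) = Z i j" using assms(1) by simp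
  then show "lin d k Z (\<lambda>l. if l = i then 1 else 0) j = Z i j"
    using assms(2) cubeD[OF assms(2), of j] by (auto simp: lin_def cube_def PiE_def extensional_def)
qed

lemma lin_update:
  assumes "i < k" "Z i \<in> cube d"
  shows "lin d k Z (x(i := (x i + 1) mod int p)) = lin d k Z x \<otimes>\<^bsub>Zpow p d\<^esub> Z i"
    and "lin d k Z (x(i := (x i - 1) mod int p)) = lin d k Z x \<otimes>\<^bsub>Zpow p d\<^esub> inv\<^bsub>Zpow p d\<^esub> (Z i)"
proof -
  have "lin d k Z (x(i := (x i + 1) mod int p)) = lin d k Z (\<lambda>l. x l + (if l = i then 1 else 0))"
    by (rule lin_cong) auto
  then show "lin d k Z (x(i := (x i + 1) mod int p)) = lin d k Z x \<otimes>\<^bsub>Zpow p d\<^esub> Z i"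
    by (simp only: lin_add lin_single[where Z = Z, OF assms])
  have "lin d k Z (x(i := (x i - 1) mod int p)) = lin d k Z (\<lambda>l. x l + - (if l = i then 1 else 0))"
    by (rule lin_cong) auto
  then show "lin d k Z (x(i := (x i - 1) mod int p)) = lin d k Z x \<otimes>\<^bsub>Zpow p d\<^esub> inv\<^bsub>Zpow p d\<^esub> (Z i)"
    by (simp only: lin_add lin_uminus lin_single[where Z = Z, OF assms])
qed

text \<open>Choosing generator i corresponds to a jump in coordinate i. As the group is Abelian, the
  position depends only on the net number of uses of each generator, taken mod p.\<close>

lemma cayley_walk_eq_map:
  assumes "0 < k" "\<And>i. i < k \<Longrightarrow> Z i \<in> cube d"
  shows "cayley_walk \<sigma> (Zpow p d) k Z t = map_pmf (lin d k Z) (coordinate_walk \<sigma> p k t)"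
proof -
  have ne: "{..<k} \<noteq> {}" using assms(1) by auto
  have one: "lin d k Z \<one>\<^bsub>Zpow p k\<^esub> = \<one>\<^bsub>Zpow p d\<^esub>"
    unfolding lin_zero[of d k Z, symmetric] by (rule lin_cong) (simp add: one_Zpow)
  have "walk_law (cayley_step \<sigma> (Zpow p d) k Z) (lin d k Z \<one>\<^bsub>Zpow p k\<^esub>) t
      = map_pmf (lin d k Z) (walk_law (coordinate_step \<sigma> p k) \<one>\<^bsub>Zpow p k\<^esub> t)"
  proof (rule walk_law_map[where S = "cube k"])
    fix x
    show "cayley_step \<sigma> (Zpow p d) k Z (lin d k Z x) = map_pmf (lin d k Z) (coordinate_step \<sigma> p k x)"
      unfolding cayley_step_def coordinate_step_def map_bind_pmf
    proof (rule bind_pmf_cong[OF refl])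
      fix i assume "i \<in> set_pmf (pmf_of_set {..<k})"
      then have i: "i < k" using ne by simp
      note up = lin_update[where Z = Z and d = d and x = x, OF i assms(2)[OF i]]
      show "(case \<sigma> of
              Directed \<Rightarrow> return_pmf (lin d k Z x \<otimes>\<^bsub>Zpow p d\<^esub> Z i)
            | Undirected \<Rightarrow> bernoulli_pmf (1 / 2) \<bind>
                (\<lambda>b. return_pmf (lin d k Z x \<otimes>\<^bsub>Zpow p d\<^esub> (if b then Z i else inv\<^bsub>Zpow p d\<^esub> (Z i)))))
          = map_pmf (lin d k Z) (case \<sigma> of
              Directed \<Rightarrow> return_pmf (x(i := (x i + 1) mod int p))
            | Undirected \<Rightarrow> bernoulli_pmf (1 / 2) \<bind>
                (\<lambda>b. return_pmf (x(i := (x i + (if b then 1 else - 1)) mod int p))))"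
      proof (cases \<sigma>)
        case Undirected
        then show ?thesis
          by (simp add: map_bind_pmf) (intro bind_pmf_cong refl, simp add: up)
      qed (simp add: up)
    qed
  qed (use one_in_cube coordinate_step_closed[OF assms(1)] in auto)
  then show ?thesis by (simp add: cayley_walk_def coordinate_walk_def one)
qed

definition lin_image :: "nat \<Rightarrow> nat \<Rightarrow> (nat \<Rightarrow> nat \<Rightarrow> int) \<Rightarrow> (nat \<Rightarrow> int) set" where
  "lin_image d k Z = lin d k Z ` cube k"

lemma lin_image_eq_range: "lin_image d k Z = range (lin d k Z)"
  unfolding lin_image_def using lin_reduce mem_cubeI by blast

lemma subgroup_lin_image: "subgroup (lin_image d k Z) (Zpow p d)"
proof
  show "lin_image d k Z \<subseteq> carrier (Zpow p d)"
    using lin_in_cube by (auto simp: lin_image_def carrier_Zpow)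
  show "\<one>\<^bsub>Zpow p d\<^esub> \<in> lin_image d k Z"
    unfolding lin_image_eq_range by (metis lin_zero rangeI)
  show "x \<otimes>\<^bsub>Zpow p d\<^esub> y \<in> lin_image d k Z" if "x \<in> lin_image d k Z" "y \<in> lin_image d k Z" for x y
    using that unfolding lin_image_eq_range by (auto simp flip: lin_add)
  show "inv\<^bsub>Zpow p d\<^esub> x \<in> lin_image d k Z" if "x \<in> lin_image d k Z" for x
    using that unfolding lin_image_eq_range by (auto simp flip: lin_uminus)
qed

lemma lin_image_eq_generate:
  assumes Z: "\<And>i. i < k \<Longrightarrow> Z i \<in> cube d"
  shows "generate (Zpow p d) (Z ` {..<k}) = lin_image d k Z"
proof
  interpret G: group "Zpow p d" by (rule group_Zpow)
  have "Z ` {..<k} \<subseteq> lin_image d k Z"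
  proof
    fix g assume "g \<in> Z ` {..<k}"
    then obtain i where "i < k" "g = Z i" by auto
    then have "g = lin d k Z (\<lambda>l. if l = i then 1 else 0)" using Z by (simp add: lin_single)
    then show "g \<in> lin_image d k Z" unfolding lin_image_eq_range by blast
  qed
  then show "generate (Zpow p d) (Z ` {..<k}) \<subseteq> lin_image d k Z"
    by (rule G.generate_subgroup_incl[OF _ subgroup_lin_image])
  let ?S = "generate (Zpow p d) (Z ` {..<k})"
  have S: "subgroup ?S (Zpow p d)"
    using Z by (intro G.generate_is_subgroup) (auto simp: carrier_Zpow)
  \<comment> \<open>Coefficients in the cube are nonnegative, so repeated addition of a generator
    suffices and inverses do not occur.\<close>
  have add: "(\<lambda>j\<in>{..<d}. (f j + int n * Z i j) mod int p) \<in> ?S"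
    if i: "i < k" and f: "(\<lambda>j\<in>{..<d}. f j mod int p) \<in> ?S" for f i n
  proof (induction n)
    case 0
    show ?case using f by (simp only: of_nat_0 mult_zero_left add_0_right)
  next
    case (Suc n)
    have "Z i \<in> ?S" using i by (auto intro: generate.incl)
    from subgroup.m_closed[OF S Suc this]
    have "(\<lambda>j\<in>{..<d}. ((\<lambda>j\<in>{..<d}. (f j + int n * Z i j) mod int p) j + Z i j) mod int p) \<in> ?S"
      by (simp only: mult_Zpow)
    also have "(\<lambda>j\<in>{..<d}. ((\<lambda>j\<in>{..<d}. (f j + int n * Z i j) mod int p) j + Z i j) mod int p)
        = (\<lambda>j\<in>{..<d}. (f j + int (Suc n) * Z i j) mod int p)"
      by (intro restrict_ext) (simp add: mod_simps algebra_simps)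
    finally show ?case .
  qed
  show "lin_image d k Z \<subseteq> ?S"
  proof
    fix g assume "g \<in> lin_image d k Z"
    then obtain x where x: "x \<in> cube k" "g = lin d k Z x" by (auto simp: lin_image_def)
    have "(\<lambda>j\<in>{..<d}. (\<Sum>i<m. x i * Z i j) mod int p) \<in> ?S" if "m \<le> k" for m
      using that
    proof (induction m)
      case 0
      have "\<one>\<^bsub>Zpow p d\<^esub> \<in> ?S" by (rule subgroup.one_closed[OF S])
      then show ?case by (simp only: one_Zpow lessThan_0 sum.empty mod_0)
    next
      case (Suc m)
      have xm: "int (nat (x m)) = x m" using cubeD[OF x(1), of m] Suc.prems by simp
      have "m < k" "m \<le> k" using Suc.prems by auto
      from add[OF this(1) Suc.IH[OF this(2)], of "nat (x m)"] show ?case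
        unfolding xm sum.lessThan_Suc .
    qed
    then show "g \<in> ?S" using x(2) by (simp add: lin_def)
  qed
qed

text \<open>Lagrange's theorem: a proper subgroup has index at least 2.\<close>

lemma card_lin_image_le:
  assumes "lin_image d k Z \<noteq> cube d"
  shows "2 * card (lin_image d k Z) \<le> p ^ d"
proof -
  interpret G: group "Zpow p d" by (rule group_Zpow)
  have sub: "lin_image d k Z \<subseteq> cube d" using lin_in_cube by (auto simp: lin_image_def)
  have lt: "card (lin_image d k Z) < p ^ d"
    using psubset_card_mono[of "cube d" "lin_image d k Z"] sub assms by (auto simp: card_cube)
  have "card (rcosets\<^bsub>Zpow p d\<^esub> (lin_image d k Z)) * card (lin_image d k Z) = p ^ d"
    using G.lagrange[OF subgroup_lin_image] by (simp add: order_def carrier_Zpow card_cube)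
  moreover have "2 \<le> m" if "m * c = n" "c < n" for m c n :: nat
  proof (rule ccontr)
    assume "\<not> 2 \<le> m"
    then have "m = 0 \<or> m = 1" by linarith
    then show False using that by auto
  qed
  ultimately show ?thesis using lt by (metis mult_le_mono1)
qed

text \<open>All fibres over the image are translates of the kernel, hence equally large.\<close>

lemma map_lin_uniform:
  assumes "lin_image d k Z = cube d"
  shows "map_pmf (lin d k Z) (pmf_of_set (cube k)) = pmf_of_set (cube d)"
proof -
  have ne: "cube n \<noteq> {}" for n using one_in_cube by auto
  define fib where "fib g = {x \<in> cube k. lin d k Z x = g}" for g
  interpret G: group "Zpow p d" by (rule group_Zpow)
  have card_fib: "card (fib g) = card (fib \<one>\<^bsub>Zpow p d\<^esub>)" if "g \<in> cube d" for g
  proof -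
    have "g \<in> lin_image d k Z" using that assms by simp
    then obtain w where w: "w \<in> cube k" "g = lin d k Z w" unfolding lin_image_def by blast
    have carr: "lin d k Z y \<in> carrier (Zpow p d)" for y by (simp add: carrier_Zpow lin_in_cube)
    have eq: "(\<lambda>i\<in>{..<k}. ((\<lambda>i\<in>{..<k}. (x i + u i) mod int p) i - u i) mod int p) = x" if "x \<in> cube k" for x u
    proof (rule ext)
      fix i
      show "(\<lambda>i\<in>{..<k}. ((\<lambda>i\<in>{..<k}. (x i + u i) mod int p) i - u i) mod int p) i = x i"
        using that cubeD[OF that, of i] by (auto simp: cube_def PiE_def extensional_def mod_simps)
    qed
    \<comment> \<open>Translation by a preimage w of g, reduced mod p to stay in the cube.\<close>
    have "bij_betw (\<lambda>x. \<lambda>i\<in>{..<k}. (x i + - w i) mod int p) (fib g) (fib \<one>\<^bsub>Zpow p d\<^esub>)"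
    proof (rule bij_betw_byWitness[where f' = "\<lambda>x. \<lambda>i\<in>{..<k}. (x i + w i) mod int p"])
      show "\<forall>x\<in>fib g. (\<lambda>i\<in>{..<k}. ((\<lambda>i\<in>{..<k}. (x i + - w i) mod int p) i + w i) mod int p) = x"
        using eq[of _ "\<lambda>i. - w i"] by (simp add: fib_def)
      show "\<forall>x\<in>fib \<one>\<^bsub>Zpow p d\<^esub>. (\<lambda>i\<in>{..<k}. ((\<lambda>i\<in>{..<k}. (x i + w i) mod int p) i + - w i) mod int p) = x"
        using eq[of _ w] by (simp add: fib_def)
      show "(\<lambda>x. \<lambda>i\<in>{..<k}. (x i + - w i) mod int p) ` fib g \<subseteq> fib \<one>\<^bsub>Zpow p d\<^esub>"
      proof
        fix y assume "y \<in> (\<lambda>x. \<lambda>i\<in>{..<k}. (x i + - w i) mod int p) ` fib g"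
        then obtain x where x: "x \<in> fib g" "y = (\<lambda>i\<in>{..<k}. (x i + - w i) mod int p)" by blast
        have "lin d k Z y = lin d k Z (\<lambda>i. x i + - w i)" unfolding x(2) by (rule lin_reduce[symmetric])
        also have "\<dots> = \<one>\<^bsub>Zpow p d\<^esub>"
          unfolding lin_add lin_uminus using x(1) w(2) carr by (simp add: fib_def)
        finally show "y \<in> fib \<one>\<^bsub>Zpow p d\<^esub>" by (simp add: fib_def x(2) mem_cubeI)
      qed
      show "(\<lambda>x. \<lambda>i\<in>{..<k}. (x i + w i) mod int p) ` fib \<one>\<^bsub>Zpow p d\<^esub> \<subseteq> fib g"
      proof
        fix y assume "y \<in> (\<lambda>x. \<lambda>i\<in>{..<k}. (x i + w i) mod int p) ` fib \<one>\<^bsub>Zpow p d\<^esub>"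
        then obtain x where x: "x \<in> fib \<one>\<^bsub>Zpow p d\<^esub>" "y = (\<lambda>i\<in>{..<k}. (x i + w i) mod int p)" by blast
        have "lin d k Z y = lin d k Z (\<lambda>i. x i + w i)" unfolding x(2) by (rule lin_reduce[symmetric])
        also have "\<dots> = g"
          unfolding lin_add using x(1) w(2) carr by (simp add: fib_def)
        finally show "y \<in> fib g" by (simp add: fib_def x(2) mem_cubeI)
      qed
    qed
    then show ?thesis by (rule bij_betw_same_card)
  qed
  have "cube k = (\<Union>g\<in>cube d. fib g)" using lin_in_cube by (auto simp: fib_def)
  then have "p ^ k = card (\<Union>g\<in>cube d. fib g)" by (simp flip: card_cube)
  also have "\<dots> = (\<Sum>g\<in>cube d. card (fib g))"
    by (intro card_UN_disjoint) (auto simp: fib_def)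
  also have "\<dots> = p ^ d * card (fib \<one>\<^bsub>Zpow p d\<^esub>)" by (simp add: card_fib card_cube)
  finally have pk: "p ^ k = p ^ d * card (fib \<one>\<^bsub>Zpow p d\<^esub>)" .
  show ?thesis
  proof (rule pmf_eqI)
    fix g
    have "cube k \<inter> lin d k Z -` {g} = fib g" by (auto simp: fib_def)
    then have "pmf (map_pmf (lin d k Z) (pmf_of_set (cube k))) g = real (card (fib g)) / real (p ^ k)"
      using ne by (simp add: pmf_map measure_pmf_of_set card_cube)
    also have "\<dots> = pmf (pmf_of_set (cube d)) g"
    proof (cases "g \<in> cube d")
      case True
      have "0 < card (fib \<one>\<^bsub>Zpow p d\<^esub>)" using pk p_ge_2 by (metis gr0I mult_0_right not_numeral_le_zero power_eq_0_iff)
      then show ?thesis using ne True by (simp add: card_fib pk card_cube)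
    next
      case False
      then have "fib g = {}" using lin_in_cube by (auto simp: fib_def)
      then show ?thesis using ne False by simp
    qed
    finally show "pmf (map_pmf (lin d k Z) (pmf_of_set (cube k))) g = pmf (pmf_of_set (cube d)) g" .
  qed
qed

end

section \<open>Second moments over random generators\<close>

context cycle
begin

abbreviation Zlaw :: "nat \<Rightarrow> nat \<Rightarrow> (nat \<Rightarrow> nat \<Rightarrow> int) pmf" where
  "Zlaw d k \<equiv> iid_uniform (Zpow p d) k"

lemma cube_nonempty: "cube d \<noteq> {}"
  using one_in_cube by auto

lemma Zlaw_eq: "Zlaw d k = pmf_of_set (PiE_dflt {..<k} undefined (\<lambda>_. cube d))"
  unfolding iid_uniform_def carrier_Zpow by (rule Pi_pmf_of_set) (auto simp: cube_nonempty)

lemma set_Zlaw: "set_pmf (Zlaw d k) = PiE_dflt {..<k} undefined (\<lambda>_. cube d)"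
  unfolding Zlaw_eq by (rule set_pmf_of_set) (auto simp: cube_nonempty)

lemma finite_set_Zlaw: "finite (set_pmf (Zlaw d k))"
  unfolding set_Zlaw by (rule finite_PiE_dflt) auto

lemma set_ZlawD: "Z \<in> set_pmf (Zlaw d k) \<Longrightarrow> i < k \<Longrightarrow> Z i \<in> cube d"
  unfolding set_Zlaw by (auto simp: PiE_dflt_def)

lemma sum_Zlaw: "(\<Sum>Z\<in>set_pmf (Zlaw d k). pmf (Zlaw d k) Z) = 1"
  by (rule sum_pmf_eq_1[OF finite_set_Zlaw]) simp

lemma lin_eq_iff: "lin d k Z x = lin d k Z y \<longleftrightarrow> (\<forall>j<d. int p dvd (\<Sum>l<k. (x l - y l) * Z l j))"
proof -
  have "lin d k Z x = lin d k Z y \<longleftrightarrow> (\<forall>j<d. (\<Sum>i<k. x i * Z i j) mod int p = (\<Sum>i<k. y i * Z i j) mod int p)"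
    by (auto simp: lin_def restrict_def fun_eq_iff)
  then show ?thesis by (simp add: mod_eq_dvd_iff left_diff_distrib sum_subtractf)
qed

text \<open>At a coordinate i where x and y differ, fix all generators but \<open>Z i\<close>: at
  most one of the p^d values of \<open>Z i\<close> produces a collision. Primality makes x_i - y_i
  invertible.\<close>

lemma collision_prob_le:
  assumes "prime p" "x \<in> cube k" "y \<in> cube k" "x \<noteq> y"
  shows "measure_pmf.prob (Zlaw d k) {Z. lin d k Z x = lin d k Z y} \<le> 1 / real p ^ d"
proof -
  obtain i where i: "i < k" "x i \<noteq> y i"
    using assms(2-4) unfolding cube_def by (metis PiE_ext lessThan_iff)
  let ?E = "{Z. lin d k Z x = lin d k Z y}"
  let ?U = "pmf_of_set (cube d)" and ?A = "{..<k} - {i}"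
  \<comment> \<open>Generator i is drawn last, the others being fixed as \<open>f\<close>.\<close>
  have "{..<k} = insert i ?A" using i by auto
  then have "Zlaw d k = Pi_pmf (insert i ?A) undefined (\<lambda>_. ?U)"
    by (simp add: iid_uniform_def carrier_Zpow)
  also have "\<dots> = map_pmf (\<lambda>(z, f). f(i := z)) (pair_pmf ?U (Pi_pmf ?A undefined (\<lambda>_. ?U)))"
    by (rule Pi_pmf_insert) auto
  also have "\<dots> = bind_pmf (Pi_pmf ?A undefined (\<lambda>_. ?U)) (\<lambda>f. map_pmf (\<lambda>z. f(i := z)) ?U)"
    unfolding pair_pmf_def map_bind_pmf by (subst bind_commute_pmf) (simp add: map_pmf_def bind_return_pmf)
  finally have Z: "Zlaw d k = bind_pmf (Pi_pmf ?A undefined (\<lambda>_. ?U)) (\<lambda>f. map_pmf (\<lambda>z. f(i := z)) ?U)" .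
  have one: "emeasure (map_pmf (\<lambda>z. f(i := z)) ?U) ?E \<le> ennreal (1 / real p ^ d)" for f
  proof -
    let ?C = "cube d \<inter> (\<lambda>z. f(i := z)) -` ?E"
    have "card ?C \<le> Suc 0"
    proof (subst card_le_Suc0_iff_eq)
      show "\<forall>z\<in>?C. \<forall>z'\<in>?C. z = z'"
      proof (intro ballI)
        fix z z' assume z: "z \<in> ?C" and z': "z' \<in> ?C"
        show "z = z'"
        proof (rule PiE_ext)
          show "z \<in> PiE {..<d} (\<lambda>_. P)" "z' \<in> PiE {..<d} (\<lambda>_. P)"
            using z z' by (auto simp: cube_def)
          fix j assume j: "j \<in> {..<d}"
          have split: "(\<Sum>l<k. (x l - y l) * (f(i := u)) l j)
              = (x i - y i) * u j + (\<Sum>l\<in>?A. (x l - y l) * f l j)" for u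
            using i(1) by (subst sum.remove[of _ i]) (auto intro!: sum.cong)
          have "int p dvd (x i - y i) * z j + (\<Sum>l\<in>?A. (x l - y l) * f l j)"
               "int p dvd (x i - y i) * z' j + (\<Sum>l\<in>?A. (x l - y l) * f l j)"
            using z z' j by (auto simp: lin_eq_iff split[symmetric])
          then have "int p dvd ((x i - y i) * z j + (\<Sum>l\<in>?A. (x l - y l) * f l j))
              - ((x i - y i) * z' j + (\<Sum>l\<in>?A. (x l - y l) * f l j))"
            by (rule dvd_diff)
          then have "int p dvd (x i - y i) * (z j - z' j)" by (simp add: algebra_simps)
          moreover have "\<not> int p dvd x i - y i"
            using cubeD[OF assms(2) i(1)] cubeD[OF assms(3) i(1)] i(2) by (simp add: mod_eq_dvd_iff[symmetric])
          ultimately have "int p dvd z j - z' j"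
            using assms(1) by (simp add: prime_dvd_mult_iff)
          then show "z j = z' j"
            using cubeD[of z d j] cubeD[of z' d j] z z' j by (simp add: mod_eq_dvd_iff[symmetric])
        qed
      qed
    qed simp
    then have "real (card ?C) / real p ^ d \<le> 1 / real p ^ d"
      by (intro divide_right_mono) auto
    moreover have "measure_pmf.prob (map_pmf (\<lambda>z. f(i := z)) ?U) ?E = real (card ?C) / real p ^ d"
      by (simp only: measure_map_pmf) (simp add: measure_pmf_of_set cube_nonempty card_cube)
    ultimately show ?thesis by (simp add: measure_pmf.emeasure_eq_measure ennreal_leI)
  qed
  have "emeasure (Zlaw d k) ?E \<le> (\<integral>\<^sup>+f. ennreal (1 / real p ^ d) \<partial>(Pi_pmf ?A undefined (\<lambda>_. ?U)))"
    unfolding Z emeasure_bind_pmf by (intro nn_integral_mono one)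
  then have "ennreal (measure_pmf.prob (Zlaw d k) ?E) \<le> ennreal (1 / real p ^ d)"
    by (simp add: measure_pmf.emeasure_eq_measure)
  then show ?thesis by (simp add: ennreal_le_iff)
qed

definition push :: "nat \<Rightarrow> nat \<Rightarrow> ((nat \<Rightarrow> int) \<Rightarrow> real) \<Rightarrow> (nat \<Rightarrow> nat \<Rightarrow> int) \<Rightarrow> (nat \<Rightarrow> int) \<Rightarrow> real" where
  "push d k f Z g = (\<Sum>x\<in>cube k. if lin d k Z x = g then f x else 0)"

lemma sum_push_mult: "(\<Sum>g\<in>cube d. push d k f Z g * h g) = (\<Sum>x\<in>cube k. f x * h (lin d k Z x))"
proof -
  have "(\<Sum>g\<in>cube d. push d k f Z g * h g) = (\<Sum>g\<in>cube d. \<Sum>x\<in>cube k. if lin d k Z x = g then f x * h g else 0)"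
    unfolding push_def sum_distrib_right by (intro sum.cong refl) auto
  also have "\<dots> = (\<Sum>x\<in>cube k. \<Sum>g\<in>cube d. if lin d k Z x = g then f x * h g else 0)"
    by (rule sum.swap)
  also have "\<dots> = (\<Sum>x\<in>cube k. f x * h (lin d k Z x))"
    by (intro sum.cong refl) (simp add: lin_in_cube)
  finally show ?thesis .
qed

lemma sum_push: "(\<Sum>g\<in>cube d. push d k f Z g) = (\<Sum>x\<in>cube k. f x)"
  using sum_push_mult[of d k f Z "\<lambda>_. 1"] by simp

lemma push_nonneg: "(\<And>x. 0 \<le> f x) \<Longrightarrow> 0 \<le> push d k f Z g"
  by (simp add: push_def sum_nonneg)

lemma sum_push_sq:
  "(\<Sum>g\<in>cube d. (push d k f Z g)\<^sup>2) = (\<Sum>x\<in>cube k. \<Sum>y\<in>cube k. f x * f y * (if lin d k Z x = lin d k Z y then 1 else 0))"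
proof -
  have "(\<Sum>g\<in>cube d. (push d k f Z g)\<^sup>2) = (\<Sum>x\<in>cube k. f x * push d k f Z (lin d k Z x))"
    unfolding power2_eq_square by (rule sum_push_mult)
  also have "\<dots> = (\<Sum>x\<in>cube k. \<Sum>y\<in>cube k. f x * f y * (if lin d k Z x = lin d k Z y then 1 else 0))"
    unfolding push_def sum_distrib_left by (intro sum.cong refl) auto
  finally show ?thesis .
qed

text \<open>The squared l2 norm of the image counts colliding pairs: the diagonal contributes the
  squared norm of f, the other pairs at most p^-d each.\<close>

lemma expectation_sum_push_sq_le:
  assumes "prime p" "\<And>x. 0 \<le> f x"
  shows "(\<Sum>Z\<in>set_pmf (Zlaw d k). pmf (Zlaw d k) Z * (\<Sum>g\<in>cube d. (push d k f Z g)\<^sup>2))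
    \<le> (\<Sum>x\<in>cube k. (f x)\<^sup>2) + (\<Sum>x\<in>cube k. f x)\<^sup>2 / real p ^ d"
proof -
  let ?c = "\<lambda>x y. measure_pmf.prob (Zlaw d k) {Z. lin d k Z x = lin d k Z y}"
  have "(\<Sum>Z\<in>set_pmf (Zlaw d k). pmf (Zlaw d k) Z * (\<Sum>g\<in>cube d. (push d k f Z g)\<^sup>2))
      = (\<Sum>Z\<in>set_pmf (Zlaw d k). \<Sum>x\<in>cube k. \<Sum>y\<in>cube k.
          f x * f y * (if Z \<in> {Z. lin d k Z x = lin d k Z y} then pmf (Zlaw d k) Z else 0))"
    unfolding sum_push_sq sum_distrib_left by (intro sum.cong refl) auto
  also have "\<dots> = (\<Sum>x\<in>cube k. \<Sum>Z\<in>set_pmf (Zlaw d k). \<Sum>y\<in>cube k.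
          f x * f y * (if Z \<in> {Z. lin d k Z x = lin d k Z y} then pmf (Zlaw d k) Z else 0))"
    by (rule sum.swap)
  also have "\<dots> = (\<Sum>x\<in>cube k. \<Sum>y\<in>cube k. f x * f y * ?c x y)"
    unfolding prob_eq_sum[OF finite_set_Zlaw order_refl] sum_distrib_left
    by (intro sum.cong refl sum.swap)
  also have "\<dots> \<le> (\<Sum>x\<in>cube k. \<Sum>y\<in>cube k. (if y = x then (f x)\<^sup>2 else 0) + f x * f y / real p ^ d)"
  proof (intro sum_mono)
    fix x y assume xy: "x \<in> cube k" "y \<in> cube k"
    have ff: "0 \<le> f x * f y" using assms(2) by simp
    show "f x * f y * ?c x y \<le> (if y = x then (f x)\<^sup>2 else 0) + f x * f y / real p ^ d"
    proof (cases "y = x")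
      case True
      have "0 \<le> f x * f y / real p ^ d" using ff by simp
      then show ?thesis using True by (simp add: power2_eq_square)
    next
      case False
      then have "?c x y \<le> 1 / real p ^ d" using collision_prob_le[OF assms(1) xy] by auto
      from mult_left_mono[OF this ff] show ?thesis using False by simp
    qed
  qed
  also have "\<dots> = (\<Sum>x\<in>cube k. (f x)\<^sup>2) + (\<Sum>x\<in>cube k. f x)\<^sup>2 / real p ^ d"
    by (simp add: sum.distrib power2_eq_square[of "sum f _"] sum_product sum_divide_distrib)
  finally show ?thesis .
qed

text \<open>Subtracting the mean removes the square of the total mass divided by p^d, which is
  exactly the off-diagonal bound; only the diagonal is left.\<close>

lemma expectation_push_deviation_le:
  assumes "prime p" "\<And>x. 0 \<le> f x"
  shows "(\<Sum>Z\<in>set_pmf (Zlaw d k). pmf (Zlaw d k) Z *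
      (\<Sum>g\<in>cube d. (push d k f Z g - (\<Sum>x\<in>cube k. f x) / real p ^ d)\<^sup>2)) \<le> (\<Sum>x\<in>cube k. (f x)\<^sup>2)"
proof -
  define m where "m = (\<Sum>x\<in>cube k. f x)"
  have pd: "real p ^ d \<noteq> 0" using p_ge_2 by simp
  have "(\<Sum>g\<in>cube d. (push d k f Z g - m / real p ^ d)\<^sup>2) = (\<Sum>g\<in>cube d. (push d k f Z g)\<^sup>2) - m\<^sup>2 / real p ^ d" for Z
  proof -
    have "(\<Sum>g\<in>cube d. (push d k f Z g - m / real p ^ d)\<^sup>2)
        = (\<Sum>g\<in>cube d. (push d k f Z g)\<^sup>2 - 2 * (m / real p ^ d) * push d k f Z g + (m / real p ^ d)\<^sup>2)"
      by (intro sum.cong refl) (simp add: power2_diff mult_ac)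
    also have "\<dots> = (\<Sum>g\<in>cube d. (push d k f Z g)\<^sup>2) - 2 * (m / real p ^ d) * m + real p ^ d * (m / real p ^ d)\<^sup>2"
      unfolding sum.distrib sum_subtractf sum_distrib_left[symmetric] sum_push m_def[symmetric] by (simp add: card_cube)
    also have "real p ^ d * (m / real p ^ d)\<^sup>2 = m\<^sup>2 / real p ^ d"
      using pd by (simp add: power2_eq_square)
    finally show ?thesis by (simp add: power2_eq_square)
  qed
  then have "(\<Sum>Z\<in>set_pmf (Zlaw d k). pmf (Zlaw d k) Z * (\<Sum>g\<in>cube d. (push d k f Z g - m / real p ^ d)\<^sup>2))
      = (\<Sum>Z\<in>set_pmf (Zlaw d k). pmf (Zlaw d k) Z * (\<Sum>g\<in>cube d. (push d k f Z g)\<^sup>2)) - m\<^sup>2 / real p ^ d"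
    by (simp only: right_diff_distrib sum_subtractf sum_distrib_right[symmetric] sum_Zlaw mult_1_left)
  moreover have "(\<Sum>Z\<in>set_pmf (Zlaw d k). pmf (Zlaw d k) Z * (\<Sum>g\<in>cube d. (push d k f Z g)\<^sup>2))
      \<le> (\<Sum>x\<in>cube k. (f x)\<^sup>2) + (\<Sum>x\<in>cube k. f x)\<^sup>2 / real p ^ d"
    using assms by (rule expectation_sum_push_sq_le)
  ultimately show ?thesis by (simp add: m_def)
qed

text \<open>The square root is taken outside the expectation by \<open>2 L \<le> \<alpha> + L\<^sup>2 / \<alpha>\<close> instead of Jensen's inequality.\<close>

lemma expectation_push_l1_le:
  assumes "prime p" "\<And>x. 0 \<le> f x" "0 < \<alpha>" "real p ^ d * (\<Sum>x\<in>cube k. (f x)\<^sup>2) \<le> \<alpha>\<^sup>2"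
  shows "(\<Sum>Z\<in>set_pmf (Zlaw d k). pmf (Zlaw d k) Z *
      (\<Sum>g\<in>cube d. \<bar>push d k f Z g - (\<Sum>x\<in>cube k. f x) / real p ^ d\<bar>)) \<le> \<alpha>"
proof -
  define D where "D Z g = push d k f Z g - (\<Sum>x\<in>cube k. f x) / real p ^ d" for Z g
  have "(\<Sum>Z\<in>set_pmf (Zlaw d k). pmf (Zlaw d k) Z * (\<Sum>g\<in>cube d. \<bar>D Z g\<bar>))
      \<le> (\<Sum>Z\<in>set_pmf (Zlaw d k). pmf (Zlaw d k) Z * (\<alpha> / 2 + real p ^ d / (2 * \<alpha>) * (\<Sum>g\<in>cube d. (D Z g)\<^sup>2)))"
  proof (intro sum_mono mult_left_mono)
    fix Z
    let ?L = "\<Sum>g\<in>cube d. \<bar>D Z g\<bar>"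
    have "?L\<^sup>2 \<le> (\<Sum>g\<in>cube d. \<bar>D Z g\<bar>\<^sup>2) * (\<Sum>g\<in>cube d. 1\<^sup>2)"
      using Cauchy_Schwarz_ineq_sum[of "\<lambda>g. \<bar>D Z g\<bar>" "\<lambda>_. 1" "cube d"] by simp
    then have L2: "?L\<^sup>2 \<le> real p ^ d * (\<Sum>g\<in>cube d. (D Z g)\<^sup>2)" by (simp add: card_cube mult.commute)
    have "0 \<le> (?L - \<alpha>)\<^sup>2" by simp
    then have "2 * \<alpha> * ?L \<le> \<alpha> * \<alpha> + ?L\<^sup>2" by (simp add: power2_eq_square algebra_simps)
    also have "\<dots> \<le> \<alpha> * \<alpha> + real p ^ d * (\<Sum>g\<in>cube d. (D Z g)\<^sup>2)" using L2 by simp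
    finally show "?L \<le> \<alpha> / 2 + real p ^ d / (2 * \<alpha>) * (\<Sum>g\<in>cube d. (D Z g)\<^sup>2)"
      using assms(3) by (simp add: field_simps)
  qed simp
  also have "\<dots> = \<alpha> / 2 + real p ^ d / (2 * \<alpha>) * (\<Sum>Z\<in>set_pmf (Zlaw d k). pmf (Zlaw d k) Z * (\<Sum>g\<in>cube d. (D Z g)\<^sup>2))"
  proof -
    have "(\<Sum>Z\<in>set_pmf (Zlaw d k). pmf (Zlaw d k) Z * (a + b * h Z))
        = a + b * (\<Sum>Z\<in>set_pmf (Zlaw d k). pmf (Zlaw d k) Z * h Z)" for a b :: real and h
    proof -
      have "(\<Sum>Z\<in>set_pmf (Zlaw d k). pmf (Zlaw d k) Z * (a + b * h Z))
          = (\<Sum>Z\<in>set_pmf (Zlaw d k). pmf (Zlaw d k) Z) * a + b * (\<Sum>Z\<in>set_pmf (Zlaw d k). pmf (Zlaw d k) Z * h Z)"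
        unfolding sum_distrib_right sum_distrib_left sum.distrib[symmetric]
        by (intro sum.cong refl) (simp add: algebra_simps)
      then show ?thesis by (simp add: sum_Zlaw)
    qed
    then show ?thesis .
  qed
  also have "\<dots> \<le> \<alpha> / 2 + real p ^ d / (2 * \<alpha>) * (\<Sum>x\<in>cube k. (f x)\<^sup>2)"
    unfolding D_def using assms(3) expectation_push_deviation_le[OF assms(1,2)]
    by (intro add_left_mono mult_left_mono) auto
  also have "\<dots> = \<alpha> / 2 + (real p ^ d * (\<Sum>x\<in>cube k. (f x)\<^sup>2)) / (2 * \<alpha>)" by simp
  also have "\<dots> \<le> \<alpha> / 2 + \<alpha>\<^sup>2 / (2 * \<alpha>)"
    using assms(3,4) by (intro add_left_mono divide_right_mono) auto
  also have "\<dots> = \<alpha>" using assms(3) by (simp add: power2_eq_square)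
  finally show ?thesis by (simp add: D_def)
qed

section \<open>Probability of generating the group\<close>

lemma generating_iff:
  assumes "Z \<in> set_pmf (Zlaw d k)"
  shows "Z \<in> generating (Zpow p d) k \<longleftrightarrow> lin_image d k Z = cube d"
  using lin_image_eq_generate[of k Z d] set_ZlawD[OF assms] by (simp add: generating_def carrier_Zpow)

text \<open>If Z fails to generate, the image of the uniform law lives on at most half of the group,
  so its chi-square distance \<open>?q\<close> from uniform is at least 1. Markov's inequality
  compares this with the mean of \<open>?q\<close>, at most p^d times the squared norm p^-k.\<close>

lemma prob_not_generating_le:
  assumes "prime p"
  shows "measure_pmf.prob (Zlaw d k) (- generating (Zpow p d) k) \<le> real p ^ d / real p ^ k"
proof -
  define f where "f x = 1 / real p ^ k" for x :: "nat \<Rightarrow> int"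
  have f0: "0 \<le> f x" for x by (simp add: f_def)
  have pk: "real p ^ n \<noteq> 0" for n using p_ge_2 by simp
  have m: "(\<Sum>x\<in>cube k. f x) = 1" using pk by (simp add: f_def card_cube)
  have f2: "(\<Sum>x\<in>cube k. (f x)\<^sup>2) = 1 / real p ^ k" using pk by (simp add: f_def card_cube power2_eq_square)
  let ?q = "\<lambda>Z. real p ^ d * (\<Sum>g\<in>cube d. (push d k f Z g - 1 / real p ^ d)\<^sup>2)"
  have "measure_pmf.prob (Zlaw d k) (- generating (Zpow p d) k)
      = (\<Sum>Z\<in>set_pmf (Zlaw d k). if Z \<in> - generating (Zpow p d) k then pmf (Zlaw d k) Z else 0)"
    by (rule prob_eq_sum[OF finite_set_Zlaw order_refl])
  also have "\<dots> \<le> (\<Sum>Z\<in>set_pmf (Zlaw d k). pmf (Zlaw d k) Z * ?q Z)"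
  proof (intro sum_mono)
    fix Z assume Z: "Z \<in> set_pmf (Zlaw d k)"
    show "(if Z \<in> - generating (Zpow p d) k then pmf (Zlaw d k) Z else 0) \<le> pmf (Zlaw d k) Z * ?q Z"
    proof (cases "lin_image d k Z = cube d")
      case True
      then show ?thesis using generating_iff[OF Z] by (simp add: sum_nonneg)
    next
      case False
      let ?I = "lin_image d k Z"
      have I: "?I \<subseteq> cube d" using lin_in_cube by (auto simp: lin_image_def)
      then have finI: "finite ?I" by (rule finite_subset) simp
      have zero: "push d k f Z g = 0" if "g \<in> cube d - ?I" for g
        using that unfolding push_def by (intro sum.neutral) (auto simp: lin_image_def)
      have "1 = (\<Sum>g\<in>?I. push d k f Z g)"
        using sum_push[of d k f Z] m sum.mono_neutral_right[of "cube d" ?I "push d k f Z"] I zero by simp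
      then have "1 = (\<Sum>g\<in>?I. push d k f Z g * 1)\<^sup>2" by simp
      also have "\<dots> \<le> (\<Sum>g\<in>?I. (push d k f Z g)\<^sup>2) * (\<Sum>g\<in>?I. 1\<^sup>2)"
        by (rule Cauchy_Schwarz_ineq_sum)
      also have "\<dots> = (\<Sum>g\<in>cube d. (push d k f Z g)\<^sup>2) * real (card ?I)"
        using sum.mono_neutral_right[of "cube d" ?I "\<lambda>g. (push d k f Z g)\<^sup>2"] I zero by simp
      finally have 1: "1 \<le> (\<Sum>g\<in>cube d. (push d k f Z g)\<^sup>2) * real (card ?I)" .
      have "real (2 * card ?I) \<le> real (p ^ d)" using card_lin_image_le[OF False] by (rule of_nat_mono)
      then have "(\<Sum>g\<in>cube d. (push d k f Z g)\<^sup>2) * real (card ?I) * 2 \<le> (\<Sum>g\<in>cube d. (push d k f Z g)\<^sup>2) * real p ^ d"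
        by (simp only: mult.assoc) (intro mult_left_mono, auto simp: sum_nonneg)
      with 1 have 2: "2 \<le> (\<Sum>g\<in>cube d. (push d k f Z g)\<^sup>2) * real p ^ d" by linarith
      have "?q Z = real p ^ d * (\<Sum>g\<in>cube d. (push d k f Z g)\<^sup>2 - 2 * (1 / real p ^ d) * push d k f Z g + (1 / real p ^ d)\<^sup>2)"
        by (intro arg_cong2[where f = "(*)"] sum.cong refl) (simp add: power2_diff mult_ac)
      also have "\<dots> = real p ^ d * ((\<Sum>g\<in>cube d. (push d k f Z g)\<^sup>2) - 2 * (1 / real p ^ d) + real p ^ d * (1 / real p ^ d)\<^sup>2)"
        unfolding sum.distrib sum_subtractf sum_distrib_left[symmetric] sum_push m by (simp add: card_cube)
      also have "\<dots> = real p ^ d * (\<Sum>g\<in>cube d. (push d k f Z g)\<^sup>2) - 1"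
        using pk[of d] by (simp add: field_simps power2_eq_square)
      finally have "1 \<le> ?q Z" using 2 by (simp add: mult.commute)
      then have "pmf (Zlaw d k) Z * 1 \<le> pmf (Zlaw d k) Z * ?q Z" by (intro mult_left_mono) auto
      moreover have "0 \<le> pmf (Zlaw d k) Z * ?q Z" by (simp add: sum_nonneg)
      ultimately show ?thesis by simp
    qed
  qed
  also have "\<dots> = real p ^ d * (\<Sum>Z\<in>set_pmf (Zlaw d k). pmf (Zlaw d k) Z * (\<Sum>g\<in>cube d. (push d k f Z g - 1 / real p ^ d)\<^sup>2))"
    by (simp add: sum_distrib_left mult_ac)
  also have "\<dots> \<le> real p ^ d * (1 / real p ^ k)"
  proof (rule mult_left_mono)
    show "(\<Sum>Z\<in>set_pmf (Zlaw d k). pmf (Zlaw d k) Z * (\<Sum>g\<in>cube d. (push d k f Z g - 1 / real p ^ d)\<^sup>2))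
        \<le> 1 / real p ^ k"
      using expectation_push_deviation_le[of f d k] assms f0 unfolding m f2 by blast
  qed simp
  finally show ?thesis by simp
qed

section \<open>Total variation for given and for random generators\<close>

lemma pmf_cayley_walk:
  assumes "0 < k" "0 \<le> t" "Z \<in> set_pmf (Zlaw d k)"
  shows "pmf (cayley_walk \<sigma> (Zpow p d) k Z t) g = push d k (mu \<sigma> k (t / k)) Z g"
proof -
  have eq: "cayley_walk \<sigma> (Zpow p d) k Z t = map_pmf (lin d k Z) (coordinate_walk \<sigma> p k t)"
    using assms set_ZlawD by (intro cayley_walk_eq_map) auto
  have "pmf (cayley_walk \<sigma> (Zpow p d) k Z t) g
      = (\<Sum>x\<in>cube k. if x \<in> lin d k Z -` {g} then pmf (coordinate_walk \<sigma> p k t) x else 0)"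
    unfolding eq pmf_map using set_coordinate_walk[OF assms(1)] by (intro prob_eq_sum) auto
  also have "\<dots> = push d k (mu \<sigma> k (t / k)) Z g"
    unfolding push_def using assms by (intro sum.cong refl) (simp add: pmf_coordinate_walk mu_def)
  finally show ?thesis .
qed

lemma set_cayley_walk:
  assumes "0 < k" "Z \<in> set_pmf (Zlaw d k)"
  shows "set_pmf (cayley_walk \<sigma> (Zpow p d) k Z t) \<subseteq> cube d"
proof -
  have "cayley_walk \<sigma> (Zpow p d) k Z t = map_pmf (lin d k Z) (coordinate_walk \<sigma> p k t)"
    using assms set_ZlawD by (intro cayley_walk_eq_map) auto
  then show ?thesis using lin_in_cube by auto
qed

text \<open>Points of probability at least exp (- a) number at most exp a. Their image keeps their
  mass and is no larger, whatever Z is, while the uniform law gives it at most exp a / p^d.\<close>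

lemma tv_to_uniform_lower:
  assumes "0 < k" "0 < t" "Z \<in> set_pmf (Zlaw d k)"
  shows "(\<Sum>x\<in>{x \<in> cube k. exp (- a) \<le> mu \<sigma> k (t / k) x}. mu \<sigma> k (t / k) x) - exp a / real p ^ d
    \<le> tv_to_uniform \<sigma> (Zpow p d) k t Z"
proof -
  define s where "s = t / k"
  have s: "0 < s" using assms by (simp add: s_def)
  define T where "T = {x \<in> cube k. exp (- a) \<le> mu \<sigma> k s x}"
  have finT: "finite T" by (simp add: T_def)
  define A where "A = lin d k Z ` T"
  have "real (card T) * exp (- a) \<le> (\<Sum>x\<in>T. mu \<sigma> k s x)"
    using sum_mono[of T "\<lambda>_. exp (- a)" "mu \<sigma> k s"] by (simp add: T_def)
  also have "\<dots> \<le> (\<Sum>x\<in>cube k. mu \<sigma> k s x)" by (intro sum_mono2) (auto simp: T_def mu_nonneg)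
  also have "\<dots> = 1" using s by (intro sum_mu) simp
  finally have "real (card T) \<le> exp a" by (simp add: exp_minus field_simps)
  moreover have "card A \<le> card T" unfolding A_def by (rule card_image_le[OF finT])
  ultimately have cA: "real (card A) \<le> exp a" by linarith
  have A: "A \<subseteq> cube d" using lin_in_cube by (auto simp: A_def)
  have "measure_pmf.prob (pmf_of_set (cube d)) A = real (card A) / real p ^ d"
    using A cube_nonempty by (simp add: measure_pmf_of_set card_cube Int_absorb1)
  also have "\<dots> \<le> exp a / real p ^ d" using cA by (intro divide_right_mono) auto
  finally have U: "measure_pmf.prob (pmf_of_set (cube d)) A \<le> exp a / real p ^ d" .
  have eq: "cayley_walk \<sigma> (Zpow p d) k Z t = map_pmf (lin d k Z) (coordinate_walk \<sigma> p k t)"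
    using assms set_ZlawD by (intro cayley_walk_eq_map) auto
  have "(\<Sum>x\<in>T. mu \<sigma> k s x) = (\<Sum>x\<in>T. pmf (coordinate_walk \<sigma> p k t) x)"
    using assms by (intro sum.cong refl) (simp add: T_def pmf_coordinate_walk mu_def s_def)
  also have "\<dots> = measure_pmf.prob (coordinate_walk \<sigma> p k t) T"
    using finT by (simp add: measure_measure_pmf_finite)
  also have "\<dots> \<le> measure_pmf.prob (coordinate_walk \<sigma> p k t) (lin d k Z -` A)"
    by (intro measure_pmf.finite_measure_mono) (auto simp: A_def)
  also have "\<dots> = measure_pmf.prob (cayley_walk \<sigma> (Zpow p d) k Z t) A" by (simp add: eq)
  finally have "(\<Sum>x\<in>T. mu \<sigma> k s x) - exp a / real p ^ d
      \<le> measure_pmf.prob (cayley_walk \<sigma> (Zpow p d) k Z t) A - measure_pmf.prob (pmf_of_set (cube d)) A"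
    using U by simp
  also have "\<dots> \<le> tv_to_uniform \<sigma> (Zpow p d) k t Z"
    unfolding tv_to_uniform_def carrier_Zpow
    using tv_dist_ge[of "cayley_walk \<sigma> (Zpow p d) k Z t" A "pmf_of_set (cube d)"] by linarith
  finally show ?thesis by (simp add: T_def s_def)
qed

text \<open>Discard the points heavier than exp (- a): the rest has sup norm, hence squared l2 norm,
  at most exp (- a), and the second moment bound applies. The discarded mass counts twice, in the
  law of the walk and in the target.\<close>

lemma expectation_tv_to_uniform_le:
  assumes "prime p" "0 < k" "0 < t"
  shows "(\<Sum>Z\<in>set_pmf (Zlaw d k). pmf (Zlaw d k) Z * tv_to_uniform \<sigma> (Zpow p d) k t Z)
    \<le> sqrt (real p ^ d * exp (- a)) + 2 * (\<Sum>x\<in>{x \<in> cube k. exp (- a) < mu \<sigma> k (t / k) x}. mu \<sigma> k (t / k) x)"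
proof -
  define s where "s = t / k"
  have s: "0 < s" using assms by (simp add: s_def)
  define f where "f x = (if mu \<sigma> k s x \<le> exp (- a) then mu \<sigma> k s x else 0)" for x
  define m where "m = (\<Sum>x\<in>cube k. f x)"
  define r where "r = (\<Sum>x\<in>{x \<in> cube k. exp (- a) < mu \<sigma> k s x}. mu \<sigma> k s x)"
  have f0: "0 \<le> f x" and f_le: "f x \<le> mu \<sigma> k s x" for x by (simp_all add: f_def mu_nonneg)
  have r: "r = (\<Sum>x\<in>cube k. mu \<sigma> k s x - f x)"
    unfolding r_def sum.inter_filter[OF finite_cube] by (intro sum.cong refl) (auto simp: f_def)
  have rm: "r = 1 - m" unfolding r m_def sum_subtractf using s by (simp add: sum_mu)
  have r0: "0 \<le> r" by (simp add: r_def sum_nonneg mu_nonneg)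
  have m1: "m \<le> 1" using rm r0 by simp
  have "(\<Sum>x\<in>cube k. (f x)\<^sup>2) \<le> (\<Sum>x\<in>cube k. exp (- a) * f x)"
    unfolding power2_eq_square by (intro sum_mono mult_right_mono f0) (auto simp: f_def)
  also have "\<dots> = exp (- a) * m" by (simp add: m_def sum_distrib_left)
  also have "\<dots> \<le> exp (- a) * 1" using m1 by (intro mult_left_mono) auto
  finally have f2: "real p ^ d * (\<Sum>x\<in>cube k. (f x)\<^sup>2) \<le> real p ^ d * exp (- a)"
    by (intro mult_left_mono) auto
  have tv: "tv_to_uniform \<sigma> (Zpow p d) k t Z \<le> (\<Sum>g\<in>cube d. \<bar>push d k f Z g - m / real p ^ d\<bar>) + 2 * r"
    if Z: "Z \<in> set_pmf (Zlaw d k)" for Z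
  proof -
    have "tv_to_uniform \<sigma> (Zpow p d) k t Z
        \<le> (\<Sum>g\<in>cube d. \<bar>pmf (cayley_walk \<sigma> (Zpow p d) k Z t) g - pmf (pmf_of_set (cube d)) g\<bar>)"
      unfolding tv_to_uniform_def carrier_Zpow using set_cayley_walk[OF assms(2) Z] cube_nonempty
      by (intro tv_dist_le_l1) auto
    \<comment> \<open>The uniform weight is split as m / p^d + r / p^d, since the image of
      \<open>f\<close> has total mass m only.\<close>
    also have "\<dots> \<le> (\<Sum>g\<in>cube d. \<bar>push d k f Z g - m / real p ^ d\<bar>
        + push d k (\<lambda>x. mu \<sigma> k s x - f x) Z g + r / real p ^ d)"
    proof (intro sum_mono)
      fix g assume g: "g \<in> cube d"
      have "pmf (cayley_walk \<sigma> (Zpow p d) k Z t) g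
          = push d k f Z g + push d k (\<lambda>x. mu \<sigma> k s x - f x) Z g"
        using assms Z unfolding push_def sum.distrib[symmetric]
        by (subst pmf_cayley_walk) (auto simp: push_def s_def intro!: sum.cong)
      moreover have "pmf (pmf_of_set (cube d)) g = m / real p ^ d + r / real p ^ d"
        using g cube_nonempty by (simp add: card_cube rm flip: add_divide_distrib)
      moreover have "0 \<le> push d k (\<lambda>x. mu \<sigma> k s x - f x) Z g" by (rule push_nonneg) (use f_le in simp)
      moreover have "0 \<le> r / real p ^ d" using r0 by simp
      ultimately show "\<bar>pmf (cayley_walk \<sigma> (Zpow p d) k Z t) g - pmf (pmf_of_set (cube d)) g\<bar>
          \<le> \<bar>push d k f Z g - m / real p ^ d\<bar> + push d k (\<lambda>x. mu \<sigma> k s x - f x) Z g + r / real p ^ d"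
        by linarith
    qed
    also have "\<dots> = (\<Sum>g\<in>cube d. \<bar>push d k f Z g - m / real p ^ d\<bar>) + 2 * r"
      using p_ge_2 by (simp add: sum.distrib sum_push r[symmetric] card_cube)
    finally show ?thesis .
  qed
  have "(\<Sum>Z\<in>set_pmf (Zlaw d k). pmf (Zlaw d k) Z * tv_to_uniform \<sigma> (Zpow p d) k t Z)
      \<le> (\<Sum>Z\<in>set_pmf (Zlaw d k). pmf (Zlaw d k) Z * ((\<Sum>g\<in>cube d. \<bar>push d k f Z g - m / real p ^ d\<bar>) + 2 * r))"
    by (intro sum_mono mult_left_mono tv) auto
  also have "\<dots> = (\<Sum>Z\<in>set_pmf (Zlaw d k). pmf (Zlaw d k) Z * (\<Sum>g\<in>cube d. \<bar>push d k f Z g - m / real p ^ d\<bar>)) + 2 * r"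
    by (simp only: distrib_left sum.distrib sum_distrib_right[symmetric] sum_Zlaw mult_1_left)
  also have "\<dots> \<le> sqrt (real p ^ d * exp (- a)) + 2 * r"
    unfolding m_def using assms(1) f0 f2 p_ge_2 by (intro add_right_mono expectation_push_l1_le) auto
  finally show ?thesis by (simp add: r_def s_def)
qed

text \<open>When Z generates, the linear map takes the uniform law to the uniform law, and total
  variation does not increase under maps.\<close>

lemma tv_to_uniform_le_coordinate:
  assumes "0 < k" "0 < t" "Z \<in> set_pmf (Zlaw d k)" "Z \<in> generating (Zpow p d) k"
  shows "tv_to_uniform \<sigma> (Zpow p d) k t Z \<le> sqrt (exp (real k * chisq (t / k)) - 1)"
proof -
  have eq: "cayley_walk \<sigma> (Zpow p d) k Z t = map_pmf (lin d k Z) (coordinate_walk \<sigma> p k t)"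
    using assms set_ZlawD by (intro cayley_walk_eq_map) auto
  have "pmf_of_set (cube d) = map_pmf (lin d k Z) (pmf_of_set (cube k))"
    using assms generating_iff by (simp add: map_lin_uniform)
  then have "tv_to_uniform \<sigma> (Zpow p d) k t Z \<le> tv_dist (coordinate_walk \<sigma> p k t) (pmf_of_set (cube k))"
    unfolding tv_to_uniform_def carrier_Zpow eq by (simp add: tv_dist_map_le)
  also have "\<dots> \<le> sqrt (exp (real k * chisq (t / k)) - 1)"
    using assms by (intro tv_coordinate_walk_le) auto
  finally show ?thesis .
qed

lemma prob_generating_ge_half:
  assumes "prime p" "d < k"
  shows "1 / 2 \<le> measure_pmf.prob (Zlaw d k) (generating (Zpow p d) k)"
proof -
  have "real p ^ d / real p ^ k = 1 / real p ^ (k - d)"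
    using assms p_ge_2 by (simp add: power_diff)
  also have "\<dots> \<le> 1 / 2"
  proof -
    have "(2::real) = 2 ^ 1" by simp
    also have "\<dots> \<le> real p ^ (k - d)"
      using assms p_ge_2 by (intro order_trans[OF power_increasing power_mono]) auto
    finally show ?thesis by (intro divide_left_mono) auto
  qed
  finally have "measure_pmf.prob (Zlaw d k) (- generating (Zpow p d) k) \<le> 1 / 2"
    using prob_not_generating_le[OF assms(1), of d k] by linarith
  moreover have "measure_pmf.prob (Zlaw d k) (- generating (Zpow p d) k) = 1 - measure_pmf.prob (Zlaw d k) (generating (Zpow p d) k)"
    using measure_pmf.prob_compl[of "generating (Zpow p d) k" "Zlaw d k"] by (simp add: Compl_eq_Diff_UNIV)
  ultimately show ?thesis by simp
qed

lemma generating_nonempty: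
  assumes "prime p" "d < k"
  shows "set_pmf (Zlaw d k) \<inter> generating (Zpow p d) k \<noteq> {}"
  using prob_generating_ge_half[OF assms] measure_pmf_zero_iff[of "Zlaw d k" "generating (Zpow p d) k"] by auto

text \<open>The conditional law is pointwise at most twice the unconditional one; then Markov's
  inequality.\<close>

lemma prob_conditioned_le:
  assumes "prime p" "d < k" "0 < \<eta>"
  shows "measure_pmf.prob (iid_uniform_generating (Zpow p d) k) {Z. \<eta> < tv_to_uniform \<sigma> (Zpow p d) k t Z}
    \<le> 2 * (\<Sum>Z\<in>set_pmf (Zlaw d k). pmf (Zlaw d k) Z * tv_to_uniform \<sigma> (Zpow p d) k t Z) / \<eta>"
proof -
  let ?D = "\<lambda>Z. tv_to_uniform \<sigma> (Zpow p d) k t Z"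
  note ne = generating_nonempty[OF assms(1,2)]
  have D0: "0 \<le> ?D Z" for Z by (simp add: tv_to_uniform_def tv_dist_nonneg)
  have "measure_pmf.prob (iid_uniform_generating (Zpow p d) k) {Z. \<eta> < ?D Z}
      = (\<Sum>Z\<in>set_pmf (Zlaw d k). if Z \<in> {Z. \<eta> < ?D Z} then pmf (iid_uniform_generating (Zpow p d) k) Z else 0)"
    unfolding iid_uniform_generating_def using ne by (intro prob_eq_sum finite_set_Zlaw) auto
  also have "\<dots> \<le> (\<Sum>Z\<in>set_pmf (Zlaw d k). 2 * (pmf (Zlaw d k) Z * ?D Z) / \<eta>)"
  proof (intro sum_mono)
    fix Z
    have le: "pmf (iid_uniform_generating (Zpow p d) k) Z \<le> 2 * pmf (Zlaw d k) Z"
    proof (cases "Z \<in> generating (Zpow p d) k")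
      case True
      have "pmf (Zlaw d k) Z / measure_pmf.prob (Zlaw d k) (generating (Zpow p d) k) \<le> pmf (Zlaw d k) Z / (1 / 2)"
        using prob_generating_ge_half[OF assms(1,2)] by (intro divide_left_mono mult_pos_pos) auto
      then show ?thesis using True ne by (simp add: iid_uniform_generating_def pmf_cond)
    qed (use ne in \<open>simp add: iid_uniform_generating_def pmf_cond\<close>)
    show "(if Z \<in> {Z. \<eta> < ?D Z} then pmf (iid_uniform_generating (Zpow p d) k) Z else 0) \<le> 2 * (pmf (Zlaw d k) Z * ?D Z) / \<eta>"
    proof (cases "\<eta> < ?D Z")
      case True
      have "2 * pmf (Zlaw d k) Z * \<eta> \<le> 2 * pmf (Zlaw d k) Z * ?D Z"
        using True by (intro mult_left_mono) auto
      then have "2 * pmf (Zlaw d k) Z \<le> 2 * (pmf (Zlaw d k) Z * ?D Z) / \<eta>"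
        using assms(3) by (simp add: pos_le_divide_eq)
      then show ?thesis using le True by simp
    qed (use D0 assms(3) in simp)
  qed
  also have "\<dots> = 2 * (\<Sum>Z\<in>set_pmf (Zlaw d k). pmf (Zlaw d k) Z * ?D Z) / \<eta>"
    by (simp add: sum_distrib_left sum_divide_distrib)
  finally show ?thesis .
qed

end

section \<open>Bounds at a fixed index\<close>

text \<open>Convergence in probability to a constant implies convergence in distribution; the jump
  of the limiting distribution function is not a continuity point.\<close>

lemma tends_in_distribution_to_constI:
  assumes "\<And>\<eta>. 0 < \<eta> \<Longrightarrow> (\<lambda>N. measure_pmf.prob (M N) {z. \<eta> < \<bar>X N z - c\<bar>}) \<longlonglongrightarrow> 0"
  shows "tends_in_distribution_to_const M X c"
  unfolding tends_in_distribution_to_const_def weak_conv_m_def weak_conv_def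
proof (intro allI impI)
  fix x
  have cdf_X: "cdf (distr (measure_pmf (M N)) borel (X N)) x = measure_pmf.prob (M N) {z. X N z \<le> x}" for N
    unfolding cdf_def by (subst measure_distr) (auto simp: vimage_def)
  have cdf_c: "cdf (return borel c) u = (if c \<le> u then 1 else 0)" for u
    unfolding cdf_def by (subst measure_return) (auto simp: indicator_def)
  assume cont: "isCont (cdf (return borel c)) x"
  show "(\<lambda>N. cdf (distr (measure_pmf (M N)) borel (X N)) x) \<longlonglongrightarrow> cdf (return borel c) x"
  proof (cases rule: linorder_cases[of x c])
    case less
    have "(\<lambda>N. measure_pmf.prob (M N) {z. X N z \<le> x}) \<longlonglongrightarrow> 0"
    proof (rule tendsto_sandwich[OF _ _ tendsto_const assms[of "(c - x) / 2"]])
      show "\<forall>\<^sub>F N in sequentially. measure_pmf.prob (M N) {z. X N z \<le> x}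
          \<le> measure_pmf.prob (M N) {z. (c - x) / 2 < \<bar>X N z - c\<bar>}"
        using less by (intro always_eventually allI measure_pmf.finite_measure_mono) auto
    qed (use less in auto)
    then show ?thesis using less by (simp add: cdf_X cdf_c)
  next
    case equal
    \<comment> \<open>Approaching x = c from the left, the values are 0 whereas the value at c is 1;
      this contradicts continuity.\<close>
    have "(\<lambda>n. x - 1 / real (Suc n)) \<longlonglongrightarrow> x - 0"
      by (intro tendsto_diff tendsto_const LIMSEQ_Suc[OF lim_1_over_n])
    then have "(\<lambda>n. x - 1 / real (Suc n)) \<longlonglongrightarrow> x" by simp
    from isCont_tendsto_compose[OF cont this] equal show ?thesis
      by (simp add: cdf_c LIMSEQ_const_iff)
  next
    case greater
    have "(\<lambda>N. 1 - measure_pmf.prob (M N) {z. X N z \<le> x}) \<longlonglongrightarrow> 0"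
    proof (rule tendsto_sandwich[OF _ _ tendsto_const assms[of "(x - c) / 2"]])
      show "\<forall>\<^sub>F N in sequentially. 1 - measure_pmf.prob (M N) {z. X N z \<le> x}
          \<le> measure_pmf.prob (M N) {z. (x - c) / 2 < \<bar>X N z - c\<bar>}"
      proof (intro always_eventually allI)
        fix N
        have "1 - measure_pmf.prob (M N) {z. X N z \<le> x} = measure_pmf.prob (M N) (- {z. X N z \<le> x})"
          using measure_pmf.prob_compl[of "{z. X N z \<le> x}" "M N"] by (simp add: Compl_eq_Diff_UNIV)
        also have "\<dots> \<le> measure_pmf.prob (M N) {z. (x - c) / 2 < \<bar>X N z - c\<bar>}"
          using greater by (intro measure_pmf.finite_measure_mono) auto
        finally show "1 - measure_pmf.prob (M N) {z. X N z \<le> x}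
            \<le> measure_pmf.prob (M N) {z. (x - c) / 2 < \<bar>X N z - c\<bar>}" .
      qed
    qed (use greater in auto)
    then have "(\<lambda>N. 1 - (1 - measure_pmf.prob (M N) {z. X N z \<le> x})) \<longlonglongrightarrow> 1 - 0"
      by (intro tendsto_diff tendsto_const)
    then show ?thesis using greater by (simp add: cdf_X cdf_c)
  qed
qed

definition gain_const :: "real \<Rightarrow> real \<Rightarrow> real" where
  "gain_const c \<delta> = min (c * exp (- (4 * pi\<^sup>2)) * ln (1 + \<delta>)) ((1 - exp (- 8 * \<delta>)) / 4)"

text \<open>The varentropy bound valid up to p^2, times exp (4 pi^2), which compensates for the
  factor exp (-2 g s) that is still bounded below there.\<close>

definition varentropy_const :: "real \<Rightarrow> real" where
  "varentropy_const c = (166 + 18 / sqrt c) * exp (4 * pi\<^sup>2)"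

text \<open>The threshold of \<open>entropy1_small\<close>: before it the entropy of a coordinate is
  below T.\<close>

definition min_time :: "real \<Rightarrow> real" where
  "min_time T = min 1 (T / (6 * (27 / T)\<^sup>2))"

lemma gain_const_pos: "0 < c \<Longrightarrow> 0 < \<delta> \<Longrightarrow> 0 < gain_const c \<delta>"
  by (simp add: gain_const_def)

lemma varentropy_const_pos: "0 < c \<Longrightarrow> 0 < varentropy_const c"
  by (simp add: varentropy_const_def add_pos_pos)

lemma min_time_pos: "0 < T \<Longrightarrow> 0 < min_time T"
  by (simp add: min_time_def)

context cycle
begin

lemma exp_gap_ge:
  assumes "s \<le> (real p)\<^sup>2"
  shows "exp (- (4 * pi\<^sup>2)) \<le> exp (- (2 * gap * s))"
proof -
  have "gap * s \<le> gap * (real p)\<^sup>2" using assms gap_pos by (intro mult_left_mono) auto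
  then show ?thesis using gap_mult_p2 by (simp add: mult.commute)
qed

lemma varentropy1_le_exp:
  assumes "0 < c" "c \<le> s"
  shows "varentropy1 \<sigma> s \<le> varentropy_const c * exp (- (2 * gap * s))"
proof (cases "s \<le> (real p)\<^sup>2")
  case True
  have "varentropy1 \<sigma> s \<le> 166 + 18 / sqrt s" using True assms by (intro varentropy1_bounded) auto
  also have "\<dots> \<le> 166 + 18 / sqrt c" using assms by (intro add_left_mono divide_left_mono) auto
  also have "\<dots> = varentropy_const c * exp (- (4 * pi\<^sup>2))"
    by (simp add: varentropy_const_def mult.assoc exp_add[symmetric])
  also have "\<dots> \<le> varentropy_const c * exp (- (2 * gap * s))"
    using exp_gap_ge[OF True] varentropy_const_pos[OF assms(1)] by (intro mult_left_mono) auto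
  finally show ?thesis .
next
  case False
  have "varentropy1 \<sigma> s \<le> chisq s" using assms by (intro varentropy1_le_chisq) auto
  also have "\<dots> \<le> 2 * exp (4 * pi\<^sup>2) * exp (- (2 * gap * s))" using False by (intro chisq_decay) auto
  also have "\<dots> \<le> varentropy_const c * exp (- (2 * gap * s))"
    unfolding varentropy_const_def using assms(1) by (intro mult_right_mono) (auto intro: order_trans[of _ 166])
  finally show ?thesis .
qed

lemma entropy1_gain_exp:
  assumes "0 < c" "c \<le> 1" "c \<le> a" "0 < \<delta>" "\<delta> \<le> 1" "(1 + \<delta>) * a \<le> b"
  shows "gain_const c \<delta> * exp (- (2 * gap * a)) \<le> entropy1 \<sigma> b - entropy1 \<sigma> a"
  unfolding gain_const_def by (rule entropy1_gain[OF assms])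

end

text \<open>The situation at one index N. All bounds below depend on C and \<epsilon>, and on p, d,
  k only through k and \<open>y0\<close> or similar scales, so that the limit can be taken
  afterwards.\<close>

locale entropic = cycle p for p +
  fixes \<sigma> :: orientation and d k :: nat and C :: real
  assumes p_prime: "prime p"
    and d_pos: "0 < d"
    and d_less_k: "d < k"
    and C_pos: "0 < C"
    and k_le: "real k \<le> C * ln (real (p ^ d))"
begin

definition s0 :: real where "s0 = entropic_time \<sigma> k p d / real k"

definition y0 :: real where "y0 = real k * exp (- (2 * gap * s0))"

abbreviation c0 :: real where "c0 \<equiv> min_time (1 / C)"

lemma k_pos: "0 < k"
  using d_less_k by simp

lemma s0_pos: "0 < s0" and entropy1_s0: "real k * entropy1 \<sigma> s0 = ln (real (p ^ d))"
  using entropic_time_props[OF d_pos d_less_k, of \<sigma>] by (simp_all only: s0_def)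

lemma t0_eq: "(r * entropic_time \<sigma> k p d) / real k = r * s0"
  by (simp add: s0_def)

lemma t0_pos: "0 < entropic_time \<sigma> k p d"
  using s0_pos k_pos by (simp add: s0_def zero_less_divide_iff)

text \<open>k \<le> C ln (p^d) says that the entropy per coordinate at \<open>s0\<close> is at least
  1 / C, too much for a time below \<open>c0\<close>.\<close>

lemma c0_le_s0: "c0 \<le> s0"
proof (rule ccontr)
  assume "\<not> c0 \<le> s0"
  then have "entropy1 \<sigma> s0 < 1 / C"
    using s0_pos C_pos by (intro entropy1_small) (auto simp: min_time_def)
  then have "real k * entropy1 \<sigma> s0 < real k * (1 / C)" using k_pos by (intro mult_strict_left_mono) auto
  then show False using k_le C_pos unfolding entropy1_s0 by (simp add: field_simps)
qed

lemma y0_pos: "0 < y0"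
  using k_pos by (simp add: y0_def)

text \<open>Exponents at (1 + \<epsilon>) s0 and (1 - \<epsilon>) s0 become combinations of ln k and
  ln \<open>y0\<close>.\<close>

lemma two_gap_s0: "2 * gap * s0 = ln (real k) - ln y0"
  using k_pos by (simp add: y0_def ln_mult)

lemma y0_ge_small_time: "s0 \<le> (real p)\<^sup>2 \<Longrightarrow> real k * exp (- (4 * pi\<^sup>2)) \<le> y0"
  unfolding y0_def by (intro mult_left_mono exp_gap_ge) auto

text \<open>The total entropy deficit at \<open>s0\<close> is (k - d) ln p, at least ln 2, and
  beyond p^2 it is at most a constant times \<open>y0\<close>. Before p^2, \<open>y0\<close> is at
  least a constant times k.\<close>

lemma y0_ge: "ln 2 / (2 * exp (4 * pi\<^sup>2)) \<le> y0"
proof (cases "s0 \<le> (real p)\<^sup>2")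
  case True
  have "ln 2 / (2 * exp (4 * pi\<^sup>2)) \<le> 1 * exp (- (4 * pi\<^sup>2))"
    using ln_le_minus_one[of 2] by (simp add: exp_minus field_simps)
  also have "\<dots> \<le> real k * exp (- (4 * pi\<^sup>2))" using k_pos by (intro mult_right_mono) auto
  finally show ?thesis using y0_ge_small_time[OF True] by simp
next
  case False
  have "ln 2 \<le> ln (real p)" using p_ge_2 by simp
  also have "ln (real p) = 1 * ln (real p)" by simp
  also have "\<dots> \<le> (real k - real d) * ln (real p)"
    using d_less_k p_ge_2 by (intro mult_right_mono) auto
  also have "\<dots> = real k * (ln (real p) - entropy1 \<sigma> s0)"
    using entropy1_s0 p_ge_2 by (simp add: ln_realpow algebra_simps)
  also have "\<dots> \<le> real k * (2 * exp (4 * pi\<^sup>2) * exp (- (2 * gap * s0)))"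
    using entropy1_deficit_le_chisq[OF s0_pos, of \<sigma>] chisq_decay[of s0] False by (intro mult_left_mono) auto
  also have "\<dots> = 2 * exp (4 * pi\<^sup>2) * y0" by (simp add: y0_def)
  finally show ?thesis by (simp add: field_simps)
qed

text \<open>The deviation \<gamma> Y / 2 is half the guaranteed entropy gain, the variance is at
  most K Y.\<close>

lemma chebyshev_ratio:
  assumes "0 < Y" "0 < \<gamma>" "v \<le> K * (Y / real k)"
  shows "real k * v / (\<gamma> * Y / 2)\<^sup>2 \<le> 4 * K / (\<gamma>\<^sup>2 * Y)"
proof -
  have "real k * v \<le> real k * (K * (Y / real k))" using assms by (intro mult_left_mono) auto
  also have "\<dots> = K * Y" using k_pos by simp
  finally have "real k * v / (\<gamma> * Y / 2)\<^sup>2 \<le> K * Y / (\<gamma> * Y / 2)\<^sup>2" by (intro divide_right_mono) auto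
  also have "\<dots> = 4 * K / (\<gamma>\<^sup>2 * Y)" using assms by (simp add: power2_eq_square field_simps)
  finally show ?thesis .
qed

lemma tv_lower:
  assumes \<epsilon>: "0 < \<epsilon>" "\<epsilon> < 1" and Z: "Z \<in> set_pmf (Zlaw d k)"
  defines "c \<equiv> (1 - \<epsilon>) * c0"
  defines "\<gamma> \<equiv> gain_const c \<epsilon>"
  defines "Y \<equiv> real k * exp (- (2 * gap * ((1 - \<epsilon>) * s0)))"
  shows "1 - 4 * varentropy_const c / (\<gamma>\<^sup>2 * Y) - exp (- (\<gamma> * Y / 2))
    \<le> tv_to_uniform \<sigma> (Zpow p d) k ((1 - \<epsilon>) * entropic_time \<sigma> k p d) Z"
proof -
  define s where "s = (1 - \<epsilon>) * s0"
  have c: "0 < c" "c \<le> 1" "c \<le> s"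
    using \<epsilon> C_pos c0_le_s0 min_time_pos[of "1 / C"]
    by (auto simp: c_def s_def min_time_def intro!: mult_le_one)
  have s: "0 < s" using \<epsilon> s0_pos by (simp add: s_def)
  have \<gamma>: "0 < \<gamma>" unfolding \<gamma>_def using c \<epsilon> by (intro gain_const_pos) auto
  have Y: "0 < Y" using k_pos by (simp add: Y_def)
  define r where "r = \<gamma> * Y / 2"
  have r: "0 < r" using \<gamma> Y by (simp add: r_def)
  \<comment> \<open>(1 + \<epsilon>) (1 - \<epsilon>) \<le> 1, so the gain from s to
    \<open>s0\<close> is available with \<delta> = \<epsilon>.\<close>
  have "(1 + \<epsilon>) * s \<le> s0"
  proof -
    have "(1 + \<epsilon>) * s = (1 - \<epsilon>\<^sup>2) * s0" by (simp add: s_def power2_eq_square algebra_simps)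
    also have "\<dots> \<le> 1 * s0" using s0_pos by (intro mult_right_mono) auto
    finally show ?thesis by simp
  qed
  then have "\<gamma> * exp (- (2 * gap * s)) \<le> entropy1 \<sigma> s0 - entropy1 \<sigma> s"
    unfolding \<gamma>_def using c \<epsilon> by (intro entropy1_gain_exp) auto
  then have "real k * (\<gamma> * exp (- (2 * gap * s))) \<le> real k * (entropy1 \<sigma> s0 - entropy1 \<sigma> s)"
    by (intro mult_left_mono) auto
  then have gain: "2 * r \<le> ln (real (p ^ d)) - real k * entropy1 \<sigma> s"
    by (simp only: right_diff_distrib entropy1_s0) (simp add: r_def Y_def s_def mult_ac)
  \<comment> \<open>At least r above the entropy of the walk, so typical points qualify, and still r
    below ln (p^d), so they are few.\<close>
  define a where "a = ln (real (p ^ d)) - r"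
  let ?B = "{x \<in> cube k. r \<le> \<bar>ln (mu \<sigma> k s x) + real k * entropy1 \<sigma> s\<bar>}"
  let ?A = "{x \<in> cube k. exp (- a) \<le> mu \<sigma> k s x}"
  have sub: "cube k \<subseteq> ?A \<union> ?B"
  proof
    fix x assume x: "x \<in> cube k"
    have "ln (mu \<sigma> k s x) + real k * entropy1 \<sigma> s \<le> - r" if "\<not> exp (- a) \<le> mu \<sigma> k s x"
    proof -
      have "ln (mu \<sigma> k s x) < - a"
        using that mu_pos[OF s, of \<sigma> k x] by (metis exp_less_cancel_iff exp_ln not_le)
      then show ?thesis using gain by (simp add: a_def)
    qed
    then show "x \<in> ?A \<union> ?B" using x r by fastforce
  qed
  have "1 = (\<Sum>x\<in>cube k. mu \<sigma> k s x)" using s by (simp add: sum_mu)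
  also have "\<dots> \<le> (\<Sum>x\<in>?A \<union> ?B. mu \<sigma> k s x)"
    by (intro sum_mono2[OF _ sub] mu_nonneg) auto
  also have "\<dots> \<le> (\<Sum>x\<in>?A. mu \<sigma> k s x) + (\<Sum>x\<in>?B. mu \<sigma> k s x)"
    using sum.union_inter[of ?A ?B "mu \<sigma> k s"] sum_nonneg[of "?A \<inter> ?B" "mu \<sigma> k s"] mu_nonneg by simp
  also have "(\<Sum>x\<in>?B. mu \<sigma> k s x) \<le> real k * varentropy1 \<sigma> s / r\<^sup>2" by (rule mu_chebyshev[OF s r])
  also have "\<dots> \<le> 4 * varentropy_const c / (\<gamma>\<^sup>2 * Y)"
    unfolding r_def
  proof (rule chebyshev_ratio[OF Y \<gamma>])
    show "varentropy1 \<sigma> s \<le> varentropy_const c * (Y / real k)"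
      using varentropy1_le_exp[OF c(1,3), of \<sigma>] k_pos by (simp add: Y_def s_def)
  qed
  finally have "1 - 4 * varentropy_const c / (\<gamma>\<^sup>2 * Y) \<le> (\<Sum>x\<in>?A. mu \<sigma> k s x)" by simp
  moreover have "exp a / real p ^ d = exp (- (\<gamma> * Y / 2))"
  proof -
    have "exp a = exp (ln (real (p ^ d))) * exp (- r)" by (simp add: a_def exp_diff exp_minus field_simps)
    then show ?thesis using p_ge_2 by (simp add: r_def)
  qed
  moreover have "(\<Sum>x\<in>?A. mu \<sigma> k s x) - exp a / real p ^ d
      \<le> tv_to_uniform \<sigma> (Zpow p d) k ((1 - \<epsilon>) * entropic_time \<sigma> k p d) Z"
    using tv_to_uniform_lower[OF k_pos _ Z, where t = "(1 - \<epsilon>) * entropic_time \<sigma> k p d" and a = a and \<sigma> = \<sigma>] \<epsilon> t0_pos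
    unfolding t0_eq s_def[symmetric] by simp
  ultimately show ?thesis by simp
qed

text \<open>The right-hand side is k^\<epsilon> times \<open>y0\<close>^(1 - \<epsilon>); inserting
  the lower bound for \<open>y0\<close> leaves a power of k, which tends to infinity.\<close>

lemma lower_scale_ge:
  assumes "0 < \<epsilon>" "\<epsilon> < 1"
  shows "exp (\<epsilon> * ln (real k) + (1 - \<epsilon>) * ln (ln 2 / (2 * exp (4 * pi\<^sup>2))))
    \<le> real k * exp (- (2 * gap * ((1 - \<epsilon>) * s0)))"
proof -
  let ?c = "ln 2 / (2 * exp (4 * pi\<^sup>2)) :: real"
  have "ln ?c \<le> ln y0" using y0_ge by (intro ln_mono) auto
  then have "(1 - \<epsilon>) * (2 * gap * s0) \<le> (1 - \<epsilon>) * (ln (real k) - ln ?c)"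
    using assms unfolding two_gap_s0 by (intro mult_left_mono) auto
  then have "\<epsilon> * ln (real k) + (1 - \<epsilon>) * ln ?c \<le> ln (real k) + - (2 * gap * ((1 - \<epsilon>) * s0))"
    by (simp add: algebra_simps)
  then have "exp (\<epsilon> * ln (real k) + (1 - \<epsilon>) * ln ?c) \<le> exp (ln (real k) + - (2 * gap * ((1 - \<epsilon>) * s0)))"
    by simp
  also have "\<dots> = real k * exp (- (2 * gap * ((1 - \<epsilon>) * s0)))"
    using k_pos by (simp only: exp_add) simp
  finally show ?thesis .
qed

text \<open>The exponential is the second moment term, the other is twice the Chebyshev tail. Both
  are small exactly when \<open>y0\<close> is large.\<close>

lemma expectation_tv_upper:
  assumes \<epsilon>: "0 < \<epsilon>" "\<epsilon> < 1"
  defines "\<gamma> \<equiv> gain_const c0 \<epsilon>"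
  shows "(\<Sum>Z\<in>set_pmf (Zlaw d k). pmf (Zlaw d k) Z *
      tv_to_uniform \<sigma> (Zpow p d) k ((1 + \<epsilon>) * entropic_time \<sigma> k p d) Z)
    \<le> exp (- (\<gamma> * y0 / 4)) + 8 * varentropy_const c0 / (\<gamma>\<^sup>2 * y0)"
proof -
  define s where "s = (1 + \<epsilon>) * s0"
  have c: "0 < c0" "c0 \<le> 1" using C_pos min_time_pos[of "1 / C"] by (auto simp: min_time_def)
  have s: "0 < s" "s0 \<le> s" using \<epsilon> s0_pos by (simp_all add: s_def)
  have \<gamma>: "0 < \<gamma>" unfolding \<gamma>_def using c \<epsilon> by (intro gain_const_pos) auto
  define r where "r = \<gamma> * y0 / 2"
  have r: "0 < r" using \<gamma> y0_pos by (simp add: r_def)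
  have "\<gamma> * exp (- (2 * gap * s0)) \<le> entropy1 \<sigma> s - entropy1 \<sigma> s0"
    unfolding \<gamma>_def s_def using c c0_le_s0 \<epsilon> by (intro entropy1_gain_exp) auto
  then have "real k * (\<gamma> * exp (- (2 * gap * s0))) \<le> real k * (entropy1 \<sigma> s - entropy1 \<sigma> s0)"
    by (intro mult_left_mono) auto
  then have gain: "2 * r \<le> real k * entropy1 \<sigma> s - ln (real (p ^ d))"
    by (simp only: right_diff_distrib entropy1_s0) (simp add: r_def y0_def mult_ac)
  \<comment> \<open>Here the entropy exceeds ln (p^d) by at least 2 r: half of it makes the second
    moment term small, half is the margin for Chebyshev.\<close>
  define a where "a = ln (real (p ^ d)) + r"
  let ?B = "{x \<in> cube k. r \<le> \<bar>ln (mu \<sigma> k s x) + real k * entropy1 \<sigma> s\<bar>}"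
  let ?A = "{x \<in> cube k. exp (- a) < mu \<sigma> k s x}"
  have sub: "?A \<subseteq> ?B"
  proof
    fix x assume x: "x \<in> ?A"
    then have "ln (exp (- a)) < ln (mu \<sigma> k s x)"
      using mu_pos[OF s(1), of \<sigma> k x] by (simp only: mem_Collect_eq ln_less_cancel_iff exp_gt_zero)
    then have "r \<le> ln (mu \<sigma> k s x) + real k * entropy1 \<sigma> s" using gain by (simp add: a_def)
    then show "x \<in> ?B" using x by auto
  qed
  have "(\<Sum>x\<in>?A. mu \<sigma> k s x) \<le> (\<Sum>x\<in>?B. mu \<sigma> k s x)"
    by (intro sum_mono2[OF _ sub] mu_nonneg) auto
  also have "\<dots> \<le> real k * varentropy1 \<sigma> s / r\<^sup>2" by (rule mu_chebyshev[OF s(1) r])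
  also have "\<dots> \<le> 4 * varentropy_const c0 / (\<gamma>\<^sup>2 * y0)"
    unfolding r_def
  proof (rule chebyshev_ratio[OF y0_pos \<gamma>])
    have "varentropy1 \<sigma> s \<le> varentropy_const c0 * exp (- (2 * gap * s))"
      using c0_le_s0 s c by (intro varentropy1_le_exp) auto
    also have "\<dots> \<le> varentropy_const c0 * exp (- (2 * gap * s0))"
      using s(2) gap_pos varentropy_const_pos[OF c(1)] by (intro mult_left_mono) auto
    finally show "varentropy1 \<sigma> s \<le> varentropy_const c0 * (y0 / real k)" using k_pos by (simp add: y0_def)
  qed
  finally have tail: "(\<Sum>x\<in>?A. mu \<sigma> k s x) \<le> 4 * varentropy_const c0 / (\<gamma>\<^sup>2 * y0)" .
  have "real p ^ d * exp (- a) = exp (- r)"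
  proof -
    have "exp (- a) = exp (- r) / exp (ln (real (p ^ d)))" by (simp add: a_def exp_diff exp_minus exp_add field_simps)
    then show ?thesis using p_ge_2 by simp
  qed
  also have "sqrt \<dots> = exp (- (\<gamma> * y0 / 4))"
    by (rule real_sqrt_unique) (simp_all add: power2_eq_square exp_add[symmetric] r_def)
  finally have root: "sqrt (real p ^ d * exp (- a)) = exp (- (\<gamma> * y0 / 4))" .
  have "(\<Sum>Z\<in>set_pmf (Zlaw d k). pmf (Zlaw d k) Z *
      tv_to_uniform \<sigma> (Zpow p d) k ((1 + \<epsilon>) * entropic_time \<sigma> k p d) Z)
    \<le> sqrt (real p ^ d * exp (- a)) + 2 * (\<Sum>x\<in>?A. mu \<sigma> k s x)"
    using expectation_tv_to_uniform_le[OF p_prime k_pos, where t = "(1 + \<epsilon>) * entropic_time \<sigma> k p d" and a = a and \<sigma> = \<sigma>] \<epsilon> t0_pos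
    unfolding t0_eq s_def[symmetric] by simp
  then show ?thesis using tail unfolding root by simp
qed

text \<open>The bound for bounded \<open>y0\<close>. The exponent is a constant times
  \<open>y0\<close>^(1 + \<epsilon>) / k^\<epsilon>.\<close>

lemma tv_upper_large_time:
  assumes \<epsilon>: "0 < \<epsilon>" and Z: "Z \<in> set_pmf (Zlaw d k)" "Z \<in> generating (Zpow p d) k"
    and s0: "(real p)\<^sup>2 \<le> s0"
  shows "tv_to_uniform \<sigma> (Zpow p d) k ((1 + \<epsilon>) * entropic_time \<sigma> k p d) Z
    \<le> sqrt (exp (2 * exp (4 * pi\<^sup>2) * exp ((1 + \<epsilon>) * ln y0 - \<epsilon> * ln (real k))) - 1)"
proof -
  define s where "s = (1 + \<epsilon>) * s0"
  have s: "s0 \<le> s" using \<epsilon> s0_pos by (simp add: s_def)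
  have "tv_to_uniform \<sigma> (Zpow p d) k ((1 + \<epsilon>) * entropic_time \<sigma> k p d) Z \<le> sqrt (exp (real k * chisq s) - 1)"
    using tv_to_uniform_le_coordinate[OF k_pos _ Z, where t = "(1 + \<epsilon>) * entropic_time \<sigma> k p d" and \<sigma> = \<sigma>] \<epsilon> t0_pos
    unfolding t0_eq s_def[symmetric] by simp
  also have "\<dots> \<le> sqrt (exp (2 * exp (4 * pi\<^sup>2) * exp ((1 + \<epsilon>) * ln y0 - \<epsilon> * ln (real k))) - 1)"
  proof -
    have "real k * chisq s \<le> real k * (2 * exp (4 * pi\<^sup>2) * exp (- (2 * gap * s)))"
      using s s0 by (intro mult_left_mono chisq_decay) auto
    also have "\<dots> = 2 * exp (4 * pi\<^sup>2) * (exp (ln (real k)) * exp (- ((1 + \<epsilon>) * (2 * gap * s0))))"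
      using k_pos by (simp add: s_def mult_ac)
    also have "exp (ln (real k)) * exp (- ((1 + \<epsilon>) * (2 * gap * s0))) = exp ((1 + \<epsilon>) * ln y0 - \<epsilon> * ln (real k))"
      unfolding two_gap_s0 exp_add[symmetric] by (simp add: algebra_simps)
    finally show ?thesis by simp
  qed
  finally show ?thesis .
qed

end

section \<open>Convergence\<close>

text \<open>The lower bound holds for every Z, so the exceptional probability is eventually equal to
  0.\<close>

lemma cutoff_lower:
  fixes p d k :: "nat \<Rightarrow> nat"
  assumes ent: "\<forall>\<^sub>F N in sequentially. entropic (p N) (d N) (k N) C"
    and k: "filterlim k at_top sequentially"
    and \<epsilon>: "0 < \<epsilon>" "\<epsilon> < 1"
  shows "tends_in_distribution_to_const (\<lambda>N. iid_uniform_generating (Zpow (p N) (d N)) (k N))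
    (\<lambda>N. tv_to_uniform \<sigma> (Zpow (p N) (d N)) (k N) ((1 - \<epsilon>) * entropic_time \<sigma> (k N) (p N) (d N))) 1"
proof (rule tends_in_distribution_to_constI)
  fix \<eta> :: real assume \<eta>: "0 < \<eta>"
  let ?X = "\<lambda>N. tv_to_uniform \<sigma> (Zpow (p N) (d N)) (k N) ((1 - \<epsilon>) * entropic_time \<sigma> (k N) (p N) (d N))"
  have C: "0 < C"
    using eventually_happens'[OF sequentially_bot ent] by (auto dest: entropic.C_pos)
  define c where "c = (1 - \<epsilon>) * min_time (1 / C)"
  define \<gamma> where "\<gamma> = gain_const c \<epsilon>"
  define A where "A = 4 * varentropy_const c / \<gamma>\<^sup>2"
  define B where "B = \<gamma> / 2"
  have c: "0 < c" using \<epsilon> C min_time_pos by (simp add: c_def)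
  have \<gamma>: "0 < \<gamma>" unfolding \<gamma>_def by (rule gain_const_pos[OF c \<epsilon>(1)])
  have AB: "0 < A" "0 < B" using \<gamma> varentropy_const_pos[OF c] by (simp_all add: A_def B_def)
  define Y where "Y N = real (k N) * exp (- (2 * cycle.gap (p N) * ((1 - \<epsilon>) * entropic.s0 (p N) \<sigma> (d N) (k N))))" for N
  define L where "L = (1 - \<epsilon>) * ln (ln 2 / (2 * exp (4 * pi\<^sup>2)))"
  have "filterlim (\<lambda>x::real. exp (\<epsilon> * ln x + L)) at_top at_top"
    using \<epsilon>(1) by real_asymp
  then have "filterlim (\<lambda>N. exp (\<epsilon> * ln (real (k N)) + L)) at_top sequentially"
    by (rule filterlim_compose) (rule filterlim_compose[OF filterlim_real_sequentially k])
  then have "filterlim Y at_top sequentially"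
  proof (rule filterlim_at_top_mono)
    show "\<forall>\<^sub>F N in sequentially. exp (\<epsilon> * ln (real (k N)) + L) \<le> Y N"
      using ent by eventually_elim (unfold Y_def L_def, rule entropic.lower_scale_ge[OF _ \<epsilon>])
  qed
  moreover have "((\<lambda>y::real. 1 - A / y - exp (- (B * y))) \<longlongrightarrow> 1) at_top"
    using AB by real_asymp
  ultimately have "(\<lambda>N. 1 - A / Y N - exp (- (B * Y N))) \<longlonglongrightarrow> 1"
    by (rule filterlim_compose[rotated])
  then have "\<forall>\<^sub>F N in sequentially. 1 - \<eta> < 1 - A / Y N - exp (- (B * Y N))"
    by (rule order_tendstoD) (use \<eta> in simp)
  then have "\<forall>\<^sub>F N in sequentially. measure_pmf.prob (iid_uniform_generating (Zpow (p N) (d N)) (k N))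
      {Z. \<eta> < \<bar>?X N Z - 1\<bar>} = 0"
    using ent
  proof eventually_elim
    case (elim N)
    then interpret entropic "p N" \<sigma> "d N" "k N" C by simp
    have "?X N Z \<le> 1" "1 - \<eta> < ?X N Z"
      if "Z \<in> set_pmf (iid_uniform_generating (Zpow (p N) (d N)) (k N))" for Z
    proof -
      have "Z \<in> set_pmf (Zlaw (d N) (k N))"
        using that generating_nonempty[OF p_prime d_less_k] by (simp add: iid_uniform_generating_def)
      from tv_lower[OF \<epsilon> this] elim(1) show "1 - \<eta> < ?X N Z"
        by (simp add: A_def B_def Y_def \<gamma>_def c_def)
      show "?X N Z \<le> 1" by (simp add: tv_to_uniform_def tv_dist_le_1)
    qed
    then show ?case by (auto simp: measure_pmf_zero_iff disjoint_iff abs_real_def) (smt (verit) \<eta>)+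
  qed
  then show "(\<lambda>N. measure_pmf.prob (iid_uniform_generating (Zpow (p N) (d N)) (k N)) {Z. \<eta> < \<bar>?X N Z - 1\<bar>}) \<longlonglongrightarrow> 0"
    by (rule tendsto_eventually)
qed

text \<open>\<open>y0\<close> need not have a limit along the sequence, so the two arguments are
  separated index by index at a threshold \<open>y2\<close> fixed by the target error e, without
  passing to subsequences.\<close>

lemma cutoff_upper:
  fixes p d k :: "nat \<Rightarrow> nat"
  assumes ent: "\<forall>\<^sub>F N in sequentially. entropic (p N) (d N) (k N) C"
    and k: "filterlim k at_top sequentially"
    and \<epsilon>: "0 < \<epsilon>" "\<epsilon> < 1"
  shows "tends_in_distribution_to_const (\<lambda>N. iid_uniform_generating (Zpow (p N) (d N)) (k N))
    (\<lambda>N. tv_to_uniform \<sigma> (Zpow (p N) (d N)) (k N) ((1 + \<epsilon>) * entropic_time \<sigma> (k N) (p N) (d N))) 0"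
proof (rule tends_in_distribution_to_constI)
  fix \<eta> :: real assume \<eta>: "0 < \<eta>"
  let ?X = "\<lambda>N. tv_to_uniform \<sigma> (Zpow (p N) (d N)) (k N) ((1 + \<epsilon>) * entropic_time \<sigma> (k N) (p N) (d N))"
  let ?pr = "\<lambda>N. measure_pmf.prob (iid_uniform_generating (Zpow (p N) (d N)) (k N)) {Z. \<eta> < ?X N Z}"
  have C: "0 < C"
    using eventually_happens'[OF sequentially_bot ent] by (auto dest: entropic.C_pos)
  define c where "c = min_time (1 / C)"
  define \<gamma> where "\<gamma> = gain_const c \<epsilon>"
  define A where "A = 8 * varentropy_const c / \<gamma>\<^sup>2"
  define B where "B = \<gamma> / 4"
  have c: "0 < c" using C min_time_pos by (simp add: c_def)
  have \<gamma>: "0 < \<gamma>" unfolding \<gamma>_def by (rule gain_const_pos[OF c \<epsilon>(1)])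
  have AB: "0 < A" "0 < B" using \<gamma> varentropy_const_pos[OF c] by (simp_all add: A_def B_def)
  have k_real: "filterlim (\<lambda>N. real (k N)) at_top sequentially"
    by (rule filterlim_compose[OF filterlim_real_sequentially k])
  have "?pr \<longlonglongrightarrow> 0"
  proof (rule tendstoI)
    fix e :: real assume e: "0 < e"
    have "((\<lambda>y::real. 2 * (exp (- (B * y)) + A / y) / \<eta>) \<longlongrightarrow> 0) at_top"
      using AB \<eta> by real_asymp
    then have "\<forall>\<^sub>F y in at_top. 2 * (exp (- (B * y)) + A / y) / \<eta> < e"
      by (rule order_tendstoD) (use e in simp)
    then obtain y1 where y1: "\<And>y. y1 \<le> y \<Longrightarrow> 2 * (exp (- (B * y)) + A / y) / \<eta> < e"
      by (auto simp: eventually_at_top_linorder)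
    define y2 where "y2 = max 1 y1"
    have "((\<lambda>x::real. sqrt (exp (2 * exp (4 * pi\<^sup>2) * exp ((1 + \<epsilon>) * ln y2 - \<epsilon> * ln x)) - 1)) \<longlongrightarrow> 0) at_top"
    proof -
      have "((\<lambda>x::real. exp ((1 + \<epsilon>) * ln y2 - \<epsilon> * ln x)) \<longlongrightarrow> 0) at_top"
        using \<epsilon>(1) by real_asymp
      then have "((\<lambda>x::real. sqrt (exp (2 * exp (4 * pi\<^sup>2) * exp ((1 + \<epsilon>) * ln y2 - \<epsilon> * ln x)) - 1))
          \<longlongrightarrow> sqrt (exp (2 * exp (4 * pi\<^sup>2) * 0) - 1)) at_top"
        by (intro tendsto_intros)
      then show ?thesis by simp
    qed
    then have "((\<lambda>N. sqrt (exp (2 * exp (4 * pi\<^sup>2) * exp ((1 + \<epsilon>) * ln y2 - \<epsilon> * ln (real (k N)))) - 1)) \<longlonglongrightarrow> 0)"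
      by (rule filterlim_compose) (rule k_real)
    then have "\<forall>\<^sub>F N in sequentially.
        sqrt (exp (2 * exp (4 * pi\<^sup>2) * exp ((1 + \<epsilon>) * ln y2 - \<epsilon> * ln (real (k N)))) - 1) < \<eta>"
      by (rule order_tendstoD) (use \<eta> in simp)
    moreover have "\<forall>\<^sub>F N in sequentially. y2 * exp (4 * pi\<^sup>2) \<le> real (k N)"
      using k_real by (simp add: filterlim_at_top)
    ultimately show "\<forall>\<^sub>F N in sequentially. dist (?pr N) 0 < e"
      using ent
    proof eventually_elim
      case (elim N)
      then interpret entropic "p N" \<sigma> "d N" "k N" C by simp
      show ?case
      proof (cases "y2 \<le> y0")
        case True
        have "?pr N \<le> 2 * (\<Sum>Z\<in>set_pmf (Zlaw (d N) (k N)). pmf (Zlaw (d N) (k N)) Z * ?X N Z) / \<eta>"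
          by (rule prob_conditioned_le[OF p_prime d_less_k \<eta>])
        also have "\<dots> \<le> 2 * (exp (- (B * y0)) + A / y0) / \<eta>"
          using expectation_tv_upper[OF \<epsilon>] \<eta>
          by (intro divide_right_mono mult_left_mono) (auto simp: A_def B_def \<gamma>_def c_def)
        also have "\<dots> < e" using True by (intro y1) (simp add: y2_def)
        finally show ?thesis by simp
      next
        case False
        \<comment> \<open>Before p^2, \<open>y0\<close> is at least a constant times k and would
          exceed the fixed threshold.\<close>
        have "\<not> s0 \<le> (real (p N))\<^sup>2"
        proof
          assume "s0 \<le> (real (p N))\<^sup>2"
          then have "real (k N) * exp (- (4 * pi\<^sup>2)) < y2"
            using y0_ge_small_time False by linarith
          then show False using elim(2) by (simp add: exp_minus field_simps)
        qed
        then have s0: "(real (p N))\<^sup>2 \<le> s0" by simp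
        have "\<not> \<eta> < ?X N Z" if "Z \<in> set_pmf (iid_uniform_generating (Zpow (p N) (d N)) (k N))" for Z
        proof -
          have Z: "Z \<in> set_pmf (Zlaw (d N) (k N))" "Z \<in> generating (Zpow (p N) (d N)) (k N)"
            using that generating_nonempty[OF p_prime d_less_k] by (simp_all add: iid_uniform_generating_def)
          have "ln y0 \<le> ln y2" using False y0_pos by (intro ln_mono) auto
          then have "(1 + \<epsilon>) * ln y0 \<le> (1 + \<epsilon>) * ln y2" using \<epsilon> by (intro mult_left_mono) auto
          then have "sqrt (exp (2 * exp (4 * pi\<^sup>2) * exp ((1 + \<epsilon>) * ln y0 - \<epsilon> * ln (real (k N)))) - 1)
              \<le> sqrt (exp (2 * exp (4 * pi\<^sup>2) * exp ((1 + \<epsilon>) * ln y2 - \<epsilon> * ln (real (k N)))) - 1)"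
            by simp
          with tv_upper_large_time[OF \<epsilon>(1) Z s0] elim(1) show ?thesis by linarith
        qed
        then have "?pr N = 0" by (auto simp: measure_pmf_zero_iff disjoint_iff)
        then show ?thesis using e by simp
      qed
    qed
  qed
  then show "(\<lambda>N. measure_pmf.prob (iid_uniform_generating (Zpow (p N) (d N)) (k N)) {Z. \<eta> < \<bar>?X N Z - 0\<bar>}) \<longlonglongrightarrow> 0"
    by (simp add: tv_to_uniform_def tv_dist_nonneg)
qed

lemma generating_whp:
  fixes p d k :: "nat \<Rightarrow> nat"
  assumes prime: "\<And>N. prime (p N)"
    and lim: "filterlim (\<lambda>N. (real (k N) - real (d N)) * real (p N)) at_top sequentially"
  shows "(\<lambda>N. measure_pmf.prob (iid_uniform (Zpow (p N) (d N)) (k N)) (generating (Zpow (p N) (d N)) (k N))) \<longlonglongrightarrow> 1"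
proof -
  let ?pr = "\<lambda>N. measure_pmf.prob (iid_uniform (Zpow (p N) (d N)) (k N)) (generating (Zpow (p N) (d N)) (k N))"
  let ?m = "\<lambda>N. (real (k N) - real (d N)) * real (p N)"
  have "(\<lambda>N. 1 - 1 / ?m N) \<longlonglongrightarrow> 1 - 0"
    by (intro tendsto_diff tendsto_const tendsto_divide_0[OF tendsto_const] filterlim_at_top_imp_at_infinity lim)
  then have "(\<lambda>N. 1 - 1 / ?m N) \<longlonglongrightarrow> 1" by simp
  moreover have "\<forall>\<^sub>F N in sequentially. 1 - 1 / ?m N \<le> ?pr N"
  proof -
    have "\<forall>\<^sub>F N in sequentially. 1 \<le> ?m N" using lim by (simp add: filterlim_at_top)
    then show ?thesis
    proof eventually_elim
      case (elim N)
      interpret cycle "p N" by unfold_locales (rule prime_ge_2_nat[OF prime])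
      have "0 < real (k N) - real (d N)" using elim by (metis less_le_trans not_less_iff_gr_or_eq of_nat_0_less_iff p_pos zero_less_mult_pos2 zero_less_one)
      then have dk: "d N < k N" by simp
      define m where "m = k N - d N"
      have m: "1 \<le> m" using dk by (simp add: m_def)
      \<comment> \<open>With m = k - d this leads to m p \<le> p^m, so (k - d) p tending to infinity
        forces p^(k - d) to do so.\<close>
      have "m \<le> 2 ^ (m - 1)" using less_exp[of "m - 1"] m by linarith
      also have "\<dots> \<le> p N ^ (m - 1)" using p_ge_2 by (intro power_mono) auto
      finally have "m * p N \<le> p N ^ (m - 1) * p N" by (rule mult_le_mono1)
      also have "\<dots> = p N ^ m" using m by (metis One_nat_def Suc_pred' mult.commute not_one_le_zero power_Suc zero_less_iff_neq_zero)
      finally have "real (m * p N) \<le> real (p N ^ m)" by (rule of_nat_mono)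
      then have "?m N \<le> real (p N) ^ m" using dk by (simp add: m_def of_nat_diff)
      then have "1 / real (p N) ^ m \<le> 1 / ?m N" using dk p_ge_2 by (intro divide_left_mono mult_pos_pos) auto
      moreover have "real (p N) ^ d N / real (p N) ^ k N = 1 / real (p N) ^ m"
        using dk p_ge_2 by (simp add: m_def power_diff)
      ultimately have "measure_pmf.prob (Zlaw (d N) (k N)) (- generating (Zpow (p N) (d N)) (k N)) \<le> 1 / ?m N"
        using prob_not_generating_le[OF prime, of "d N" "k N"] by linarith
      moreover have "measure_pmf.prob (Zlaw (d N) (k N)) (- generating (Zpow (p N) (d N)) (k N)) = 1 - ?pr N"
        using measure_pmf.prob_compl[of "generating (Zpow (p N) (d N)) (k N)" "Zlaw (d N) (k N)"]
        by (simp add: Compl_eq_Diff_UNIV)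
      ultimately show ?case by linarith
    qed
  qed
  ultimately show ?thesis
    by (rule tendsto_sandwich[OF _ _ _ tendsto_const, rotated 2]) auto
qed

theorem theorem2:
  fixes p d k :: "nat \<Rightarrow> nat" and \<sigma> :: orientation
  assumes prime: "\<And>N. prime (p N)"
    and k_ge_d: "\<And>N. d N \<le> k N"
    and card_G: "filterlim (\<lambda>N. p N ^ d N) at_top sequentially"
    and k_large: "filterlim k at_top sequentially"
    and k_bound: "(\<lambda>N. real (k N)) \<in> O(\<lambda>N. ln (real (p N ^ d N)))"
  shows
    "((\<forall>\<^sub>F N in sequentially. d N < k N) \<longrightarrow>
        cutoff_whp (\<lambda>N. iid_uniform_generating (Zpow (p N) (d N)) (k N))
          (\<lambda>N. tv_to_uniform \<sigma> (Zpow (p N) (d N)) (k N))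
          (\<lambda>N. entropic_time \<sigma> (k N) (p N) (d N)))
     \<and> (filterlim (\<lambda>N. (real (k N) - real (d N)) * real (p N)) at_top sequentially \<longrightarrow>
        (\<lambda>N. measure_pmf.prob (iid_uniform (Zpow (p N) (d N)) (k N))
               (generating (Zpow (p N) (d N)) (k N))) \<longlonglongrightarrow> 1)"
proof (intro conjI impI)
  assume less: "\<forall>\<^sub>F N in sequentially. d N < k N"
  obtain C where C: "0 < C" "\<forall>\<^sub>F N in sequentially. norm (real (k N)) \<le> C * norm (ln (real (p N ^ d N)))"
    using k_bound by (rule landau_o.bigE)
  have "\<forall>\<^sub>F N in sequentially. 2 \<le> p N ^ d N" using card_G by (simp add: filterlim_at_top)
  then have "\<forall>\<^sub>F N in sequentially. entropic (p N) (d N) (k N) C"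
    using less C(2)
  proof eventually_elim
    case (elim N)
    have "0 < d N" using elim(1) by (cases "d N") auto
    moreover have "1 \<le> real (p N ^ d N)" using elim(1) by linarith
    then have "0 \<le> ln (real (p N ^ d N))" by (rule ln_ge_zero)
    ultimately show ?case
      using elim prime[of N] C(1) prime_ge_2_nat[OF prime, of N] by unfold_locales auto
  qed
  then show "cutoff_whp (\<lambda>N. iid_uniform_generating (Zpow (p N) (d N)) (k N))
          (\<lambda>N. tv_to_uniform \<sigma> (Zpow (p N) (d N)) (k N))
          (\<lambda>N. entropic_time \<sigma> (k N) (p N) (d N))"
    unfolding cutoff_whp_def using cutoff_lower cutoff_upper k_large by blast
next
  assume "filterlim (\<lambda>N. (real (k N) - real (d N)) * real (p N)) at_top sequentially"
  then show "(\<lambda>N. measure_pmf.prob (iid_uniform (Zpow (p N) (d N)) (k N))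
      (generating (Zpow (p N) (d N)) (k N))) \<longlonglongrightarrow> 1"
    by (rule generating_whp[OF prime])
qed

end
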